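(* Assume that $\alpha\in(0,1)$ and $\beta\in(0,2]$, and that the $\xi_y$ are $\mathbb{Z}$-valued. For $x\in\mathbb{R}$ let $D(x):=r f_\beta(rx)$, with $r:=\mathbb{E}\left[\widetilde N_\infty(0)^{\beta-1}\right]^{-1/\beta}$. Then for all $n\ge1$ and $x\in\mathbb{R}$: (1) if $\mathbb{P}\left(n\xi_1-\lfloor n^{1/\beta}x\rfloor\notin d\mathbb{Z}\right)=1$, then $\mathbb{P}\left(Z_n=\lfloor n^{1/\beta}x\rfloor\right)=0$; (2) if $\mathbb{P}\left(n\xi_1-\lfloor n^{1/\beta}x\rfloor\in d\mathbb{Z}\right)=1$, then $$\mathbb{P}\left(Z_n=\lfloor n^{1/\beta}x\rfloor\right)=d\,\frac{D(x)}{n^{1/\beta}}+o(n^{-1/\beta}),$$ where the $o(n^{-1/\beta})$ (as $n\to\infty$) is uniform in $x$.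
   Context: $\xi=(\xi_y)_{y\in\mathbb{Z}}$ and $X=(X_k)_{k\ge1}$ are two independent sequences of i.i.d. random variables, the $X_k$ taking values in $\mathbb{Z}$. The law of $\xi_1$ is in the normal domain of attraction of a strictly stable law $\mathcal{S}_\beta$ of index $\beta$ (that is, $n^{-1/\beta}(\xi_1+\dots+\xi_n)$ converges in distribution to $\mathcal{S}_\beta$), with characteristic function $\phi(u)=e^{-|u|^\beta(A_1+iA_2\,\mathrm{sgn}(u))}$, where $0<A_1<\infty$ and $|A_1^{-1}A_2|\le|\tan(\pi\beta/2)|$ (no restriction on $A_2\in\mathbb{R}$ if $\beta=1$); $f_\beta$ denotes the density of $\mathcal{S}_\beta$. The law of $X_1$ is in the normal domain of attraction of a strictly stable law $\mathcal{S}_\alpha$ of index $\alpha$ (that is, $n^{-1/\alpha}(X_1+\dots+X_n)$ converges in distribution to $\mathcal{S}_\alpha$). $S_0:=0$, $S_n:=\sum_{i=1}^nX_i$, and $Z_n:=\sum_{k=0}^{n-1}\xi_{S_k}$ for $n\ge1$. $\widetilde N_\infty(0)$ is the total time spent at $0$ by the two-sided random walk $(S_k)_{k\in\mathbb{Z}}$, i.e. $\widetilde N_\infty(0)=\#\{k\in\mathbb{Z}:S_k=0\}$, where $S_{-k}:=-\sum_{m=1}^kX_{-m}$ for $k\ge1$ and $(X_{-k})_{k\ge1}$ is an independent copy of $(X_k)_{k\ge1}$. $\varphi_\xi(u):=\mathbb{E}[e^{iu\xi_1}]$, and $d\ge1$ is the integer such that $\{u\in\mathbb{R}:|\varphi_\xi(u)|=1\}=\frac{2\pi}{d}\mathbb{Z}$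 (equivalently $d$ is the g.c.d. of the set of $b-c$ with $b,c$ in the support of the law of $\xi_1$). *)

theory Defs
  imports "HOL-Probability.Probability" "HOL-Library.Landau_Symbols"
begin

definition (in prob_space) iid_on :: "int set \<Rightarrow> (int \<Rightarrow> 'a \<Rightarrow> int) \<Rightarrow> bool" where
  "iid_on I Y \<longleftrightarrow>
     indep_vars (\<lambda>_. count_space UNIV) Y I \<and>
     (\<forall>i\<in>I. \<forall>j\<in>I. distr M (count_space UNIV) (Y i) = distr M (count_space UNIV) (Y j))"

definition (in prob_space) indep_families ::
    "int set \<Rightarrow> (int \<Rightarrow> 'a \<Rightarrow> int) \<Rightarrow> int set \<Rightarrow> (int \<Rightarrow> 'a \<Rightarrow> int) \<Rightarrow> bool" where
  "indep_families I Y J Y' \<longleftrightarrow>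
     indep_var (PiM I (\<lambda>_. count_space UNIV)) (\<lambda>\<omega>. \<lambda>i\<in>I. Y i \<omega>)
               (PiM J (\<lambda>_. count_space UNIV)) (\<lambda>\<omega>. \<lambda>j\<in>J. Y' j \<omega>)"

definition (in prob_space) indep_copy ::
    "int set \<Rightarrow> (int \<Rightarrow> 'a \<Rightarrow> int) \<Rightarrow> (int \<Rightarrow> 'a \<Rightarrow> int) \<Rightarrow> bool" where
  "indep_copy I Y' Y \<longleftrightarrow>
     indep_families I Y' I Y \<and>
     distr M (PiM I (\<lambda>_. count_space UNIV)) (\<lambda>\<omega>. \<lambda>i\<in>I. Y' i \<omega>) =
     distr M (PiM I (\<lambda>_. count_space UNIV)) (\<lambda>\<omega>. \<lambda>i\<in>I. Y i \<omega>)"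

text \<open>Strict stability in its defining form: for independent copies \<open>U, V\<close> of a
  non-degenerate variable with law \<open>\<mu>\<close> and \<open>a, b > 0\<close>, the variable \<open>a U + b V\<close> has the law
  of \<open>(a\<^sup>\<alpha> + b\<^sup>\<alpha>)\<^bsup>1/\<alpha>\<^esup> U\<close>. Point masses are excluded, as usual; without this the unit mass
  at \<open>0\<close> would satisfy the identity for every \<open>\<alpha>\<close>.\<close>

definition strictly_stable :: "real \<Rightarrow> real measure \<Rightarrow> bool" where
  "strictly_stable \<alpha> \<mu> \<longleftrightarrow>
     0 < \<alpha> \<and> \<alpha> \<le> 2 \<and> real_distribution \<mu> \<and> (\<forall>c. \<mu> \<noteq> return borel c) \<and>
     (\<forall>a>0. \<forall>b>0. distr (\<mu> \<Otimes>\<^sub>M \<mu>) borel (\<lambda>(x, y). a * x + b * y) =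
        distr \<mu> borel (\<lambda>x. (a powr \<alpha> + b powr \<alpha>) powr (1 / \<alpha>) * x))"

definition stable_char :: "real \<Rightarrow> real \<Rightarrow> real \<Rightarrow> real \<Rightarrow> complex" where
  "stable_char \<beta> A1 A2 u =
     exp (- (complex_of_real (\<bar>u\<bar> powr \<beta>) *
             (complex_of_real A1 + \<i> * complex_of_real A2 * complex_of_real (sgn u))))"

text \<open>A density is determined only almost everywhere; since it is evaluated pointwise below,
  the continuous version is meant.\<close>

definition continuous_density :: "real measure \<Rightarrow> real \<Rightarrow> real" where
  "continuous_density \<mu> =
     (THE f. continuous_on UNIV f \<and> (\<forall>x. 0 \<le> f x) \<and> \<mu> = density lborel (\<lambda>x. ennreal (f x)))"

definition normal_attraction ::
    "'a measure \<Rightarrow> (int \<Rightarrow> 'a \<Rightarrow> int) \<Rightarrow> real \<Rightarrow> real measure \<Rightarrow> bool" where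
  "normal_attraction M Y \<alpha> \<mu> \<longleftrightarrow>
     strictly_stable \<alpha> \<mu> \<and>
     weak_conv_m
       (\<lambda>n. distr M borel
          (\<lambda>\<omega>. real n powr (- 1 / \<alpha>) * (\<Sum>i = 1..int n. real_of_int (Y i \<omega>)))) \<mu>"

text \<open>The steps are \<open>X k\<close> for \<open>k \<noteq> 0\<close>; the value \<open>X 0\<close> is never used.\<close>

definition walk :: "(int \<Rightarrow> 'a \<Rightarrow> int) \<Rightarrow> int \<Rightarrow> 'a \<Rightarrow> int" where
  "walk X k \<omega> = (if 0 \<le> k then \<Sum>i = 1..k. X i \<omega> else - (\<Sum>m = 1..- k. X (- m) \<omega>))"

definition scenery_sum ::
    "(int \<Rightarrow> 'a \<Rightarrow> int) \<Rightarrow> (int \<Rightarrow> 'a \<Rightarrow> int) \<Rightarrow> nat \<Rightarrow> 'a \<Rightarrow> int" where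
  "scenery_sum \<xi> X n \<omega> = (\<Sum>k<n. \<xi> (walk X (int k) \<omega>) \<omega>)"

text \<open>For steps attracted to a stable law of index \<open>\<alpha> < 1\<close> the walk is transient, so the set
  below is almost surely finite and the convention for \<open>card\<close> of infinite sets is immaterial.\<close>

definition total_time_at_0 :: "(int \<Rightarrow> 'a \<Rightarrow> int) \<Rightarrow> 'a \<Rightarrow> nat" where
  "total_time_at_0 X \<omega> = card {k. walk X k \<omega> = 0}"

end

theory Submission
  imports Defs "HOL-Real_Asymp.Real_Asymp"
begin

text \<open>Let \<open>S\<close> be the walk, \<open>N\<^sub>n(y)\<close> the number of its visits to \<open>y\<close> before time \<open>n\<close>, and \<open>\<phi>\<close> the
characteristic function of \<open>\<xi>\<^sub>1\<close>. Given the path, \<open>Z\<^sub>n\<close> is the sum of the independent variables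
\<open>N\<^sub>n(y) \<xi>\<^sub>y\<close>, so its characteristic function at \<open>t\<close> is the mean over paths of
\<open>\<Prod>\<^sub>y \<phi>(t N\<^sub>n(y))\<close> (\<open>char_scenery_sum\<close>). The scenery lives in one coset of \<open>d\<int>\<close>, which settles
the impossible values. For the others, Fourier inversion on a coset of \<open>d\<int>\<close> expresses
\<open>n\<^bsup>1/\<beta>\<^esup> P(Z\<^sub>n = m)\<close> as \<open>d/(2\<pi>)\<close> times the integral of \<open>exp(-i u m n\<^bsup>-1/\<beta>\<^esup>) \<Phi>\<^sub>n(u)\<close> over
\<open>\<bar>u\<bar> \<le> \<pi> n\<^bsup>1/\<beta>\<^esup>/d\<close>, where \<open>\<Phi>\<^sub>n(u)\<close> is the characteristic function of \<open>n\<^bsup>-1/\<beta>\<^esup> Z\<^sub>n\<close>. The claimed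
limit \<open>d D(x)\<close> is the same integral, over the whole line, of
\<open>exp(-i u x) \<Psi>(u)\<close> with \<open>\<Psi>(u) = exp(-v \<bar>u\<bar>\<^sup>\<beta> (A\<^sub>1 + i A\<^sub>2 sgn u))\<close> and
\<open>v = E(N\<^bsup>\<beta>-1\<^esup>)\<close>, \<open>N\<close> being the total time at the origin. The point \<open>x\<close> enters only through a
factor of modulus one, so convergence of the truncated \<open>\<Phi>\<^sub>n\<close> to \<open>\<Psi>\<close> in \<open>L\<^sup>1\<close> is enough and gives
uniformity in \<open>x\<close> (\<open>local_limit_error\<close>, \<open>L1_convergence_truncated\<close>).

Pointwise convergence (\<open>rwrs_char_tendsto\<close>). Near \<open>0\<close> the function \<open>\<phi>\<close> agrees with the stable
characteristic function up to \<open>o(\<bar>u\<bar>\<^sup>\<beta>)\<close>, so the product over sites is close to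
\<open>exp(-\<bar>u\<bar>\<^sup>\<beta> (A\<^sub>1 + i A\<^sub>2 sgn u) V)\<close> with \<open>V = n\<^sup>-\<^sup>1 \<Sum>\<^sub>y N\<^sub>n(y)\<^sup>\<beta>\<close>. Counting the sites along the path,
\<open>V\<close> is the mean of \<open>N\<^sub>n(S\<^sub>k)\<^bsup>\<beta>-1\<^esup>\<close> over the times \<open>k < n\<close>. The probability that \<open>S\<^sub>k\<close>
takes a given value is at most \<open>C k\<^bsup>-1/\<alpha>\<^esup>\<close>, which is summable because \<open>\<alpha> < 1\<close>. Visits that are far
apart in time are therefore negligible in mean, and counts of visits in a bounded window of times
have finite range of dependence; the law of large numbers \<open>V \<longrightarrow> v\<close> in \<open>L\<^sup>1\<close> follows
(\<open>mean_visit_count_tendsto\<close>, \<open>window_mean_tendsto_total_time\<close>).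

Domination (\<open>norm_rwrs_char_le\<close>). If \<open>\<bar>t\<bar> \<le> \<pi>/d\<close>, then \<open>\<bar>\<phi>(t)\<bar> \<le> exp(-\<sigma> \<bar>t\<bar>\<^sup>\<beta>)\<close>, while a multiple of
\<open>t\<close> can hit the lattice on which \<open>\<bar>\<phi>\<bar> = 1\<close>. So only the sites visited exactly once are used: if there are at
least \<open>c n\<close> of them, the product is at most \<open>exp(-\<sigma> c \<bar>u\<bar>\<^sup>\<beta>)\<close>. The probability of fewer than \<open>c n\<close> such
sites has to be \<open>o(n\<^bsup>-1/\<beta>\<^esup>)\<close> to compensate for the length of the range of integration. It is in fact smaller
than any power of \<open>n\<close> (\<open>prob_few_visited_once\<close>): take windows of \<open>m\<close> times, \<open>m\<close> about \<open>n\<^sup>g\<close> with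
\<open>\<alpha> < g < 1\<close>. A step sum over a window hits one of at most \<open>n\<close> prescribed values with probability at most
\<open>C n m\<^bsup>-1/\<alpha>\<^esup>\<close>, which tends to \<open>0\<close>, and times in a fixed residue class modulo \<open>2m + 1\<close> behave
independently enough for a bound that is exponential in \<open>n/m\<close>.\<close>

section \<open>Characteristic functions and convergence to a stable law\<close>

lemma norm_iexp_diff_le: "cmod (iexp x - iexp y) \<le> \<bar>x - y\<bar>"
proof -
  have "iexp x - iexp y = iexp y * (iexp (x - y) - 1)"
    by (simp add: algebra_simps exp_diff)
  then have "cmod (iexp x - iexp y) = cmod (iexp (x - y) - 1)"
    by (simp add: norm_mult)
  also have "\<dots> \<le> \<bar>x - y\<bar>"
    using iexp_approx1[of "x - y" 0] by simp
  finally show ?thesis .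
qed

text \<open>By Skorohod's theorem the convergence may be taken almost sure, and then the difference is at most the mean of
\<open>min 2 \<bar>Y\<^sub>n - Y\<bar>\<close>, simultaneously for all \<open>\<bar>u\<bar> \<le> 1\<close>.\<close>

lemma char_weak_conv_uniform:
  assumes \<mu>: "\<And>n. real_distribution (\<mu> n)" and M: "real_distribution M"
    and conv: "weak_conv_m \<mu> M" and "0 < e"
  shows "\<exists>J. \<forall>n\<ge>J. \<forall>u. \<bar>u\<bar> \<le> 1 \<longrightarrow> cmod (char (\<mu> n) u - char M u) < e"
proof -
  obtain \<Omega> :: "real measure" and Yn :: "nat \<Rightarrow> real \<Rightarrow> real" and Y :: "real \<Rightarrow> real"
    where \<Omega>: "prob_space \<Omega>" and Yn[measurable]: "\<And>n. Yn n \<in> borel_measurable \<Omega>"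
      and dYn: "\<And>n. distr \<Omega> borel (Yn n) = \<mu> n"
      and Y: "Y \<in> measurable \<Omega> lborel" and dY: "distr \<Omega> borel Y = M"
      and lim: "\<And>x. x \<in> space \<Omega> \<Longrightarrow> (\<lambda>n. Yn n x) \<longlonglongrightarrow> Y x"
    using Skorohod[OF \<mu> M conv] by blast
  interpret prob_space \<Omega> by (fact \<Omega>)
  have Y'[measurable]: "Y \<in> borel_measurable \<Omega>" using Y by simp
  have "(\<lambda>n. \<integral>x. min 2 \<bar>Yn n x - Y x\<bar> \<partial>\<Omega>) \<longlonglongrightarrow> (\<integral>x. 0 \<partial>\<Omega>)"
  proof (rule integral_dominated_convergence[where w="\<lambda>_. 2"])
    show "AE x in \<Omega>. (\<lambda>n. min 2 \<bar>Yn n x - Y x\<bar>) \<longlonglongrightarrow> 0"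
    proof (rule AE_I2)
      fix x assume "x \<in> space \<Omega>"
      then have "(\<lambda>n. min 2 \<bar>Yn n x - Y x\<bar>) \<longlonglongrightarrow> min 2 \<bar>Y x - Y x\<bar>"
        by (intro tendsto_intros lim)
      then show "(\<lambda>n. min 2 \<bar>Yn n x - Y x\<bar>) \<longlonglongrightarrow> 0" by simp
    qed
  qed auto
  then have "eventually (\<lambda>n. (\<integral>x. min 2 \<bar>Yn n x - Y x\<bar> \<partial>\<Omega>) < e) sequentially"
    using \<open>0 < e\<close> by (auto simp: order_tendsto_iff)
  then obtain J where J: "\<And>n. n \<ge> J \<Longrightarrow> (\<integral>x. min 2 \<bar>Yn n x - Y x\<bar> \<partial>\<Omega>) < e"
    by (auto simp: eventually_sequentially)
  have "cmod (char (\<mu> n) u - char M u) < e" if "n \<ge> J" "\<bar>u\<bar> \<le> 1" for n u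
  proof -
    have "char (\<mu> n) u - char M u = (CLINT x|\<Omega>. iexp (u * Yn n x)) - (CLINT x|\<Omega>. iexp (u * Y x))"
      unfolding dYn[symmetric] dY[symmetric] char_def
      by (simp add: integral_distr)
    also have "\<dots> = (CLINT x|\<Omega>. iexp (u * Yn n x) - iexp (u * Y x))"
      by (intro Bochner_Integration.integral_diff[symmetric] integrable_const_bound[where B=1]) auto
    also have "cmod \<dots> \<le> (\<integral>x. cmod (iexp (u * Yn n x) - iexp (u * Y x)) \<partial>\<Omega>)"
      by (rule integral_norm_bound)
    also have "\<dots> \<le> (\<integral>x. min 2 \<bar>Yn n x - Y x\<bar> \<partial>\<Omega>)"
    proof (rule integral_mono)
      show "integrable \<Omega> (\<lambda>x. cmod (iexp (u * Yn n x) - iexp (u * Y x)))"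
        by (intro integrable_const_bound[where B=2] AE_I2)
           (auto intro: order_trans[OF norm_triangle_ineq4])
      show "integrable \<Omega> (\<lambda>x. min 2 \<bar>Yn n x - Y x\<bar>)"
        by (intro integrable_const_bound[where B=2] AE_I2) auto
      fix x
      have "cmod (iexp (u * Yn n x) - iexp (u * Y x)) \<le> 2"
        by (rule order_trans[OF norm_triangle_ineq4]) simp
      moreover have "cmod (iexp (u * Yn n x) - iexp (u * Y x)) \<le> \<bar>u * Yn n x - u * Y x\<bar>"
        by (rule norm_iexp_diff_le)
      moreover have "\<bar>u * Yn n x - u * Y x\<bar> \<le> \<bar>Yn n x - Y x\<bar>"
        using mult_right_mono[OF that(2), of "\<bar>Yn n x - Y x\<bar>"]
        by (simp add: abs_mult[symmetric] algebra_simps)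
      ultimately show "cmod (iexp (u * Yn n x) - iexp (u * Y x)) \<le> min 2 \<bar>Yn n x - Y x\<bar>"
        by simp
    qed
    also have "\<dots> < e" using J that by simp
    finally show ?thesis .
  qed
  then show ?thesis by blast
qed

text \<open>Equality in \<open>\<bar>E Z\<bar> \<le> E \<bar>Z\<bar>\<close> for a variable \<open>Z\<close> on the unit circle: after rotation by the conjugate of the
mean the real part of \<open>Z\<close> is at most \<open>1\<close> and has mean \<open>1\<close>.\<close>

lemma (in prob_space) AE_iexp_eq_of_norm_one:
  assumes [measurable]: "X \<in> borel_measurable M"
    and one: "cmod (CLINT x|M. iexp (u * X x)) = 1"
  shows "AE x in M. iexp (u * X x) = (CLINT x|M. iexp (u * X x))"
proof -
  define c where "c = (CLINT x|M. iexp (u * X x))"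
  have int: "integrable M (\<lambda>x. iexp (u * X x))"
    by (intro integrable_const_bound[where B=1]) auto
  have cc: "c * cnj c = 1" using one by (simp add: c_def complex_norm_square[symmetric])
  have nn: "0 \<le> 1 - Re (cnj c * iexp (u * X x))" for x
  proof -
    have "Re (cnj c * iexp (u * X x)) \<le> cmod (cnj c * iexp (u * X x))" by (rule complex_Re_le_cmod)
    then show ?thesis using one by (simp add: norm_mult c_def)
  qed
  have "(CLINT x|M. cnj c * iexp (u * X x)) = cnj c * c"
    using int by (simp add: c_def)
  then have "(\<integral>x. Re (cnj c * iexp (u * X x)) \<partial>M) = Re (cnj c * c)"
    using int by (subst integral_Re) auto
  then have "(\<integral>x. 1 - Re (cnj c * iexp (u * X x)) \<partial>M) = 0"
    using int cc by (subst Bochner_Integration.integral_diff) (auto simp: prob_space mult.commute intro!: integrable_Re)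
  then have "AE x in M. 1 - Re (cnj c * iexp (u * X x)) = 0"
    using int nn by (subst (asm) integral_nonneg_eq_0_iff_AE)
      (auto intro!: integrable_Re Bochner_Integration.integrable_diff)
  then show ?thesis unfolding c_def[symmetric]
  proof (eventually_elim)
    case (elim x)
    define z where "z = cnj c * iexp (u * X x)"
    have "cmod z = 1" using one by (simp add: z_def norm_mult c_def)
    moreover have "Re z = 1" using elim by (simp add: z_def)
    ultimately have "z = 1" by (simp add: complex_eq_iff cmod_def)
    then have "c * z = c" by simp
    then show ?case using cc by (simp add: z_def mult.assoc[symmetric])
  qed
qed

lemma iexp_eq_1_small:
  assumes "iexp x = 1" "\<bar>x\<bar> < 2 * pi" shows "x = 0"
proof -
  from assms(1) have "cis x = 1" by (simp add: cis_conv_exp)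
  then have "cos x = 1" by (simp add: complex_eq_iff)
  then obtain k :: int where "x = real_of_int k * 2 * pi" using cos_one_2pi_int by auto
  moreover from this assms(2) have "\<bar>real_of_int k\<bar> * (2 * pi) < 1 * (2 * pi)" by (simp add: abs_mult)
  then have "\<bar>real_of_int k\<bar> < 1" using pi_gt_zero mult_less_cancel_right_pos[of "2 * pi"] by simp
  ultimately show ?thesis by simp
qed

lemma (in real_distribution) eq_return_of_AE_eq:
  assumes "AE x in M. x = c"
  shows "M = return borel c"
proof (rule measure_eqI)
  show "sets M = sets (return borel c)" by simp
  fix A assume A: "A \<in> sets M"
  then have A': "A \<in> sets borel" by simp
  show "emeasure M A = emeasure (return borel c) A"
  proof (cases "c \<in> A")
    case True
    have "emeasure M A = 1"
      using A assms True by (intro emeasure_eq_1_AE) auto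
    with True A' show ?thesis by simp
  next
    case False
    have "AE x in M. x \<notin> A" using assms False by (auto)
    then have "emeasure M A = 0" using A by (subst (asm) AE_iff_measurable[of A]) (auto simp: sets.sets_into_space)
    with False A' show ?thesis by simp
  qed
qed

text \<open>Stability with \<open>a = b = 1\<close> squares the characteristic function under \<open>u \<mapsto> 2\<^bsup>1/\<alpha>\<^esup> u\<close>. Modulus one at one
point \<open>u\<close> thus spreads to all points \<open>2\<^bsup>-k/\<alpha>\<^esup> u\<close>, so the law sits on lattices of arbitrarily large
mesh through a common point and is degenerate.\<close>

lemma char_strictly_stable_less_1:
  assumes st: "strictly_stable \<alpha> \<mu>" and "u \<noteq> 0"
  shows "cmod (char \<mu> u) < 1"
proof (rule ccontr)
  assume not: "\<not> cmod (char \<mu> u) < 1"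
  from st have \<alpha>: "0 < \<alpha>" and rd: "real_distribution \<mu>" and nondeg: "\<And>c. \<mu> \<noteq> return borel c"
    and eq: "distr (\<mu> \<Otimes>\<^sub>M \<mu>) borel (\<lambda>(x, y). 1 * x + 1 * y) =
        distr \<mu> borel (\<lambda>x. (1 powr \<alpha> + 1 powr \<alpha>) powr (1 / \<alpha>) * x)"
    unfolding strictly_stable_def by (blast, blast, blast, metis zero_less_one)
  interpret real_distribution \<mu> by fact
  interpret P: pair_prob_space \<mu> \<mu> ..
  define s :: real where "s = 2 powr (1 / \<alpha>)"
  have s: "1 < s" unfolding s_def using \<alpha> by simp
  have sq: "char \<mu> v * char \<mu> v = char \<mu> (s * v)" for v
  proof -
    have int: "integrable (\<mu> \<Otimes>\<^sub>M \<mu>) (\<lambda>p. iexp (v * fst p) * iexp (v * snd p))"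
      by (intro P.integrable_const_bound[where B=1]) (auto simp: norm_mult)
    have "char \<mu> (s * v) = char (distr \<mu> borel (\<lambda>x. (1 powr \<alpha> + 1 powr \<alpha>) powr (1 / \<alpha>) * x)) v"
      by (simp add: char_def integral_distr s_def mult_ac)
    also have "\<dots> = char (distr (\<mu> \<Otimes>\<^sub>M \<mu>) borel (\<lambda>(x, y). 1 * x + 1 * y)) v"
      by (simp only: eq)
    also have "\<dots> = (CLINT p|\<mu> \<Otimes>\<^sub>M \<mu>. iexp (v * fst p) * iexp (v * snd p))"
      by (simp add: char_def integral_distr case_prod_unfold exp_add[symmetric] algebra_simps)
    also have "\<dots> = (CLINT x|\<mu>. CLINT y|\<mu>. iexp (v * x) * iexp (v * y))"
      using P.integral_fst'[OF int] by simp
    also have "\<dots> = char \<mu> v * char \<mu> v"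
      by (simp add: char_def)
    finally show ?thesis by simp
  qed
  have one: "cmod (char \<mu> (u / s ^ k)) = 1" for k
  proof (induction k)
    case 0
    then show ?case using not cmod_char_le_1[of u] by simp
  next
    case (Suc k)
    have "cmod (char \<mu> (u / s ^ Suc k)) ^ 2 = cmod (char \<mu> (u / s ^ k))"
      using sq[of "u / s ^ Suc k"] s by (simp add: power2_eq_square norm_mult[symmetric])
    then show ?case using Suc by (simp add: abs_square_eq_1)
  qed
  have "AE x in \<mu>. iexp (u / s ^ k * x) = char \<mu> (u / s ^ k)" for k
    using one[of k] unfolding char_def by (intro AE_iexp_eq_of_norm_one) simp_all
  then have "AE x in \<mu>. \<forall>k. iexp (u / s ^ k * x) = char \<mu> (u / s ^ k)"
    by (subst AE_all_countable) auto
  then have AE: "AE x in \<mu>. \<forall>k. iexp (u / s ^ k * x) = char \<mu> (u / s ^ k)" .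
  then obtain x0 where x0: "\<And>k. iexp (u / s ^ k * x0) = char \<mu> (u / s ^ k)"
    using eventually_happens ae_filter_bot by blast
  have "AE x in \<mu>. x = x0"
    using AE
  proof eventually_elim
    case (elim x)
    have e1: "iexp (u / s ^ k * (x - x0)) = 1" for k
    proof -
      have "iexp (u / s ^ k * (x - x0)) = iexp (u / s ^ k * x) / iexp (u / s ^ k * x0)"
        by (simp add: exp_diff algebra_simps diff_divide_distrib)
      moreover have "char \<mu> (u / s ^ k) \<noteq> 0" using one[of k] by auto
      ultimately show ?thesis using elim x0 by simp
    qed
    have "(\<lambda>k. \<bar>u * (x - x0)\<bar> * (1 / s) ^ k) \<longlonglongrightarrow> \<bar>u * (x - x0)\<bar> * 0"
      using s by (intro tendsto_intros LIMSEQ_realpow_zero) auto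
    then have "eventually (\<lambda>k. \<bar>u * (x - x0)\<bar> * (1 / s) ^ k < 2 * pi) sequentially"
      by (rule order_tendstoD) simp
    then obtain k where "\<bar>u * (x - x0)\<bar> * (1 / s) ^ k < 2 * pi"
      by (auto simp: eventually_sequentially)
    then have "\<bar>u / s ^ k * (x - x0)\<bar> < 2 * pi"
      using s by (simp add: abs_mult power_divide)
    then have "u / s ^ k * (x - x0) = 0" using e1 iexp_eq_1_small by blast
    then show ?case using \<open>u \<noteq> 0\<close> s by auto
  qed
  then show False using eq_return_of_AE_eq nondeg by blast
qed

text \<open>The choice \<open>n = \<lfloor>\<bar>t\<bar>\<^bsup>-\<alpha>\<^esup>\<rfloor>\<close>, by which a statement on \<open>n\<close>-fold sums at scale \<open>n\<^bsup>1/\<alpha>\<^esup>\<close> becomes a statement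
about a single small \<open>t\<close>.\<close>

lemma scale_choice:
  fixes \<alpha> :: real
  assumes \<alpha>: "0 < \<alpha>"
  shows "\<exists>\<delta>>0. \<forall>t. 0 < \<bar>t\<bar> \<and> \<bar>t\<bar> \<le> \<delta> \<longrightarrow>
    (\<exists>n\<ge>J. 1 \<le> n \<and> real n * \<bar>t\<bar> powr \<alpha> \<le> 1 \<and> 1 \<le> 2 * real n * \<bar>t\<bar> powr \<alpha>)"
proof -
  define K where "K = real J + 1"
  have K: "K > 0" by (simp add: K_def)
  show ?thesis
  proof (rule exI[of _ "(1 / K) powr (1 / \<alpha>)"], intro conjI allI impI)
  show "0 < (1 / K) powr (1 / \<alpha>)" using K by simp
  fix t :: real assume t: "0 < \<bar>t\<bar> \<and> \<bar>t\<bar> \<le> (1 / K) powr (1 / \<alpha>)"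
  define q where "q = \<bar>t\<bar> powr \<alpha>"
  have q0: "0 < q" using t by (simp add: q_def)
  have "q \<le> ((1 / K) powr (1 / \<alpha>)) powr \<alpha>"
    unfolding q_def using t \<alpha> by (intro powr_mono2) auto
  also have "\<dots> = 1 / K" using \<alpha> K by (simp add: powr_powr)
  finally have qK: "K \<le> 1 / q" using q0 K by (simp add: field_simps)
  define n where "n = nat \<lfloor>1 / q\<rfloor>"
  have n1: "real n \<le> 1 / q" unfolding n_def using q0 by simp
  have n2: "1 / q < real n + 1" unfolding n_def using q0 by linarith
  have "J \<le> n \<and> 1 \<le> n" using qK n2 unfolding K_def by linarith
  moreover have "real n * q \<le> 1" using n1 q0 by (simp add: field_simps)
  moreover have "1 \<le> 2 * real n * q"
  proof -
    have "1 / q \<le> 2 * real n" using n2 \<open>J \<le> n \<and> 1 \<le> n\<close> by linarith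
    then show ?thesis using q0 by (simp add: field_simps)
  qed
  ultimately show "\<exists>n\<ge>J. 1 \<le> n \<and> real n * \<bar>t\<bar> powr \<alpha> \<le> 1 \<and> 1 \<le> 2 * real n * \<bar>t\<bar> powr \<alpha>"
    unfolding q_def by blast
  qed
qed

text \<open>The form in which attraction to a stable law is used: \<open>\<phi>\<close> is the characteristic function of one summand,
\<open>\<psi>\<close> that of the limit.\<close>

definition scaling_limit :: "real \<Rightarrow> (real \<Rightarrow> complex) \<Rightarrow> (real \<Rightarrow> complex) \<Rightarrow> bool" where
  "scaling_limit \<alpha> \<phi> \<psi> \<longleftrightarrow> (\<forall>e>0. \<exists>J. \<forall>n\<ge>J. \<forall>u. \<bar>u\<bar> \<le> 1 \<longrightarrow>
     cmod (\<phi> (u * real n powr (- 1 / \<alpha>)) ^ n - \<psi> u) < e)"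

lemma scaled_arg:
  fixes \<alpha> t :: real
  assumes "0 < \<alpha>" "1 \<le> n"
  defines "u \<equiv> t * real n powr (1 / \<alpha>)"
  shows "u * real n powr (- 1 / \<alpha>) = t" "\<bar>u\<bar> powr \<alpha> = real n * \<bar>t\<bar> powr \<alpha>"
  using assms by (simp_all add: u_def powr_minus powr_mult abs_mult powr_powr)

text \<open>On the annulus \<open>2\<^bsup>-1/\<alpha>\<^esup> \<le> \<bar>u\<bar> \<le> 1\<close> the limit \<open>\<psi>\<close> has modulus at most some \<open>k < 1\<close>. Every small \<open>t\<close> is
\<open>u n\<^bsup>-1/\<alpha>\<^esup>\<close> with \<open>u\<close> in the annulus, so \<open>\<bar>\<phi>(t)\<bar>\<^sup>n\<close> is bounded by a constant below one and
\<open>1/n\<close> is comparable to \<open>\<bar>t\<bar>\<^sup>\<alpha>\<close>.\<close>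

lemma scaling_limit_bound_near_0:
  assumes lim: "scaling_limit \<alpha> \<phi> \<psi>" and \<alpha>: "0 < \<alpha>"
    and cont: "continuous_on UNIV \<psi>" and less: "\<And>u. u \<noteq> 0 \<Longrightarrow> cmod (\<psi> u) < 1"
    and le: "\<And>t. cmod (\<phi> t) \<le> 1"
  shows "\<exists>c>0. \<exists>\<delta>>0. \<forall>t. \<bar>t\<bar> \<le> \<delta> \<longrightarrow> cmod (\<phi> t) \<le> exp (- c * \<bar>t\<bar> powr \<alpha>)"
proof -
  define h :: real where "h = (1 / 2) powr (1 / \<alpha>)"
  have h: "0 < h" "h \<le> 1" using \<alpha> by (auto simp: h_def powr_le1)
  define K where "K = {-1..-h} \<union> {h..1}"
  have "compact K" unfolding K_def by (intro compact_Un compact_Icc)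
  moreover have "K \<noteq> {}" using h by (auto simp: K_def)
  moreover have "continuous_on K (\<lambda>u. cmod (\<psi> u))"
    by (intro continuous_intros continuous_on_subset[OF cont]) auto
  ultimately obtain u0 where u0: "u0 \<in> K" "\<And>u. u \<in> K \<Longrightarrow> cmod (\<psi> u) \<le> cmod (\<psi> u0)"
    using continuous_attains_sup[of K "\<lambda>u. cmod (\<psi> u)"] by blast
  define k where "k = cmod (\<psi> u0)"
  have "u0 \<noteq> 0" using u0 h by (auto simp: K_def)
  then have k: "0 \<le> k" "k < 1" using less by (auto simp: k_def)
  define k' where "k' = (1 + k) / 2"
  have k': "0 < k'" "k' < 1" "k < k'" using k by (auto simp: k'_def)
  obtain J where J: "\<And>n u. n \<ge> J \<Longrightarrow> \<bar>u\<bar> \<le> 1 \<Longrightarrow> cmod (\<phi> (u * real n powr (- 1 / \<alpha>)) ^ n - \<psi> u) < k' - k"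
    using lim k' unfolding scaling_limit_def by (meson diff_gt_0_iff_gt)
  obtain \<delta> where \<delta>: "\<delta> > 0" "\<And>t. 0 < \<bar>t\<bar> \<Longrightarrow> \<bar>t\<bar> \<le> \<delta> \<Longrightarrow>
      (\<exists>n\<ge>J. 1 \<le> n \<and> real n * \<bar>t\<bar> powr \<alpha> \<le> 1 \<and> 1 \<le> 2 * real n * \<bar>t\<bar> powr \<alpha>)"
    using scale_choice[OF \<alpha>, of J] by blast
  define c where "c = - ln k'"
  have c: "c > 0" using k' by (simp add: c_def)
  have "cmod (\<phi> t) \<le> exp (- c * \<bar>t\<bar> powr \<alpha>)" if t: "\<bar>t\<bar> \<le> \<delta>" for t
  proof (cases "t = 0")
    case True then show ?thesis using le by simp
  next
    case False
    then obtain n where n: "n \<ge> J" "1 \<le> n" "real n * \<bar>t\<bar> powr \<alpha> \<le> 1" "1 \<le> 2 * real n * \<bar>t\<bar> powr \<alpha>"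
      using \<delta>(2) t by force
    define u where "u = t * real n powr (1 / \<alpha>)"
    have ut: "u * real n powr (- 1 / \<alpha>) = t" and ua: "\<bar>u\<bar> powr \<alpha> = real n * \<bar>t\<bar> powr \<alpha>"
      unfolding u_def using scaled_arg[OF \<alpha> n(2)] by auto
    have "\<bar>u\<bar> = (\<bar>u\<bar> powr \<alpha>) powr (1 / \<alpha>)" using \<alpha> by (simp add: powr_powr)
    moreover have "(\<bar>u\<bar> powr \<alpha>) powr (1 / \<alpha>) \<le> 1 powr (1 / \<alpha>)"
      using n(3) ua \<alpha> by (intro powr_mono2) auto
    moreover have "h \<le> (\<bar>u\<bar> powr \<alpha>) powr (1 / \<alpha>)"
      unfolding h_def using n(4) ua \<alpha> by (intro powr_mono2) auto
    ultimately have u: "\<bar>u\<bar> \<le> 1" "h \<le> \<bar>u\<bar>" by auto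
    then have "u \<in> K" by (auto simp: K_def)
    then have "cmod (\<psi> u) \<le> k" using u0 by (simp add: k_def)
    moreover have "cmod (\<phi> t ^ n - \<psi> u) < k' - k" using J[OF n(1) u(1)] ut by simp
    moreover have "cmod (\<phi> t ^ n) \<le> cmod (\<phi> t ^ n - \<psi> u) + cmod (\<psi> u)"
      using norm_triangle_ineq[of "\<phi> t ^ n - \<psi> u" "\<psi> u"] by simp
    ultimately have "cmod (\<phi> t) ^ n \<le> k'" by (simp add: norm_power)
    also have "k' = exp (- c / real n) ^ n"
      using n(2) k' by (simp add: exp_of_nat_mult[symmetric] c_def)
    finally have "cmod (\<phi> t) \<le> exp (- c / real n)"
      using n(2) by (subst (asm) power_mono_iff) auto
    also have "\<dots> \<le> exp (- c * \<bar>t\<bar> powr \<alpha>)"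
      using c n(2,3) by (simp add: field_simps)
    finally show ?thesis .
  qed
  then show ?thesis using c \<delta>(1) by blast
qed

text \<open>Taking an \<open>n\<close>-th root is harmless when all powers up to \<open>n\<close> stay near \<open>1\<close>, because then the geometric sum
\<open>(\<rho>\<^sup>n - 1)/(\<rho> - 1)\<close> has modulus at least \<open>n/2\<close>. Closeness of \<open>\<rho>\<^sup>n\<close> alone would leave the choice of the root
open.\<close>

lemma norm_diff_one_of_powers:
  fixes \<rho> :: complex
  assumes pw: "\<And>j. j \<le> n \<Longrightarrow> cmod (\<rho> ^ j - 1) \<le> e" and e: "e \<le> 1 / 2" and n: "1 \<le> n"
  shows "real n * cmod (\<rho> - 1) \<le> 2 * e"
proof -
  have "real n * (1 / 2) \<le> (\<Sum>j<n. Re (\<rho> ^ j))"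
  proof -
    have "1 / 2 \<le> Re (\<rho> ^ j)" if "j < n" for j
      using pw[of j] that e abs_Re_le_cmod[of "\<rho> ^ j - 1"] by (simp del: Re_power_real)
    then have "(\<Sum>j<n. 1 / 2 :: real) \<le> (\<Sum>j<n. Re (\<rho> ^ j))" by (intro sum_mono) auto
    then show ?thesis by simp
  qed
  also have "\<dots> \<le> cmod (\<Sum>j<n. \<rho> ^ j)"
    using complex_Re_le_cmod[of "\<Sum>j<n. \<rho> ^ j"] by simp
  finally have "real n * (1 / 2) * cmod (\<rho> - 1) \<le> cmod (\<Sum>j<n. \<rho> ^ j) * cmod (\<rho> - 1)"
    by (rule mult_right_mono) simp
  also have "\<dots> = cmod (\<rho> ^ n - 1)"
    by (simp add: power_diff_1_eq norm_mult mult.commute)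
  also have "\<dots> \<le> e" using pw by simp
  finally show ?thesis by simp
qed

text \<open>Apply the previous lemma to \<open>\<rho> = \<phi>(u)/\<psi>(u)\<close> with \<open>n\<close> about \<open>\<bar>u\<bar>\<^bsup>-\<beta>\<^esup>\<close>. Self-similarity of \<open>\<psi>\<close> turns the
powers \<open>\<psi>(u)\<^sup>j\<close>, \<open>j \<le> n\<close>, into values of \<open>\<psi>\<close> on \<open>[-1, 1]\<close>; the scaling limit controls large \<open>j\<close>, and continuity
at \<open>0\<close> the finitely many others.\<close>

lemma scaling_limit_expansion:
  assumes lim: "scaling_limit \<beta> \<phi> \<psi>" and \<beta>: "0 < \<beta>"
    and self: "\<And>n u. 1 \<le> n \<Longrightarrow> \<psi> (u * real n powr (- 1 / \<beta>)) ^ n = \<psi> u"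
    and c\<phi>: "isCont \<phi> 0" and c\<psi>: "isCont \<psi> 0" and \<phi>0: "\<phi> 0 = 1" and \<psi>0: "\<psi> 0 = 1"
    and le1: "\<And>u. cmod (\<psi> u) \<le> 1"
    and b: "0 < b" "\<And>u. \<bar>u\<bar> \<le> 1 \<Longrightarrow> b \<le> cmod (\<psi> u)"
    and e: "0 < e"
  shows "\<exists>\<delta>>0. \<forall>u. \<bar>u\<bar> \<le> \<delta> \<longrightarrow> cmod (\<phi> u - \<psi> u) \<le> e * \<bar>u\<bar> powr \<beta>"
proof -
  define e' where "e' = min (1 / 2) (e / 4)"
  have e': "0 < e'" "e' \<le> 1 / 2" "4 * e' \<le> e" using e by (auto simp: e'_def)
  have be: "0 < e' * b" using e' b by simp
  obtain J where J: "\<And>n u. n \<ge> J \<Longrightarrow> \<bar>u\<bar> \<le> 1 \<Longrightarrow>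
      cmod (\<phi> (u * real n powr (- 1 / \<beta>)) ^ n - \<psi> u) < e' * b"
    using lim be unfolding scaling_limit_def by meson
  have "eventually (\<lambda>u. \<forall>j\<in>{..<J}. cmod (\<phi> u ^ j - \<psi> u ^ j) < e' * b) (at 0)"
  proof (intro eventually_ball_finite ballI)
    fix j
    have "((\<lambda>u. cmod (\<phi> u ^ j - \<psi> u ^ j)) \<longlongrightarrow> cmod (\<phi> 0 ^ j - \<psi> 0 ^ j)) (at 0)"
      using c\<phi> c\<psi> unfolding isCont_def by (intro tendsto_intros)
    then show "eventually (\<lambda>u. cmod (\<phi> u ^ j - \<psi> u ^ j) < e' * b) (at 0)"
      by (rule order_tendstoD) (use be \<phi>0 \<psi>0 in simp)
  qed simp
  then obtain d where d: "d > 0"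
    "\<And>u j. u \<noteq> 0 \<Longrightarrow> \<bar>u\<bar> < d \<Longrightarrow> j < J \<Longrightarrow> cmod (\<phi> u ^ j - \<psi> u ^ j) < e' * b"
    unfolding eventually_at by (auto simp: dist_real_def)
  obtain \<delta> where \<delta>: "\<delta> > 0" "\<And>t. 0 < \<bar>t\<bar> \<Longrightarrow> \<bar>t\<bar> \<le> \<delta> \<Longrightarrow>
      (\<exists>n\<ge>J. 1 \<le> n \<and> real n * \<bar>t\<bar> powr \<beta> \<le> 1 \<and> 1 \<le> 2 * real n * \<bar>t\<bar> powr \<beta>)"
    using scale_choice[OF \<beta>, of J] by blast
  have "cmod (\<phi> u - \<psi> u) \<le> e * \<bar>u\<bar> powr \<beta>" if u: "\<bar>u\<bar> \<le> min \<delta> (d / 2)" for u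
  proof (cases "u = 0")
    case True then show ?thesis using \<phi>0 \<psi>0 by simp
  next
    case False
    then obtain n where n: "1 \<le> n" "real n * \<bar>u\<bar> powr \<beta> \<le> 1" "1 \<le> 2 * real n * \<bar>u\<bar> powr \<beta>"
      using \<delta>(2)[of u] u by force
    have pw: "b \<le> cmod (\<psi> u ^ j) \<and> cmod (\<phi> u ^ j - \<psi> u ^ j) < e' * b" if j: "1 \<le> j" "j \<le> n" for j
    proof -
      define w where "w = u * real j powr (1 / \<beta>)"
      have wu: "w * real j powr (- 1 / \<beta>) = u" and wa: "\<bar>w\<bar> powr \<beta> = real j * \<bar>u\<bar> powr \<beta>"
        unfolding w_def using scaled_arg[OF \<beta> j(1)] by auto
      have "\<bar>w\<bar> powr \<beta> \<le> real n * \<bar>u\<bar> powr \<beta>"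
        unfolding wa using j by (intro mult_right_mono) auto
      then have "\<bar>w\<bar> powr \<beta> \<le> 1" using n(2) by linarith
      then have "(\<bar>w\<bar> powr \<beta>) powr (1 / \<beta>) \<le> 1" using \<beta> by (intro powr_le1) auto
      then have w1: "\<bar>w\<bar> \<le> 1" using \<beta> by (simp add: powr_powr)
      have \<psi>w: "\<psi> u ^ j = \<psi> w" using self[OF j(1), of w] wu by simp
      have "cmod (\<phi> u ^ j - \<psi> u ^ j) < e' * b"
      proof (cases "J \<le> j")
        case True
        then show ?thesis using J[of j w] w1 wu \<psi>w by simp
      next
        case False
        then show ?thesis using d \<open>u \<noteq> 0\<close> u by auto
      qed
      with b(2)[OF w1] \<psi>w show ?thesis by simp
    qed
    have \<psi>n: "\<psi> u \<noteq> 0" using pw[of 1] b(1) n(1) by auto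
    define \<rho> where "\<rho> = \<phi> u / \<psi> u"
    have "cmod (\<rho> ^ j - 1) \<le> e'" if "j \<le> n" for j
    proof (cases "j = 0")
      case True then show ?thesis using e' by simp
    next
      case False
      then have p: "b \<le> cmod (\<psi> u ^ j)" "cmod (\<phi> u ^ j - \<psi> u ^ j) < e' * b" using pw[of j] that by auto
      have "\<rho> ^ j - 1 = (\<phi> u ^ j - \<psi> u ^ j) / \<psi> u ^ j"
        using \<psi>n by (simp add: \<rho>_def power_divide diff_divide_distrib)
      then have "cmod (\<rho> ^ j - 1) = cmod (\<phi> u ^ j - \<psi> u ^ j) / cmod (\<psi> u ^ j)"
        by (simp add: norm_divide)
      also have "\<dots> \<le> (e' * b) / b" using p b(1) be by (intro frac_le) auto
      finally show ?thesis using b(1) by simp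
    qed
    then have r: "real n * cmod (\<rho> - 1) \<le> 2 * e'"
      using norm_diff_one_of_powers e'(2) n(1) by blast
    have "\<phi> u - \<psi> u = \<psi> u * (\<rho> - 1)" using \<psi>n by (simp add: \<rho>_def algebra_simps)
    then have "cmod (\<phi> u - \<psi> u) \<le> cmod (\<rho> - 1)"
      using mult_right_mono[OF le1[of u], of "cmod (\<rho> - 1)"] by (simp add: norm_mult)
    also have "\<dots> \<le> (2 * real n * \<bar>u\<bar> powr \<beta>) * cmod (\<rho> - 1)"
      using mult_right_mono[OF n(3), of "cmod (\<rho> - 1)"] by simp
    also have "\<dots> = 2 * \<bar>u\<bar> powr \<beta> * (real n * cmod (\<rho> - 1))" by simp
    also have "\<dots> \<le> 2 * \<bar>u\<bar> powr \<beta> * (2 * e')" using r by (intro mult_left_mono) auto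
    also have "\<dots> = (4 * e') * \<bar>u\<bar> powr \<beta>" by simp
    also have "\<dots> \<le> e * \<bar>u\<bar> powr \<beta>" using e'(3) by (intro mult_right_mono) auto
    finally show ?thesis .
  qed
  then show ?thesis using \<delta>(1) d(1) by (intro exI[of _ "min \<delta> (d / 2)"]) auto
qed

section \<open>A concentration inequality for sums of integers\<close>

lemma sum_abs_diff_le:
  fixes g :: "nat \<Rightarrow> real"
  assumes g: "\<And>k. 0 \<le> g k" and sm: "summable g"
  shows "(\<Sum>l<L. \<Sum>l'<L. g (nat \<bar>int l - int l'\<bar>)) \<le> 2 * real L * suminf g"
proof -
  have "(\<Sum>l'<L. g (nat \<bar>int l - int l'\<bar>)) \<le> 2 * suminf g" if l: "l < L" for l
  proof -
    have eq: "{..<L} = {..l} \<union> {l<..<L}" using l by auto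
    have "(\<Sum>l'<L. g (nat \<bar>int l - int l'\<bar>)) =
        (\<Sum>l'\<le>l. g (l - l')) + (\<Sum>l'\<in>{l<..<L}. g (l' - l))"
      unfolding eq by (subst sum.union_disjoint)
        (auto intro!: arg_cong2[where f="(+)"] sum.cong simp: nat_diff_distrib of_nat_diff abs_if)
    also have "(\<Sum>l'\<le>l. g (l - l')) = sum g ((\<lambda>l'. l - l') ` {..l})"
      by (subst sum.reindex) (auto simp: inj_on_def)
    also have "\<dots> \<le> suminf g" by (intro sum_le_suminf sm) (auto simp: g)
    also have "(\<Sum>l'\<in>{l<..<L}. g (l' - l)) = sum g ((\<lambda>l'. l' - l) ` {l<..<L})"
      by (subst sum.reindex) (auto simp: inj_on_def)
    also have "\<dots> \<le> suminf g" by (intro sum_le_suminf sm) (auto simp: g)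
    finally show ?thesis by simp
  qed
  then have "(\<Sum>l<L. \<Sum>l'<L. g (nat \<bar>int l - int l'\<bar>)) \<le> (\<Sum>l<L. 2 * suminf g)"
    by (intro sum_mono) auto
  then show ?thesis by simp
qed

text \<open>The squared modulus of a sum of \<open>L\<close> characters is nonnegative and equals \<open>L\<^sup>2\<close> at \<open>z\<close>. This discrete
form of Esseen's concentration inequality only sees the characteristic function near \<open>0\<close>, so possible
periodicity of the law of \<open>T\<close> does not matter.\<close>

lemma (in prob_space) prob_eq_le_sum_char:
  fixes T :: "'a \<Rightarrow> real"
  assumes [measurable]: "T \<in> borel_measurable M"
  shows "real L ^ 2 * prob {x \<in> space M. T x = z} \<le>
    (\<Sum>l<L. \<Sum>l'<L. cmod (CLINT x|M. iexp (\<theta> * (real l - real l') * T x)))"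
proof -
  define F where "F x = (\<Sum>l<L. \<Sum>l'<L. iexp (\<theta> * (real l - real l') * (T x - z)))" for x
  have F: "F x = of_real ((cmod (\<Sum>l<L. iexp (\<theta> * real l * (T x - z))))\<^sup>2)" for x
    unfolding complex_norm_square F_def cnj_sum sum_product exp_cnj
    by (intro sum.cong refl) (simp add: exp_add[symmetric] algebra_simps)
  have int: "integrable M (\<lambda>x. iexp (\<theta> * (real l - real l') * (T x - z)))" for l l'
    by (intro integrable_const_bound[where B=1]) auto
  have intF: "integrable M F" unfolding F_def using int by (intro Bochner_Integration.integrable_sum) auto
  have "real L ^ 2 * prob {x \<in> space M. T x = z} = (\<integral>x. real L ^ 2 * indicator {x \<in> space M. T x = z} x \<partial>M)"
    by simp
  also have "\<dots> \<le> (\<integral>x. Re (F x) \<partial>M)"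
  proof (intro integral_mono)
    show "integrable M (\<lambda>x. real L ^ 2 * indicator {x \<in> space M. T x = z} x)"
      by (intro integrable_const_bound[where B="real L ^ 2"]) (auto simp: indicator_def)
    show "integrable M (\<lambda>x. Re (F x))" using intF by (rule integrable_Re)
    fix x
    show "real L ^ 2 * indicator {x \<in> space M. T x = z} x \<le> Re (F x)"
      unfolding F by (auto simp: indicator_def)
  qed
  also have "\<dots> = Re (\<integral>x. F x \<partial>M)" using intF by (rule integral_Re)
  also have "\<dots> \<le> cmod (\<integral>x. F x \<partial>M)" by (rule complex_Re_le_cmod)
  also have "(\<integral>x. F x \<partial>M) = (\<Sum>l<L. \<Sum>l'<L. (CLINT x|M. iexp (\<theta> * (real l - real l') * (T x - z))))"
    unfolding F_def using int by (simp add: Bochner_Integration.integral_sum Bochner_Integration.integrable_sum)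
  also have "\<dots> = (\<Sum>l<L. \<Sum>l'<L. iexp (- \<theta> * (real l - real l') * z) *
      (CLINT x|M. iexp (\<theta> * (real l - real l') * T x)))"
    by (intro sum.cong refl, subst integral_mult_right_zero[symmetric])
       (simp add: exp_add[symmetric] algebra_simps)
  also have "cmod \<dots> \<le> (\<Sum>l<L. \<Sum>l'<L. cmod (iexp (- \<theta> * (real l - real l') * z) *
      (CLINT x|M. iexp (\<theta> * (real l - real l') * T x))))"
    by (intro order_trans[OF norm_sum] sum_mono) auto
  finally show ?thesis by (simp add: norm_mult)
qed

lemma summable_exp_minus_powr:
  fixes b \<alpha> :: real
  assumes "0 < b" "0 < \<alpha>"
  shows "summable (\<lambda>k::nat. exp (- b * real k powr \<alpha>))"
proof (rule summable_comparison_test_bigo)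
  show "summable (\<lambda>k::nat. norm (1 / real k ^ 2))"
    using inverse_power_summable[of 2, where 'a=real] by (simp add: field_simps)
  show "(\<lambda>k::nat. exp (- b * real k powr \<alpha>)) \<in> O(\<lambda>k. 1 / real k ^ 2)"
    using assms by real_asymp
qed

text \<open>If \<open>T\<close> is a sum of \<open>m\<close> steps whose characteristic function is at most \<open>exp(-c \<bar>t\<bar>\<^sup>\<alpha>)\<close> near \<open>0\<close>, the choice \<open>L\<close> about \<open>m\<^bsup>1/\<alpha>\<^esup>\<close> and \<open>\<theta>\<close> about \<open>1/L\<close> makes \<open>b\<close>
independent of \<open>m\<close>.\<close>

lemma (in prob_space) prob_eq_le_of_char_bound:
  fixes T :: "'a \<Rightarrow> real"
  assumes T: "T \<in> borel_measurable M" and "0 < b" "0 < \<alpha>" "1 \<le> L"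
    and bound: "\<And>k. k < L \<Longrightarrow> cmod (CLINT x|M. iexp (\<theta> * real k * T x)) \<le> exp (- b * real k powr \<alpha>)"
  shows "prob {x \<in> space M. T x = z} \<le> 2 * (\<Sum>k. exp (- b * real k powr \<alpha>)) / real L"
proof -
  have sym: "cmod (CLINT x|M. iexp (- s * T x)) = cmod (CLINT x|M. iexp (s * T x))" for s
  proof -
    have "(\<lambda>x. iexp (- s * T x)) = (\<lambda>x. cnj (iexp (s * T x)))"
      by (simp add: exp_cnj)
    then have "(CLINT x|M. iexp (- s * T x)) = cnj (CLINT x|M. iexp (s * T x))"
      using Bochner_Integration.integral_cnj[of M "\<lambda>x. iexp (s * T x)"] by simp
    then show ?thesis by simp
  qed
  have b2: "cmod (CLINT x|M. iexp (\<theta> * (real l - real l') * T x)) \<le>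
      exp (- b * real (nat \<bar>int l - int l'\<bar>) powr \<alpha>)" if "l < L" "l' < L" for l l'
  proof (cases "l' \<le> l")
    case True
    then show ?thesis using bound[of "l - l'"] that by (simp add: of_nat_diff nat_diff_distrib)
  next
    case False
    then have "cmod (CLINT x|M. iexp (\<theta> * (real l - real l') * T x)) =
      cmod (CLINT x|M. iexp (\<theta> * real (l' - l) * T x))"
      using sym[of "\<theta> * real (l' - l)"] by (simp add: of_nat_diff algebra_simps)
    moreover have "nat \<bar>int l - int l'\<bar> = l' - l" using False by simp
    ultimately show ?thesis using bound[of "l' - l"] that by simp
  qed
  have "real L ^ 2 * prob {x \<in> space M. T x = z} \<le>
     (\<Sum>l<L. \<Sum>l'<L. exp (- b * real (nat \<bar>int l - int l'\<bar>) powr \<alpha>))"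
    by (rule order_trans[OF prob_eq_le_sum_char[OF T, where \<theta>=\<theta>]], intro sum_mono b2) auto
  also have "\<dots> \<le> 2 * real L * (\<Sum>k. exp (- b * real k powr \<alpha>))"
    using sum_abs_diff_le[of "\<lambda>k. exp (- b * real k powr \<alpha>)" L] summable_exp_minus_powr assms by simp
  finally show ?thesis using \<open>1 \<le> L\<close> by (simp add: field_simps power2_eq_square)
qed

section \<open>Finite families of independent integers\<close>

abbreviation iid_pmf :: "'i set \<Rightarrow> int pmf \<Rightarrow> ('i \<Rightarrow> int) pmf" where
  "iid_pmf I p \<equiv> Pi_pmf I 0 (\<lambda>_. p)"

text \<open>Dependence of a function \<open>f\<close> on the coordinates in \<open>B\<close> only is expressed by \<open>f (resample B x y) = f y\<close>, dependence
on the coordinates outside \<open>B\<close> only by \<open>f (resample B x y) = f x\<close>.\<close>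

definition resample :: "'i set \<Rightarrow> ('i \<Rightarrow> int) \<Rightarrow> ('i \<Rightarrow> int) \<Rightarrow> 'i \<Rightarrow> int" where
  "resample B x y = (\<lambda>i. if i \<in> B then y i else x i)"

lemma resample_in [simp]: "i \<in> B \<Longrightarrow> resample B x y i = y i"
  and resample_notin [simp]: "i \<notin> B \<Longrightarrow> resample B x y i = x i"
  by (simp_all add: resample_def)

text \<open>Replacing a block of coordinates by that of an independent copy preserves the law. Independence of
disjoint blocks of increments is used in this form.\<close>

lemma iid_pmf_resample:
  assumes I: "finite I" "B \<subseteq> I"
  shows "map_pmf (\<lambda>(x, y). resample B x y) (pair_pmf (iid_pmf I p) (iid_pmf I p)) = iid_pmf I p"
proof -
  let ?P = "iid_pmf I p"
  have fin: "finite B" "finite (I - B)" using I finite_subset by auto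
  have "?P = iid_pmf (B \<union> (I - B)) p" using I by (simp add: Un_absorb1)
  also have "\<dots> = map_pmf (\<lambda>(f, g) i. if i \<in> B then f i else g i) (pair_pmf (iid_pmf B p) (iid_pmf (I - B) p))"
    using fin by (intro Pi_pmf_union) auto
  also have "iid_pmf B p = map_pmf (\<lambda>f i. if i \<in> B then f i else 0) ?P"
    using I by (rule Pi_pmf_subset)
  also have "iid_pmf (I - B) p = map_pmf (\<lambda>f i. if i \<in> I - B then f i else 0) ?P"
    using I by (intro Pi_pmf_subset) auto
  also have "map_pmf (\<lambda>(f, g) i. if i \<in> B then f i else g i)
      (pair_pmf (map_pmf (\<lambda>f i. if i \<in> B then f i else 0) ?P) (map_pmf (\<lambda>f i. if i \<in> I - B then f i else 0) ?P))
    = map_pmf (\<lambda>(y, x). resample B x y) (pair_pmf ?P ?P)"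
    unfolding pair_map_pmf1 pair_map_pmf2 map_pmf_comp
    using set_Pi_pmf_subset[OF I(1), of 0 "\<lambda>_. p"]
    by (intro map_pmf_cong refl) (auto simp: fun_eq_iff resample_def)
  also have "\<dots> = map_pmf (\<lambda>(x, y). resample B x y) (pair_pmf ?P ?P)"
    by (subst pair_commute_pmf) (simp add: map_pmf_comp case_prod_unfold)
  finally show ?thesis ..
qed

lemma nn_integral_iid_resample:
  assumes I: "finite I" "B \<subseteq> I"
  shows "(\<integral>\<^sup>+x. f x \<partial>iid_pmf I p) = (\<integral>\<^sup>+x. \<integral>\<^sup>+y. f (resample B x y) \<partial>iid_pmf I p \<partial>iid_pmf I p)"
  by (subst iid_pmf_resample[OF I, symmetric]) (simp add: nn_integral_pair_pmf')

lemma expectation_indep: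
  assumes I: "finite I" "B \<subseteq> I"
    and f: "\<And>x y. f (resample B x y) = f y" "\<And>x. 0 \<le> f x" "\<And>x. f x \<le> C"
    and g: "\<And>x y. g (resample B x y) = g x" "\<And>x. 0 \<le> g x" "\<And>x. g x \<le> D"
  shows "measure_pmf.expectation (iid_pmf I p) (\<lambda>x. f x * g x :: real) =
    measure_pmf.expectation (iid_pmf I p) f * measure_pmf.expectation (iid_pmf I p) g"
proof -
  let ?P = "iid_pmf I p"
  have int: "integrable ?P f" "integrable ?P g"
    using f g by (auto intro: measure_pmf.integrable_const_bound[where B="C"]
        measure_pmf.integrable_const_bound[where B="D"])
  have C: "0 \<le> C" using f(2,3) order_trans by blast
  have int2: "integrable ?P (\<lambda>x. f x * g x)"
    using f g C by (intro measure_pmf.integrable_const_bound[where B="C * D"] AE_I2) (auto intro: mult_mono)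
  have "ennreal (measure_pmf.expectation ?P (\<lambda>x. f x * g x)) = (\<integral>\<^sup>+x. ennreal (f x * g x) \<partial>?P)"
    using int2 f g by (intro nn_integral_eq_integral[symmetric]) auto
  also have "\<dots> = (\<integral>\<^sup>+x. \<integral>\<^sup>+y. ennreal (f (resample B x y) * g (resample B x y)) \<partial>?P \<partial>?P)"
    by (rule nn_integral_iid_resample[OF I])
  also have "\<dots> = (\<integral>\<^sup>+x. \<integral>\<^sup>+y. ennreal (f y) * ennreal (g x) \<partial>?P \<partial>?P)"
    using f g by (simp add: ennreal_mult)
  also have "\<dots> = (\<integral>\<^sup>+y. ennreal (f y) \<partial>?P) * (\<integral>\<^sup>+x. ennreal (g x) \<partial>?P)"
    by (simp add: nn_integral_multc nn_integral_cmult)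
  also have "\<dots> = ennreal (measure_pmf.expectation ?P f) * ennreal (measure_pmf.expectation ?P g)"
    using int f g by (simp add: nn_integral_eq_integral)
  also have "\<dots> = ennreal (measure_pmf.expectation ?P f * measure_pmf.expectation ?P g)"
    using f g by (simp add: ennreal_mult)
  finally show ?thesis using f g by (subst (asm) ennreal_inj) auto
qed

lemma prob_indep:
  assumes I: "finite I" "B \<subseteq> I"
    and E: "\<And>x y. resample B x y \<in> E \<longleftrightarrow> y \<in> E" and F: "\<And>x y. resample B x y \<in> F \<longleftrightarrow> x \<in> F"
  shows "measure_pmf.prob (iid_pmf I p) (E \<inter> F) =
    measure_pmf.prob (iid_pmf I p) E * measure_pmf.prob (iid_pmf I p) F"
proof -
  have "measure_pmf.prob (iid_pmf I p) (E \<inter> F) =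
      measure_pmf.expectation (iid_pmf I p) (\<lambda>x. indicator E x * indicator F x)"
    by (simp add: indicator_inter_arith[symmetric])
  also have "\<dots> = measure_pmf.expectation (iid_pmf I p) (indicator E) * measure_pmf.expectation (iid_pmf I p) (indicator F)"
    by (rule expectation_indep[OF I, where C=1 and D=1]) (auto simp: indicator_def E F)
  finally show ?thesis by simp
qed

text \<open>Freezing the coordinates outside \<open>B\<close> fixes the target \<open>Z x\<close>, which the block then hits with probability
at most \<open>r\<close>.\<close>

lemma prob_hit_le:
  assumes I: "finite I" "B \<subseteq> I"
    and E: "\<And>x y. resample B x y \<in> E \<longleftrightarrow> x \<in> E" and Z: "\<And>x y. Z (resample B x y) = Z x"
    and h: "\<And>x y. h (resample B x y) = h y"
    and conc: "\<And>z :: int. measure_pmf.prob (iid_pmf I p) {y. h y = z} \<le> r"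
  shows "measure_pmf.prob (iid_pmf I p) (E \<inter> {x. h x = Z x}) \<le> r * measure_pmf.prob (iid_pmf I p) E"
proof -
  let ?P = "iid_pmf I p"
  have r: "0 \<le> r" using conc[of 0] measure_nonneg order_trans by blast
  have "ennreal (measure_pmf.prob ?P (E \<inter> {x. h x = Z x})) = (\<integral>\<^sup>+x. indicator E x * indicator {x. h x = Z x} x \<partial>?P)"
    by (simp add: indicator_inter_arith[symmetric] measure_pmf.emeasure_eq_measure)
  also have "\<dots> = (\<integral>\<^sup>+x. \<integral>\<^sup>+y. indicator E x * indicator {y. h y = Z x} y \<partial>?P \<partial>?P)"
    by (subst nn_integral_iid_resample[OF I]) (simp add: indicator_def E Z h)
  also have "\<dots> = (\<integral>\<^sup>+x. indicator E x * ennreal (measure_pmf.prob ?P {y. h y = Z x}) \<partial>?P)"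
    by (simp add: nn_integral_cmult measure_pmf.emeasure_eq_measure)
  also have "\<dots> \<le> (\<integral>\<^sup>+x. ennreal r * indicator E x \<partial>?P)"
    by (intro nn_integral_mono) (auto simp: indicator_def intro: ennreal_leI conc)
  also have "\<dots> = ennreal (r * measure_pmf.prob ?P E)"
    using r by (simp add: nn_integral_cmult measure_pmf.emeasure_eq_measure ennreal_mult)
  finally show ?thesis using r by (simp add: ennreal_le_iff)
qed

lemma iid_pmf_reindex:
  fixes h :: "'i \<Rightarrow> nat"
  assumes I: "finite I" and h: "inj_on h A" "h ` A \<subseteq> I"
  shows "map_pmf (\<lambda>x i. if i \<in> A then x (h i) else 0) (iid_pmf I p) = iid_pmf A p"
proof -
  have finA: "finite A" using h I finite_imageD finite_subset by metis
  obtain c where c: "c \<notin> I" using ex_new_if_finite[OF infinite_UNIV_nat I] by blast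
  define h' where "h' i = (if i \<in> A then h i else c)" for i
  have "iid_pmf A p = map_pmf (\<lambda>g. g \<circ> h') (iid_pmf (h ` A) p)"
  proof (rule Pi_pmf_bij_betw[OF finA])
    show "bij_betw h' A (h ` A)" using h by (auto simp: bij_betw_def h'_def inj_on_def)
    show "h' x \<notin> h ` A" if "x \<notin> A" for x using that c h by (auto simp: h'_def)
  qed
  also have "iid_pmf (h ` A) p = map_pmf (\<lambda>f x. if x \<in> h ` A then f x else 0) (iid_pmf I p)"
    using I h by (intro Pi_pmf_subset) auto
  also have "map_pmf (\<lambda>g. g \<circ> h') \<dots> = map_pmf (\<lambda>x i. if i \<in> A then x (h i) else 0) (iid_pmf I p)"
    unfolding map_pmf_comp using c h by (intro map_pmf_cong refl) (auto simp: fun_eq_iff h'_def)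
  finally show ?thesis ..
qed

definition increment :: "(nat \<Rightarrow> int) \<Rightarrow> nat \<Rightarrow> nat \<Rightarrow> int" where
  "increment x j k = (\<Sum>i\<in>{j..<k}. x i)"

definition position :: "(nat \<Rightarrow> int) \<Rightarrow> nat \<Rightarrow> int" where
  "position x k = (\<Sum>i<k. x i)"

lemma position_split: "j \<le> k \<Longrightarrow> position x k = position x j + increment x j k"
proof -
  assume "j \<le> k"
  then have "{..<k} = {..<j} \<union> {j..<k}" by auto
  then show ?thesis unfolding position_def increment_def by (simp add: sum.union_disjoint[symmetric] ivl_disj_int)
qed

lemma increment_resample_in: "{j..<k} \<subseteq> B \<Longrightarrow> increment (resample B x y) j k = increment y j k"
  unfolding increment_def by (intro sum.cong) auto

lemma increment_resample_out: "{j..<k} \<inter> B = {} \<Longrightarrow> increment (resample B x y) j k = increment x j k"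
  unfolding increment_def by (intro sum.cong) (auto simp: resample_def)

lemma position_resample_out: "{..<k} \<inter> B = {} \<Longrightarrow> position (resample B x y) k = position x k"
  unfolding position_def by (intro sum.cong) (auto simp: resample_def)

lemma position_eq_iff_increment: "position x j = position x k \<longleftrightarrow> increment x (min j k) (max j k) = 0"
  using position_split[of "min j k" "max j k" x] by (auto simp: min_def max_def split: if_splits)

lemma position_eq_resample_in: 
  assumes "{min j k..<max j k} \<subseteq> B"
  shows "position (resample B x y) j = position (resample B x y) k \<longleftrightarrow> position y j = position y k"
  unfolding position_eq_iff_increment increment_resample_in[OF assms] ..

lemma position_eq_resample_out: 
  assumes "{min j k..<max j k} \<inter> B = {}"
  shows "position (resample B x y) j = position (resample B x y) k \<longleftrightarrow> position x j = position x k"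
  unfolding position_eq_iff_increment increment_resample_out[OF assms] ..

lemma position_shift: "position (\<lambda>i. if i < l then x (k + i) else 0) i = position x (k + i) - position x k" if "i \<le> l"
proof -
  have "position (\<lambda>i. if i < l then x (k + i) else 0) i = (\<Sum>t<i. x (k + t))"
    unfolding position_def using that by (intro sum.cong) auto
  also have "\<dots> = increment x k (k + i)"
    unfolding increment_def by (subst sum.atLeastLessThan_shift_0) (simp add: atLeast0LessThan add.commute)
  finally show ?thesis using position_split[of k "k + i" x] by simp
qed

lemma position_reverse: "position (\<lambda>i. if i < l then x (k - 1 - i) else 0) i = position x k - position x (k - i)" if "i \<le> l" "l \<le> k"
proof -
  have "position (\<lambda>i. if i < l then x (k - 1 - i) else 0) i = (\<Sum>t<i. x (k - 1 - t))"
    unfolding position_def using that by (intro sum.cong) auto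
  also have "\<dots> = increment x (k - i) k"
    unfolding increment_def using that
    by (intro sum.reindex_bij_witness[of _ "\<lambda>t. k - 1 - t" "\<lambda>t. k - 1 - t"]) auto
  finally show ?thesis using position_split[of "k - i" k x] that by simp
qed

text \<open>Paths are represented by their \<open>n\<close> first increments; the horizon \<open>n\<close> keeps the probability space discrete.\<close>

definition steps :: "int pmf \<Rightarrow> nat \<Rightarrow> (nat \<Rightarrow> int) pmf" where
  "steps p n = iid_pmf {..<n} p"

text \<open>Chernoff's bound with the exponential moment \<open>2\<^bsup>K\<^esup>\<close> of the number \<open>K\<close> of events that occur. Expanding the product
\<open>\<Prod> (1 + 1\<^bsub>B k\<^esub>)\<close> reduces this moment to the probabilities of intersections, so a product bound for these can
replace independence.\<close>

lemma prob_card_ge_of_prob_Inter: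
  fixes B :: "nat \<Rightarrow> 'b set"
  assumes C: "finite C" and \<theta>: "0 \<le> \<theta>"
    and J: "\<And>J. J \<subseteq> C \<Longrightarrow> measure_pmf.prob P (\<Inter>k\<in>J. B k) \<le> \<theta> ^ card J"
  shows "measure_pmf.prob P {x. \<epsilon> * real (card C) \<le> real (card {k\<in>C. x \<in> B k})} \<le> ((1 + \<theta>) / 2 powr \<epsilon>) ^ card C"
proof -
  define f :: "'b \<Rightarrow> real" where "f x = 2 ^ card {k\<in>C. x \<in> B k}" for x
  have f: "f x = (\<Sum>J\<in>Pow C. indicator (\<Inter>k\<in>J. B k) x)" for x
  proof -
    have "f x = (\<Prod>k\<in>C. indicator (B k) x + 1)"
    proof -
      have "(\<Prod>k\<in>C. indicator (B k) x + 1 :: real) = (\<Prod>k\<in>C. if x \<in> B k then 2 else 1)"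
        by (intro prod.cong) (auto simp: indicator_def)
      also have "\<dots> = f x" using C by (subst prod.inter_filter[symmetric]) (auto simp: f_def)
      finally show ?thesis ..
    qed
    also have "\<dots> = (\<Sum>J\<in>Pow C. (\<Prod>k\<in>J. indicator (B k) x))"
      by (subst prod_add[OF C]) simp
    also have "\<dots> = (\<Sum>J\<in>Pow C. indicator (\<Inter>k\<in>J. B k) x)"
    proof (intro sum.cong refl)
      fix J assume "J \<in> Pow C"
      then have "finite J" using C finite_subset by auto
      then show "(\<Prod>k\<in>J. indicator (B k) x :: real) = indicator (\<Inter>k\<in>J. B k) x"
        by (induction J rule: finite_induct) (auto simp: indicator_def)
    qed
    finally show ?thesis .
  qed
  have int_ind: "integrable P (indicator A :: 'b \<Rightarrow> real)" for A
    by (intro measure_pmf.integrable_const_bound[where B=1]) (auto simp: indicator_def)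
  have "measure_pmf.expectation P f = (\<Sum>J\<in>Pow C. measure_pmf.prob P (\<Inter>k\<in>J. B k))"
    unfolding f using int_ind by (subst Bochner_Integration.integral_sum) auto
  also have "\<dots> \<le> (\<Sum>J\<in>Pow C. \<theta> ^ card J)" by (intro sum_mono J) auto
  also have "\<dots> = (\<Sum>J\<in>Pow C. (\<Prod>k\<in>J. \<theta>) * (\<Prod>k\<in>C-J. 1))" by simp
  also have "\<dots> = (\<theta> + 1) ^ card C" using prod_add[OF C, of "\<lambda>_. \<theta>" "\<lambda>_. 1"] by simp
  finally have Ef: "measure_pmf.expectation P f \<le> (1 + \<theta>) ^ card C" by (simp add: add.commute)
  define c where "c = 2 powr (\<epsilon> * real (card C))"
  have c: "c = (2 powr \<epsilon>) ^ card C" "0 < c"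
    by (simp_all add: c_def powr_powr[symmetric] powr_realpow)
  have fint: "integrable P f"
    unfolding f using int_ind by (intro Bochner_Integration.integrable_sum) auto
  have "measure_pmf.prob P {x. \<epsilon> * real (card C) \<le> real (card {k\<in>C. x \<in> B k})} \<le> measure_pmf.prob P {x. c \<le> f x}"
    by (intro measure_pmf.finite_measure_mono)
       (auto simp: c_def f_def powr_realpow[symmetric])
  also have "\<dots> \<le> measure_pmf.expectation P f / c"
    using integral_Markov_inequality_measure[OF fint, of UNIV c] c(2) by (simp add: f_def[abs_def])
  also have "\<dots> \<le> (1 + \<theta>) ^ card C / c" using c(2) by (intro divide_right_mono Ef) auto
  finally show ?thesis by (simp add: c(1) power_divide)
qed

text \<open>If the density of the events is at least \<open>\<epsilon>\<close>, it is so in one of the \<open>M\<close> residue classes, each of which has at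
least \<open>n div M\<close> members.\<close>

lemma prob_card_ge_of_classes:
  fixes B :: "nat \<Rightarrow> 'b set"
  assumes M: "0 < M" and \<theta>: "0 \<le> \<theta>" and \<eta>: "(1 + \<theta>) / 2 powr \<epsilon> \<le> \<eta>" "\<eta> \<le> 1"
    and J: "\<And>J a. J \<subseteq> {k. k < n \<and> k mod M = a} \<Longrightarrow> measure_pmf.prob P (\<Inter>k\<in>J. B k) \<le> \<theta> ^ card J"
  shows "measure_pmf.prob P {x. \<epsilon> * real n \<le> real (card {k. k < n \<and> x \<in> B k})} \<le> real M * \<eta> ^ (n div M)"
proof -
  define C where "C a = {k. k < n \<and> k mod M = a}" for a
  have fin: "finite (C a)" for a by (simp add: C_def)
  have \<eta>0: "0 \<le> \<eta>" using \<theta> by (intro order_trans[OF _ \<eta>(1)]) auto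
  have cardC: "n div M \<le> card (C a)" if "a < M" for a
  proof -
    have "inj_on (\<lambda>i. i * M + a) {..<n div M}" using M by (auto simp: inj_on_def)
    moreover have "(\<lambda>i. i * M + a) ` {..<n div M} \<subseteq> C a"
    proof safe
      fix i assume "i < n div M"
      then have "(i + 1) * M \<le> n div M * M" by (intro mult_right_mono) auto
      also have "\<dots> \<le> n" by simp
      finally show "i * M + a \<in> C a" using that by (simp add: C_def)
    qed
    ultimately show ?thesis using fin card_inj_on_le[of _ "{..<n div M}" "C a"] by fastforce
  qed
  have part: "finite {k. k < n \<and> Q k} \<and> card {k. k < n \<and> Q k} = (\<Sum>a<M. card {k \<in> C a. Q k})" for Q
  proof -
    have "{k. k < n \<and> Q k} = (\<Union>a<M. {k \<in> C a. Q k})" using M by (auto simp: C_def)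
    moreover have "finite {k \<in> C a. Q k}" for a using fin by simp
    moreover have "card (\<Union>a<M. {k \<in> C a. Q k}) = (\<Sum>a<M. card {k \<in> C a. Q k})"
      using fin by (intro card_UN_disjoint) (auto simp: C_def)
    ultimately show ?thesis by simp
  qed
  define G where "G a = {x. \<epsilon> * real (card (C a)) \<le> real (card {k\<in>C a. x \<in> B k})}" for a
  have "{x. \<epsilon> * real n \<le> real (card {k. k < n \<and> x \<in> B k})} \<subseteq> (\<Union>a<M. G a)"
  proof
    fix x assume x: "x \<in> {x. \<epsilon> * real n \<le> real (card {k. k < n \<and> x \<in> B k})}"
    show "x \<in> (\<Union>a<M. G a)"
    proof (rule ccontr)
      assume "x \<notin> (\<Union>a<M. G a)"
      then have "(\<Sum>a<M. real (card {k\<in>C a. x \<in> B k})) < (\<Sum>a<M. \<epsilon> * real (card (C a)))"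
        using M by (intro sum_strict_mono) (auto simp: G_def not_le)
      also have "\<dots> = \<epsilon> * real n"
        using part[of "\<lambda>_. True"] by (simp add: sum_distrib_left[symmetric] of_nat_sum[symmetric] del: of_nat_sum)
      finally show False using x part[of "\<lambda>k. x \<in> B k"] by (simp add: of_nat_sum[symmetric] del: of_nat_sum)
    qed
  qed
  then have "measure_pmf.prob P {x. \<epsilon> * real n \<le> real (card {k. k < n \<and> x \<in> B k})} \<le> measure_pmf.prob P (\<Union>a<M. G a)"
    by (intro measure_pmf.finite_measure_mono) auto
  also have "\<dots> \<le> (\<Sum>a<M. measure_pmf.prob P (G a))"
    by (intro measure_pmf.finite_measure_subadditive_finite) auto
  also have "\<dots> \<le> (\<Sum>a<M. \<eta> ^ (n div M))"
  proof (intro sum_mono)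
    fix a assume a: "a \<in> {..<M}"
    have "measure_pmf.prob P (G a) \<le> ((1 + \<theta>) / 2 powr \<epsilon>) ^ card (C a)"
      unfolding G_def using fin \<theta> J[of _ a] by (intro prob_card_ge_of_prob_Inter) (auto simp: C_def)
    also have "\<dots> \<le> \<eta> ^ card (C a)" using \<theta> \<eta> by (intro power_mono) auto
    also have "\<dots> \<le> \<eta> ^ (n div M)" using cardC[of a] a \<eta> \<eta>0 by (intro power_decreasing) auto
    finally show "measure_pmf.prob P (G a) \<le> \<eta> ^ (n div M)" .
  qed
  finally show ?thesis by simp
qed

section \<open>Times at a site visited a single time\<close>

definition no_return :: "nat \<Rightarrow> nat \<Rightarrow> (nat \<Rightarrow> int) set" where
  "no_return k l = {x. \<forall>i\<in>{1..l}. position x (k + i) \<noteq> position x k}"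

definition no_return_back :: "nat \<Rightarrow> nat \<Rightarrow> (nat \<Rightarrow> int) set" where
  "no_return_back k l = {x. \<forall>i\<in>{1..l}. position x (k - i) \<noteq> position x k}"

lemma steps_reindex:
  assumes "inj_on h {..<l}" "h ` {..<l} \<subseteq> {..<n}"
  shows "map_pmf (\<lambda>x i. if i < l then x (h i) else 0) (steps p n) = steps p l"
  using iid_pmf_reindex[OF _ assms, of p] by (simp add: steps_def)

lemma prob_no_return:
  assumes "k + l \<le> n"
  shows "measure_pmf.prob (steps p n) (no_return k l) = measure_pmf.prob (steps p l) (no_return 0 l)"
proof -
  have "steps p l = map_pmf (\<lambda>x i. if i < l then x (k + i) else 0) (steps p n)"
    using assms by (intro steps_reindex[symmetric]) (auto simp: inj_on_def)
  moreover have "(\<lambda>x i. if i < l then x (k + i) else 0) -` no_return 0 l = no_return k l"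
    by (auto simp: no_return_def position_shift)
  ultimately show ?thesis by (simp add: measure_map_pmf)
qed

text \<open>Reversing the order of the increments turns a path seen backwards from time \<open>k\<close> into a path seen forwards.\<close>

lemma prob_no_return_back:
  assumes "l \<le> k" "k \<le> n"
  shows "measure_pmf.prob (steps p n) (no_return_back k l) = measure_pmf.prob (steps p l) (no_return 0 l)"
proof -
  have "steps p l = map_pmf (\<lambda>x i. if i < l then x (k - 1 - i) else 0) (steps p n)"
    using assms by (intro steps_reindex[symmetric]) (auto simp: inj_on_def)
  moreover have "(\<lambda>x i. if i < l then x (k - 1 - i) else 0) -` no_return 0 l = no_return_back k l"
    using assms by (auto simp: no_return_def no_return_back_def position_reverse)
  ultimately show ?thesis by (simp add: measure_map_pmf)
qed

text \<open>All that the path estimates use of the step law: a sum of \<open>k\<close> steps takes no value with probability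
above \<open>\<rho> k\<close>, and \<open>\<rho>\<close> is summable. In particular the walk is transient.\<close>

locale concentrated_walk =
  fixes p :: "int pmf" and \<rho> :: "nat \<Rightarrow> real"
  assumes conc: "\<And>n j k z. j < k \<Longrightarrow> k \<le> n \<Longrightarrow>
      measure_pmf.prob (steps p n) {x. increment x j k = z} \<le> \<rho> (k - j)"
    and summable_\<rho>: "summable \<rho>" and \<rho>_nonneg: "\<And>k. 0 \<le> \<rho> k"
begin

lemma prob_position_eq_le:
  assumes "j \<noteq> k" "j \<le> n" "k \<le> n"
  shows "measure_pmf.prob (steps p n) {x. position x j = position x k} \<le> \<rho> (max j k - min j k)"
  unfolding position_eq_iff_increment using assms by (intro conc) (auto simp: min_def max_def)

text \<open>Decompose according to the last visit to the origin up to time \<open>m + l\<close>. Visits later than \<open>m\<close> have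
total probability at most \<open>1/2\<close> if \<open>m\<close> is large, and after a last visit at some \<open>j \<le> m\<close> there is no return
for at least \<open>l\<close> steps. Hence \<open>1 \<le> (m + 1) f + 1/2\<close> for the probability \<open>f\<close> of no return in \<open>l\<close> steps.\<close>

lemma no_return_lower_bound: "\<exists>\<kappa>>0. \<forall>l. \<kappa> \<le> measure_pmf.prob (steps p l) (no_return 0 l)"
proof -
  have "(\<lambda>m. \<Sum>i. \<rho> (i + m)) \<longlonglongrightarrow> 0"
    using suminf_exist_split2[OF summable_\<rho>] .
  then have "eventually (\<lambda>m. (\<Sum>i. \<rho> (i + m)) < 1 / 2) sequentially" by (rule order_tendstoD) simp
  then obtain m where m: "(\<Sum>i. \<rho> (i + m)) < 1 / 2" by (auto simp: eventually_sequentially)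
  show ?thesis
  proof (intro exI conjI allI)
    show "0 < 1 / (2 * real (Suc m))" by simp
    fix l
    let ?P = "measure_pmf.prob (steps p (m + l))" and ?f = "measure_pmf.prob (steps p l) (no_return 0 l)"
    have "UNIV \<subseteq> (\<Union>j\<in>{..m}. no_return j l) \<union> (\<Union>i\<in>{..l}. {x. position x (i + Suc m) = position x 0 \<and> i + Suc m \<le> m + l})"
    proof
      fix x :: "nat \<Rightarrow> int"
      \<comment> \<open>The last visit to the origin is the largest element of \<open>S\<close>.\<close>
      define S where "S = {j. j \<le> m + l \<and> position x j = position x 0}"
      have S: "finite S" "0 \<in> S" by (auto simp: S_def)
      define j where "j = Max S"
      have j: "j \<in> S" "\<And>i. i \<in> S \<Longrightarrow> i \<le> j" unfolding j_def by (rule Max_in, use S in blast, use S in blast, rule Max_ge, use S in blast)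
      show "x \<in> (\<Union>j\<in>{..m}. no_return j l) \<union> (\<Union>i\<in>{..l}. {x. position x (i + Suc m) = position x 0 \<and> i + Suc m \<le> m + l})"
      proof (cases "j \<le> m")
        case True
        have "x \<in> no_return j l"
          unfolding no_return_def
        proof safe
          fix i assume i: "i \<in> {1..l}" "position x (j + i) = position x j"
          then have "j + i \<in> S" using j(1) True by (simp add: S_def)
          then show False using j(2)[of "j + i"] i by simp
        qed
        then show ?thesis using True by blast
      next
        case False
        then have "j - Suc m \<in> {..l}" "position x ((j - Suc m) + Suc m) = position x 0 \<and> (j - Suc m) + Suc m \<le> m + l"
          using j(1) by (auto simp: S_def)
        then show ?thesis by blast
      qed
    qed
    note cover = this
    have "1 = ?P UNIV" using measure_pmf.prob_space[of "steps p (m + l)"] by simp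
    also have "\<dots> \<le> ?P ((\<Union>j\<in>{..m}. no_return j l) \<union> (\<Union>i\<in>{..l}. {x. position x (i + Suc m) = position x 0 \<and> i + Suc m \<le> m + l}))"
      by (intro measure_pmf.finite_measure_mono cover) auto
    also have "\<dots> \<le> ?P (\<Union>j\<in>{..m}. no_return j l) + ?P (\<Union>i\<in>{..l}. {x. position x (i + Suc m) = position x 0 \<and> i + Suc m \<le> m + l})"
      by (intro measure_Un_le) auto
    also have "?P (\<Union>j\<in>{..m}. no_return j l) \<le> (\<Sum>j\<in>{..m}. ?P (no_return j l))"
      by (intro measure_pmf.finite_measure_subadditive_finite) auto
    also have "\<dots> = (\<Sum>j\<in>{..m}. ?f)" by (intro sum.cong prob_no_return) auto
    also have "\<dots> = real (Suc m) * ?f" by simp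
    also have "?P (\<Union>i\<in>{..l}. {x. position x (i + Suc m) = position x 0 \<and> i + Suc m \<le> m + l}) \<le>
        (\<Sum>i\<in>{..l}. ?P {x. position x (i + Suc m) = position x 0 \<and> i + Suc m \<le> m + l})"
      by (intro measure_pmf.finite_measure_subadditive_finite) auto
    also have "\<dots> \<le> (\<Sum>i\<in>{..l}. \<rho> (i + Suc m))"
    proof (intro sum_mono)
      fix i
      show "?P {x. position x (i + Suc m) = position x 0 \<and> i + Suc m \<le> m + l} \<le> \<rho> (i + Suc m)"
      proof (cases "i + Suc m \<le> m + l")
        case True
        then show ?thesis using prob_position_eq_le[of "i + Suc m" 0 "m + l"] by simp
      next
        case False
        then show ?thesis using \<rho>_nonneg by simp
      qed
    qed
    also have "\<dots> = (\<Sum>i\<in>Suc ` {..l}. \<rho> (i + m))" by (subst sum.reindex) auto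
    also have "\<dots> \<le> (\<Sum>i. \<rho> (i + m))"
      using summable_\<rho> by (intro sum_le_suminf) (auto simp: \<rho>_nonneg summable_iff_shift)
    finally have "1 / 2 \<le> real (Suc m) * ?f" using m by simp
    then show "1 / (2 * real (Suc m)) \<le> ?f" by (simp add: field_simps)
  qed
qed

end

text \<open>A time \<open>k\<close> whose site is visited more than once before \<open>n\<close> is counted by the distance to another visit: at most
\<open>m\<close>, or more than \<open>m\<close> in the past, or more than \<open>m\<close> in the future. Each kind has its own product bound over a
residue class modulo \<open>2m + 1\<close>.\<close>

definition local_return :: "nat \<Rightarrow> nat \<Rightarrow> nat \<Rightarrow> (nat \<Rightarrow> int) set" where
  "local_return n m k = {x. \<exists>j<n. j \<noteq> k \<and> j \<le> k + m \<and> k \<le> j + m \<and> position x j = position x k}"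

definition old_return :: "nat \<Rightarrow> nat \<Rightarrow> nat \<Rightarrow> (nat \<Rightarrow> int) set" where
  "old_return n m k = {x. \<exists>j<n. j + m < k \<and> position x j = position x k}"

definition late_return :: "nat \<Rightarrow> nat \<Rightarrow> nat \<Rightarrow> (nat \<Rightarrow> int) set" where
  "late_return n m k = {x. \<exists>j<n. k + m < j \<and> position x j = position x k}"

definition visited_once :: "nat \<Rightarrow> nat \<Rightarrow> (nat \<Rightarrow> int) set" where
  "visited_once n k = {x. \<forall>j<n. j \<noteq> k \<longrightarrow> position x j \<noteq> position x k}"

lemma not_visited_once_iff: "x \<notin> visited_once n k \<longleftrightarrow> x \<in> local_return n m k \<or> x \<in> old_return n m k \<or> x \<in> late_return n m k"
proof
  assume "x \<notin> visited_once n k"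
  then obtain j where j: "j < n" "j \<noteq> k" "position x j = position x k" by (auto simp: visited_once_def)
  consider "j + m < k" | "k + m < j" | "j \<le> k + m" "k \<le> j + m" by linarith
  then show "x \<in> local_return n m k \<or> x \<in> old_return n m k \<or> x \<in> late_return n m k"
    using j unfolding local_return_def old_return_def late_return_def by cases blast+
qed (auto simp: local_return_def old_return_def late_return_def visited_once_def)

lemma mod_eq_imp_add_le: "\<lbrakk>(k::nat) < k'; k mod M = k' mod M\<rbrakk> \<Longrightarrow> k + M \<le> k'"
  by (metis dvd_imp_le le_add_diff_inverse less_imp_le_nat mod_eq_dvd_iff_nat nat_add_left_cancel_le zero_less_diff)

context concentrated_walk begin

text \<open>The windows of radius \<open>m\<close> around different times of the class use disjoint sets of increments, so the events are
independent. One of them fails if there is no return to the position at time \<open>k\<close> within the window in either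
direction; the two directions are independent, each of probability at least \<open>\<kappa>\<close>.\<close>

lemma prob_Inter_local_return:
  assumes \<kappa>: "0 < \<kappa>" "\<And>l. \<kappa> \<le> measure_pmf.prob (steps p l) (no_return 0 l)"
    and J: "J \<subseteq> {k. k < n \<and> k mod (2 * m + 1) = a}"
  shows "measure_pmf.prob (steps p n) (\<Inter>k\<in>J. local_return n m k) \<le> (1 - \<kappa>\<^sup>2) ^ card J"
proof -
  have "finite J" using J finite_subset by fastforce
  then show ?thesis using J
  proof (induction J rule: finite_linorder_max_induct)
    case empty
    then show ?case by simp
  next
    case (insert k J)
    let ?P = "measure_pmf.prob (steps p n)"
    have k: "k < n" using insert.prems by simp
    have sep: "j + m + m < k" if "j \<in> J" for j
      using mod_eq_imp_add_le[of j k "2 * m + 1"] that insert by fastforce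
    \<comment> \<open>Near the ends of the time interval the window is cut; shorter stretches without return are only more
      likely.\<close>
    define a b where "a = min m k" and "b = min m (n - 1 - k)"
    have "?P (no_return k b \<inter> no_return_back k a) = ?P (no_return k b) * ?P (no_return_back k a)"
      unfolding steps_def
    proof (rule prob_indep[where B="{k..<k + b}"])
      show "{k..<k + b} \<subseteq> {..<n}" using k by (auto simp: b_def)
      show "resample {k..<k + b} x y \<in> no_return k b \<longleftrightarrow> y \<in> no_return k b" for x y
        unfolding no_return_def by (auto simp: position_eq_resample_in)
      show "resample {k..<k + b} x y \<in> no_return_back k a \<longleftrightarrow> x \<in> no_return_back k a" for x y
        unfolding no_return_back_def by (auto simp: position_eq_resample_out)
    qed simp
    also have "\<dots> = measure_pmf.prob (steps p b) (no_return 0 b) * measure_pmf.prob (steps p a) (no_return 0 a)"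
      using k by (subst prob_no_return, simp add: b_def, subst prob_no_return_back) (auto simp: a_def)
    also have "\<dots> \<ge> \<kappa> * \<kappa>" using \<kappa> by (intro mult_mono) auto
    finally have "\<kappa>\<^sup>2 \<le> ?P (no_return k b \<inter> no_return_back k a)" by (simp add: power2_eq_square)
    also have "\<dots> \<le> ?P (- local_return n m k)"
    proof (intro measure_pmf.finite_measure_mono subsetI)
      fix x assume x: "x \<in> no_return k b \<inter> no_return_back k a"
      have "position x j \<noteq> position x k" if "j < n" "j \<noteq> k" "j \<le> k + m" "k \<le> j + m" for j
      proof (cases "k < j")
        case True
        then have "j = k + (j - k)" "j - k \<in> {1..b}" using that by (auto simp: b_def)
        then show ?thesis using x unfolding no_return_def by (metis (mono_tags, lifting) IntD1 mem_Collect_eq)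
      next
        case False
        then have "j = k - (k - j)" "k - j \<in> {1..a}" using that by (auto simp: a_def)
        then show ?thesis using x unfolding no_return_back_def by (metis (mono_tags, lifting) IntD2 mem_Collect_eq)
      qed
      then show "x \<in> - local_return n m k" by (auto simp: local_return_def)
    qed simp
    also have "\<dots> = 1 - ?P (local_return n m k)"
      using measure_pmf.prob_compl[of "local_return n m k"] by (simp add: Compl_eq_Diff_UNIV)
    finally have le: "?P (local_return n m k) \<le> 1 - \<kappa>\<^sup>2" by simp
    have B: "{k - m..<k + m} \<inter> {..<n} \<subseteq> {..<n}" by auto
    have "?P (\<Inter>k\<in>insert k J. local_return n m k) = ?P (local_return n m k \<inter> (\<Inter>k\<in>J. local_return n m k))"
      by simp
    also have "\<dots> = ?P (local_return n m k) * ?P (\<Inter>k\<in>J. local_return n m k)"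
      unfolding steps_def
    proof (rule prob_indep[OF _ B])
      show "resample ({k - m..<k + m} \<inter> {..<n}) x y \<in> local_return n m k \<longleftrightarrow> y \<in> local_return n m k" for x y
      proof -
        have "position (resample ({k - m..<k + m} \<inter> {..<n}) x y) j = position (resample ({k - m..<k + m} \<inter> {..<n}) x y) k \<longleftrightarrow> position y j = position y k"
          if "j < n" "j \<le> k + m" "k \<le> j + m" for j
          using that k by (intro position_eq_resample_in) auto
        then show ?thesis unfolding local_return_def by blast
      qed
      show "resample ({k - m..<k + m} \<inter> {..<n}) x y \<in> (\<Inter>k\<in>J. local_return n m k) \<longleftrightarrow> x \<in> (\<Inter>k\<in>J. local_return n m k)" for x y
      proof -
        have "position (resample ({k - m..<k + m} \<inter> {..<n}) x y) j = position (resample ({k - m..<k + m} \<inter> {..<n}) x y) i \<longleftrightarrow> position x j = position x i"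
          if "i \<in> J" "j \<le> i + m" for i j
          using sep[OF that(1)] that by (intro position_eq_resample_out) auto
        then have "resample ({k - m..<k + m} \<inter> {..<n}) x y \<in> local_return n m i \<longleftrightarrow> x \<in> local_return n m i" if "i \<in> J" for i
          using that unfolding local_return_def by blast
        then show ?thesis by blast
      qed
    qed simp
    also have "\<dots> \<le> (1 - \<kappa>\<^sup>2) * (1 - \<kappa>\<^sup>2) ^ card J"
      using insert le order_trans[OF measure_nonneg le] by (intro mult_mono) auto
    also have "\<dots> = (1 - \<kappa>\<^sup>2) ^ card (insert k J)"
      using insert by (subst card_insert_disjoint) auto
    finally show ?case .
  qed
qed

text \<open>Adding the largest time \<open>k\<close>: given the path up to time \<open>k - m\<close>, the next \<open>m\<close> increments have to bring
the walk to one of at most \<open>n\<close> old positions.\<close>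

lemma prob_Inter_old_return:
  assumes m: "1 \<le> m" and J: "J \<subseteq> {k. k < n \<and> k mod (2 * m + 1) = a}"
  shows "measure_pmf.prob (steps p n) (\<Inter>k\<in>J. old_return n m k) \<le> (real n * \<rho> m) ^ card J"
proof -
  have "finite J" using J finite_subset by fastforce
  then show ?thesis using J
  proof (induction J rule: finite_linorder_max_induct)
    case empty
    then show ?case by simp
  next
    case (insert k J)
    let ?P = "measure_pmf.prob (steps p n)"
    let ?E = "\<Inter>k\<in>J. old_return n m k"
    have k: "k < n" using insert.prems by simp
    have sep: "j + m < k" if "j \<in> J" for j
      using mod_eq_imp_add_le[of j k "2 * m + 1"] that insert by fastforce
    have hit: "?P (?E \<inter> {x. increment x (k - m) k = position x j - position x (k - m)}) \<le> \<rho> m * ?P ?E"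
      if j: "j + m < k" for j
      unfolding steps_def
    proof (rule prob_hit_le[where B="{k - m..<k}"])
      show "{k - m..<k} \<subseteq> {..<n}" using k by auto
      show "resample {k - m..<k} x y \<in> ?E \<longleftrightarrow> x \<in> ?E" for x y
      proof -
        have "position (resample {k - m..<k} x y) j = position (resample {k - m..<k} x y) i \<longleftrightarrow> position x j = position x i"
          if "i \<in> J" "j \<le> i" for i j
          using sep[OF that(1)] that by (intro position_eq_resample_out) auto
        then have "resample {k - m..<k} x y \<in> old_return n m i \<longleftrightarrow> x \<in> old_return n m i" if "i \<in> J" for i
          using that unfolding old_return_def by (auto 0 4)
        then show ?thesis by blast
      qed
      show "position (resample {k - m..<k} x y) j - position (resample {k - m..<k} x y) (k - m) = position x j - position x (k - m)" for x y
        using j by (subst (1 2) position_resample_out) auto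
      show "increment (resample {k - m..<k} x y) (k - m) k = increment y (k - m) k" for x y
        by (rule increment_resample_in) simp
      show "measure_pmf.prob (iid_pmf {..<n} p) {y. increment y (k - m) k = z} \<le> \<rho> m" for z
        using conc[of "k - m" k n z] j k m by (simp add: steps_def)
    qed simp
    have "(\<Inter>k\<in>insert k J. old_return n m k) \<subseteq>
      (\<Union>j\<in>{..<k - m}. ?E \<inter> {x. increment x (k - m) k = position x j - position x (k - m)})"
    proof
      fix x assume x: "x \<in> (\<Inter>k\<in>insert k J. old_return n m k)"
      then obtain j where j: "j < n" "j + m < k" "position x j = position x k" by (auto simp: old_return_def)
      then have "increment x (k - m) k = position x j - position x (k - m)"
        using position_split[of "k - m" k x] by simp
      moreover have "j \<in> {..<k - m}" using j by auto
      ultimately show "x \<in> (\<Union>j\<in>{..<k - m}. ?E \<inter> {x. increment x (k - m) k = position x j - position x (k - m)})"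
        using x by auto
    qed
    then have "?P (\<Inter>k\<in>insert k J. old_return n m k) \<le>
      ?P (\<Union>j\<in>{..<k - m}. ?E \<inter> {x. increment x (k - m) k = position x j - position x (k - m)})"
      by (intro measure_pmf.finite_measure_mono) auto
    also have "\<dots> \<le> (\<Sum>j\<in>{..<k - m}. ?P (?E \<inter> {x. increment x (k - m) k = position x j - position x (k - m)}))"
      by (intro measure_pmf.finite_measure_subadditive_finite) auto
    also have "\<dots> \<le> (\<Sum>j\<in>{..<k - m}. \<rho> m * ?P ?E)"
      by (intro sum_mono hit) auto
    also have "\<dots> = real (card {..<k - m}) * (\<rho> m * ?P ?E)" by simp
    also have "\<dots> \<le> real n * (\<rho> m * ?P ?E)"
      using k by (intro mult_right_mono mult_nonneg_nonneg \<rho>_nonneg) auto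
    also have "\<dots> \<le> real n * (\<rho> m * (real n * \<rho> m) ^ card J)"
      using insert by (intro mult_left_mono \<rho>_nonneg) auto
    also have "\<dots> = (real n * \<rho> m) ^ card (insert k J)"
      using insert by (subst card_insert_disjoint) auto
    finally show ?case .
  qed
qed

text \<open>The mirror image of the preceding bound: the smallest time \<open>k\<close> is added, and the increments after time \<open>k + m\<close> are
frozen.\<close>

lemma prob_Inter_late_return:
  assumes m: "1 \<le> m" and J: "J \<subseteq> {k. k < n \<and> k mod (2 * m + 1) = a}"
  shows "measure_pmf.prob (steps p n) (\<Inter>k\<in>J. late_return n m k) \<le> (real n * \<rho> m) ^ card J"
proof -
  have "finite J" using J finite_subset by fastforce
  then show ?thesis using J
  proof (induction J rule: finite_linorder_min_induct)
    case empty
    then show ?case by simp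
  next
    case (insert k J)
    let ?P = "measure_pmf.prob (steps p n)"
    let ?E = "\<Inter>k\<in>J. late_return n m k"
    have k: "k < n" using insert by simp
    have sep: "k + m < j" if "j \<in> J" for j
      using mod_eq_imp_add_le[of k j "2 * m + 1"] that insert by fastforce
    have hit: "?P (?E \<inter> {x. increment x k (k + m) = - increment x (k + m) j}) \<le> \<rho> m * ?P ?E"
      if j: "k + m < j" "j < n" for j
      unfolding steps_def
    proof (rule prob_hit_le[where B="{k..<k + m}"])
      show "{k..<k + m} \<subseteq> {..<n}" using j by auto
      show "resample {k..<k + m} x y \<in> ?E \<longleftrightarrow> x \<in> ?E" for x y
      proof -
        have "position (resample {k..<k + m} x y) j = position (resample {k..<k + m} x y) i \<longleftrightarrow> position x j = position x i"
          if "i \<in> J" "i \<le> j" for i j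
          using sep[OF that(1)] that by (intro position_eq_resample_out) auto
        then have "resample {k..<k + m} x y \<in> late_return n m i \<longleftrightarrow> x \<in> late_return n m i" if "i \<in> J" for i
          using that unfolding late_return_def by (auto 0 4)
        then show ?thesis by blast
      qed
      show "- increment (resample {k..<k + m} x y) (k + m) j = - increment x (k + m) j" for x y
        by (subst increment_resample_out) auto
      show "increment (resample {k..<k + m} x y) k (k + m) = increment y k (k + m)" for x y
        by (rule increment_resample_in) simp
      show "measure_pmf.prob (iid_pmf {..<n} p) {y. increment y k (k + m) = z} \<le> \<rho> m" for z
        using conc[of k "k + m" n z] j k m by (simp add: steps_def)
    qed simp
    have "(\<Inter>k\<in>insert k J. late_return n m k) \<subseteq>
      (\<Union>j\<in>{k + m<..<n}. ?E \<inter> {x. increment x k (k + m) = - increment x (k + m) j})"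
    proof
      fix x assume x: "x \<in> (\<Inter>k\<in>insert k J. late_return n m k)"
      then obtain j where j: "j < n" "k + m < j" "position x j = position x k" by (auto simp: late_return_def)
      then have "increment x k (k + m) = - increment x (k + m) j"
        using position_split[of k "k + m" x] position_split[of "k + m" j x] by simp
      then show "x \<in> (\<Union>j\<in>{k + m<..<n}. ?E \<inter> {x. increment x k (k + m) = - increment x (k + m) j})"
        using x j by auto
    qed
    then have "?P (\<Inter>k\<in>insert k J. late_return n m k) \<le>
      ?P (\<Union>j\<in>{k + m<..<n}. ?E \<inter> {x. increment x k (k + m) = - increment x (k + m) j})"
      by (intro measure_pmf.finite_measure_mono) auto
    also have "\<dots> \<le> (\<Sum>j\<in>{k + m<..<n}. ?P (?E \<inter> {x. increment x k (k + m) = - increment x (k + m) j}))"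
      by (intro measure_pmf.finite_measure_subadditive_finite) auto
    also have "\<dots> \<le> (\<Sum>j\<in>{k + m<..<n}. \<rho> m * ?P ?E)"
      by (intro sum_mono hit) auto
    also have "\<dots> = real (card {k + m<..<n}) * (\<rho> m * ?P ?E)" by simp
    also have "\<dots> \<le> real n * (\<rho> m * ?P ?E)"
      using k by (intro mult_right_mono mult_nonneg_nonneg \<rho>_nonneg) auto
    also have "\<dots> \<le> real n * (\<rho> m * (real n * \<rho> m) ^ card J)"
      using insert by (intro mult_left_mono \<rho>_nonneg) auto
    also have "\<dots> = (real n * \<rho> m) ^ card (insert k J)"
      using insert by (subst card_insert_disjoint) auto
    finally show ?case .
  qed
qed

text \<open>Local returns occur at most at a density bounded away from one, old and late returns at an arbitrarily small
density, each up to a probability exponentially small in \<open>n div (2m + 1)\<close>.\<close>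

lemma prob_few_visited_once:
  "\<exists>c>0. \<exists>q>0. \<exists>\<eta>>0. \<eta> < 1 \<and> (\<forall>n m. 1 \<le> m \<longrightarrow> real n * \<rho> m \<le> q \<longrightarrow>
     measure_pmf.prob (steps p n) {x. real (card {k. k < n \<and> x \<in> visited_once n k}) < c * real n}
       \<le> 3 * (real (2 * m + 1) * \<eta> ^ (n div (2 * m + 1))))"
proof -
  obtain \<kappa> where \<kappa>: "0 < \<kappa>" "\<And>l. \<kappa> \<le> measure_pmf.prob (steps p l) (no_return 0 l)"
    using no_return_lower_bound by blast
  have "\<kappa> \<le> 1" using \<kappa>(2)[of 0] order_trans measure_pmf.prob_le_1 by blast
  define K where "K = \<kappa>\<^sup>2"
  have K: "0 < K" "K \<le> 1" using \<kappa> \<open>\<kappa> \<le> 1\<close> by (auto simp: K_def power_le_one)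
  \<comment> \<open>Local returns are allowed the density \<open>1 - 3c\<close>, old and late returns \<open>c\<close> each, which leaves \<open>c\<close> for the
    times of single visits. The value of \<open>c\<close> makes the first ratio in the Chernoff bound \<open>1 - K\<^sup>2/4\<close>.\<close>
  define c where "c = log 2 (1 + K / 2) / 3"
  have c: "0 < c" using K by (simp add: c_def)
  define q where "q = 2 powr (c / 2) - 1"
  have q: "0 < q" using c by (simp add: q_def)
  define \<eta> where "\<eta> = max (1 - K\<^sup>2 / 4) (2 powr (- c / 2))"
  have \<eta>: "0 < \<eta>" "\<eta> < 1" using K c by (auto simp: \<eta>_def powr_less_one less_max_iff_disj)
  have l3: "(1 + (1 - K)) / 2 powr (1 - 3 * c) \<le> \<eta>"
  proof -
    have "2 powr (3 * c) = 1 + K / 2" using K by (simp add: c_def)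
    then have "2 powr (1 - 3 * c) = 2 / (1 + K / 2)" by (simp only: powr_diff) simp
    note pd = this
    have "(1 + (1 - K)) / 2 powr (1 - 3 * c) = (1 - K / 2) * (1 + K / 2)"
      unfolding pd using K by (simp add: field_simps)
    also have "\<dots> = 1 - K\<^sup>2 / 4" by (simp add: field_simps power2_eq_square)
    finally show ?thesis by (simp add: \<eta>_def)
  qed
  have "measure_pmf.prob (steps p n) {x. real (card {k. k < n \<and> x \<in> visited_once n k}) < c * real n}
       \<le> 3 * (real (2 * m + 1) * \<eta> ^ (n div (2 * m + 1)))" if m: "1 \<le> m" and nq: "real n * \<rho> m \<le> q" for n m
  proof -
    let ?P = "measure_pmf.prob (steps p n)"
    let ?t = "real (2 * m + 1) * \<eta> ^ (n div (2 * m + 1))"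
    have lq: "(1 + real n * \<rho> m) / 2 powr c \<le> \<eta>"
    proof -
      have "(1 + real n * \<rho> m) / 2 powr c \<le> 2 powr (c / 2) / 2 powr c"
        using nq by (intro divide_right_mono) (auto simp: q_def)
      also have "\<dots> = 2 powr (- c / 2)" by (simp add: powr_diff[symmetric])
      finally show ?thesis by (simp add: \<eta>_def)
    qed
    let ?A = "{x. (1 - 3 * c) * real n \<le> real (card {k. k < n \<and> x \<in> local_return n m k})}"
    let ?B = "{x. c * real n \<le> real (card {k. k < n \<and> x \<in> old_return n m k})}"
    let ?C = "{x. c * real n \<le> real (card {k. k < n \<and> x \<in> late_return n m k})}"
    have A: "?P ?A \<le> ?t"
      using K \<eta> prob_Inter_local_return[OF \<kappa>] l3
      by (intro prob_card_ge_of_classes[where \<theta>="1 - K"]) (auto simp: K_def)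
    have B: "?P ?B \<le> ?t"
      using \<eta> prob_Inter_old_return[OF m] lq \<rho>_nonneg
      by (intro prob_card_ge_of_classes[where \<theta>="real n * \<rho> m"]) auto
    have C: "?P ?C \<le> ?t"
      using \<eta> prob_Inter_late_return[OF m] lq \<rho>_nonneg
      by (intro prob_card_ge_of_classes[where \<theta>="real n * \<rho> m"]) auto
    have "{x. real (card {k. k < n \<and> x \<in> visited_once n k}) < c * real n} \<subseteq> ?A \<union> ?B \<union> ?C"
    proof
      fix x assume "x \<in> {x. real (card {k. k < n \<and> x \<in> visited_once n k}) < c * real n}"
      then have lt: "real (card {k. k < n \<and> x \<in> visited_once n k}) < c * real n" by simp
      have "{..<n} = {k. k < n \<and> x \<in> visited_once n k} \<union> ({k. k < n \<and> x \<in> local_return n m k}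
          \<union> ({k. k < n \<and> x \<in> old_return n m k} \<union> {k. k < n \<and> x \<in> late_return n m k}))"
        using not_visited_once_iff[of x n _ m] by blast
      then have "n = card \<dots>" by (metis card_lessThan)
      also have "\<dots> \<le> card {k. k < n \<and> x \<in> visited_once n k} + (card {k. k < n \<and> x \<in> local_return n m k}
          + (card {k. k < n \<and> x \<in> old_return n m k} + card {k. k < n \<and> x \<in> late_return n m k}))"
        by (intro order_trans[OF card_Un_le] add_mono order_refl)
      finally have "real n \<le> real (card {k. k < n \<and> x \<in> visited_once n k}) + (real (card {k. k < n \<and> x \<in> local_return n m k})
          + (real (card {k. k < n \<and> x \<in> old_return n m k}) + real (card {k. k < n \<and> x \<in> late_return n m k})))"
        by (simp only: of_nat_add[symmetric] of_nat_le_iff)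
      moreover have "(1 - 3 * c) * real n = real n - 3 * (c * real n)" by (simp add: algebra_simps)
      ultimately show "x \<in> ?A \<union> ?B \<union> ?C" using lt by (simp; linarith)
    qed
    then have "?P {x. real (card {k. k < n \<and> x \<in> visited_once n k}) < c * real n} \<le> ?P (?A \<union> ?B \<union> ?C)"
      by (intro measure_pmf.finite_measure_mono) auto
    also have "\<dots> \<le> ?P (?A \<union> ?B) + ?P ?C" by (intro measure_Un_le) auto
    also have "?P (?A \<union> ?B) \<le> ?P ?A + ?P ?B" by (intro measure_Un_le) auto
    finally show ?thesis using A B C by simp
  qed
  then show ?thesis using c q \<eta> by blast
qed

end

section \<open>The mean power of the local time\<close>

text \<open>Allows passing from visit counts to their powers of any exponent in \<open>[-1, 1]\<close>, hence to treat all \<open>\<beta> \<in> (0, 2]\<close>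
together.\<close>

lemma abs_powr_diff_le:
  fixes a b \<gamma> :: real
  assumes a: "1 \<le> a" "1 \<le> b" and \<gamma>: "\<bar>\<gamma>\<bar> \<le> 1"
  shows "\<bar>a powr \<gamma> - b powr \<gamma>\<bar> \<le> \<bar>a - b\<bar>"
proof -
  have *: "\<bar>a powr \<gamma> - b powr \<gamma>\<bar> \<le> \<bar>a - b\<bar>" if ab: "1 \<le> b" "b < a" for a b :: real
  proof -
    have "\<exists>z. b < z \<and> z < a \<and> a powr \<gamma> - b powr \<gamma> = (a - b) * (\<gamma> * z powr (\<gamma> - 1))"
      using ab by (intro MVT2) (auto intro!: derivative_eq_intros)
    then obtain z where z: "b < z" "a powr \<gamma> - b powr \<gamma> = (a - b) * (\<gamma> * z powr (\<gamma> - 1))" by blast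
    have "z powr (\<gamma> - 1) \<le> z powr 0" using z ab \<gamma> by (intro powr_mono) auto
    then have "\<bar>\<gamma>\<bar> * z powr (\<gamma> - 1) \<le> 1 * 1" using z ab \<gamma> by (intro mult_mono) auto
    then have "\<bar>a - b\<bar> * (\<bar>\<gamma>\<bar> * z powr (\<gamma> - 1)) \<le> \<bar>a - b\<bar> * 1" by (intro mult_left_mono) auto
    then show ?thesis by (simp add: z abs_mult)
  qed
  show ?thesis
    using *[of b a] *[of a b] a by (cases a b rule: linorder_cases) (auto simp: abs_minus_commute)
qed

definition visit_count :: "nat \<Rightarrow> (nat \<Rightarrow> int) \<Rightarrow> nat \<Rightarrow> nat" where
  "visit_count n x k = card {j. j < n \<and> position x j = position x k}"

text \<open>Unlike the full visit count this depends only on the increments within distance \<open>m\<close> of \<open>k\<close>, so that counts at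
distant times are independent.\<close>

definition window_count :: "nat \<Rightarrow> nat \<Rightarrow> (nat \<Rightarrow> int) \<Rightarrow> nat \<Rightarrow> nat" where
  "window_count n m x k = card {j. j < n \<and> j \<le> k + m \<and> k \<le> j + m \<and> position x j = position x k}"

lemma visit_count_ge_1: "k < n \<Longrightarrow> 1 \<le> visit_count n x k"
  by (force simp: visit_count_def Suc_le_eq card_gt_0_iff)

lemma window_count_ge_1: "k < n \<Longrightarrow> 1 \<le> window_count n m x k"
proof -
  assume "k < n"
  then have "k \<in> {j. j < n \<and> j \<le> k + m \<and> k \<le> j + m \<and> position x j = position x k}" by simp
  then have "0 < window_count n m x k" unfolding window_count_def by (subst card_gt_0_iff, intro conjI) (blast, simp)
  then show ?thesis by simp
qed

lemma visit_count_le: "visit_count n x k \<le> n"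
  unfolding visit_count_def using card_mono[of "{..<n}" "{j. j < n \<and> position x j = position x k}"] by auto

lemma window_count_le: "window_count n m x k \<le> 2 * m + 1"
proof -
  have "window_count n m x k \<le> card {k - m..k + m}"
    unfolding window_count_def by (intro card_mono) auto
  then show ?thesis by simp
qed

lemma window_count_0: "k < n \<Longrightarrow> window_count n 0 x k = 1"
proof -
  assume "k < n"
  then have "{j. j < n \<and> j \<le> k + 0 \<and> k \<le> j + 0 \<and> position x j = position x k} = {k}" by auto
  then show ?thesis by (simp add: window_count_def)
qed

lemma visit_count_eq_window_count_plus:
  "real (visit_count n x k) = real (window_count n m x k) +
    ((\<Sum>j\<in>{j. j < n \<and> j + m < k}. indicator {x. position x j = position x k} x) +
     (\<Sum>j\<in>{j. j < n \<and> k + m < j}. indicator {x. position x j = position x k} x))"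
proof -
  have eq: "{j. j < n \<and> position x j = position x k} = {j. j < n \<and> j \<le> k + m \<and> k \<le> j + m \<and> position x j = position x k} \<union>
    ({j\<in>{j. j < n \<and> j + m < k}. position x j = position x k} \<union> {j\<in>{j. j < n \<and> k + m < j}. position x j = position x k})" by auto
  have c: "(\<Sum>j\<in>A. indicator {x. position x j = position x k} x) = real (card {j\<in>A. position x j = position x k})"
    if "finite A" for A
    using that by (simp add: indicator_def sum.If_cases Int_def)
  show ?thesis unfolding visit_count_def window_count_def eq
    by (subst card_Un_disjoint, simp, simp, force, subst card_Un_disjoint, simp, simp, force, subst (1 2) c) auto
qed

lemma integrable_pmf_bounded:
  fixes f :: "'b \<Rightarrow> 'c::{banach, second_countable_topology}"
  assumes "\<And>x. norm (f x) \<le> C"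
  shows "integrable (measure_pmf P) f"
  using assms by (intro measure_pmf.integrable_const_bound[where B=C]) auto

lemma expectation_le_const:
  fixes f :: "'b \<Rightarrow> real"
  assumes "\<And>x. \<bar>f x\<bar> \<le> C" "\<And>x. f x \<le> D"
  shows "measure_pmf.expectation P f \<le> D"
proof -
  have "measure_pmf.expectation P f \<le> measure_pmf.expectation P (\<lambda>_. D)"
    using assms integrable_pmf_bounded[of f C] by (intro integral_mono) auto
  then show ?thesis by simp
qed

context concentrated_walk begin

text \<open>Bounds the mean number of visits later than \<open>m\<close> to the present position.\<close>

definition return_tail :: "nat \<Rightarrow> real" where "return_tail m = (\<Sum>i. \<rho> (i + Suc m))"

lemma return_tail_tendsto: "return_tail \<longlonglongrightarrow> 0"
  unfolding return_tail_def using LIMSEQ_Suc[OF suminf_exist_split2[OF summable_\<rho>]] by simp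

lemma return_tail_nonneg: "0 \<le> return_tail m"
  unfolding return_tail_def by (intro suminf_nonneg summable_ignore_initial_segment summable_\<rho> \<rho>_nonneg)

lemma sum_\<rho>_le_return_tail:
  assumes "finite A" "inj_on f A" "\<And>j. j \<in> A \<Longrightarrow> m < f j"
  shows "(\<Sum>j\<in>A. \<rho> (f j)) \<le> return_tail m"
proof -
  have "(\<Sum>j\<in>A. \<rho> (f j)) = (\<Sum>j\<in>A. \<rho> ((f j - Suc m) + Suc m))"
  proof (intro sum.cong refl)
    fix j assume "j \<in> A"
    then have "f j = f j - Suc m + Suc m" using assms(3)[of j] by linarith
    then show "\<rho> (f j) = \<rho> ((f j - Suc m) + Suc m)" by (rule arg_cong)
  qed
  also have "\<dots> = (\<Sum>i\<in>(\<lambda>j. f j - Suc m) ` A. \<rho> (i + Suc m))"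
  proof (subst sum.reindex)
    show "inj_on (\<lambda>j. f j - Suc m) A"
    proof (rule inj_onI)
      fix i j assume "i \<in> A" "j \<in> A" "f i - Suc m = f j - Suc m"
      then have "f i = f j" using assms(3)[of i] assms(3)[of j] by linarith
      then show "i = j" using assms(2) \<open>i \<in> A\<close> \<open>j \<in> A\<close> by (auto dest: inj_onD)
    qed
  qed simp
  also have "\<dots> \<le> return_tail m" unfolding return_tail_def
    using assms by (intro sum_le_suminf summable_ignore_initial_segment summable_\<rho> \<rho>_nonneg) auto
  finally show ?thesis .
qed

lemma expectation_visits_outside_window_le:
  assumes k: "k < n"
  shows "measure_pmf.expectation (steps p n) (\<lambda>x. real (visit_count n x k) - real (window_count n m x k)) \<le> 2 * return_tail m"
proof -
  let ?P = "measure_pmf.prob (steps p n)"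
  have int: "integrable (steps p n) (\<lambda>x. indicator {x. position x j = position x k} x :: real)" for j
    by (rule integrable_pmf_bounded[where C=1]) (auto simp: indicator_def)
  have "measure_pmf.expectation (steps p n) (\<lambda>x. real (visit_count n x k) - real (window_count n m x k)) =
    (\<Sum>j\<in>{j. j < n \<and> j + m < k}. ?P {x. position x j = position x k}) +
    (\<Sum>j\<in>{j. j < n \<and> k + m < j}. ?P {x. position x j = position x k})"
    unfolding visit_count_eq_window_count_plus[of n _ k m] using int
    by (simp add: Bochner_Integration.integral_sum Bochner_Integration.integrable_sum)
  also have "\<dots> \<le> (\<Sum>j\<in>{j. j < n \<and> j + m < k}. \<rho> (k - j)) + (\<Sum>j\<in>{j. j < n \<and> k + m < j}. \<rho> (j - k))"
  proof (intro add_mono sum_mono)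
    fix j assume "j \<in> {j. j < n \<and> j + m < k}"
    then show "?P {x. position x j = position x k} \<le> \<rho> (k - j)" using prob_position_eq_le[of j k n] k by simp
  next
    fix j assume "j \<in> {j. j < n \<and> k + m < j}"
    then show "?P {x. position x j = position x k} \<le> \<rho> (j - k)" using prob_position_eq_le[of j k n] k by simp
  qed
  also have "\<dots> \<le> return_tail m + return_tail m"
    by (intro add_mono sum_\<rho>_le_return_tail) (auto simp: inj_on_def)
  finally show ?thesis by simp
qed

lemma integrable_visit_count_fun:
  fixes f :: "nat \<Rightarrow> real"
  shows "integrable (steps p n) (\<lambda>x. f (visit_count n x k))"
  by (rule integrable_pmf_bounded[where C="\<Sum>i\<le>n. \<bar>f i\<bar>"])
     (simp add: visit_count_le member_le_sum[of _ "{..n}" "\<lambda>i. \<bar>f i\<bar>"])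

lemma expectation_visit_count_le:
  assumes k: "k < n"
  shows "measure_pmf.expectation (steps p n) (\<lambda>x. real (visit_count n x k)) \<le> 1 + 2 * return_tail 0"
proof -
  have "measure_pmf.expectation (steps p n) (\<lambda>x. real (visit_count n x k) - real (window_count n 0 x k)) =
    measure_pmf.expectation (steps p n) (\<lambda>x. real (visit_count n x k)) - 1"
    using k integrable_visit_count_fun[of n real k] by (simp add: window_count_0)
  then show ?thesis using expectation_visits_outside_window_le[OF k, of 0] by simp
qed

text \<open>Uniform integrability without second moments: a count above twice the maximal window count is at most twice the
number of visits outside the window.\<close>

lemma expectation_large_visit_count_le:
  assumes k: "k < n"
  shows "measure_pmf.expectation (steps p n)
     (\<lambda>x. real (visit_count n x k) * indicator {x. 2 * (2 * m + 1) < visit_count n x k} x) \<le> 4 * return_tail m"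
proof -
  have wc: "window_count n m x k \<le> visit_count n x k" for x
    unfolding window_count_def visit_count_def by (intro card_mono) auto
  have i1: "integrable (steps p n) (\<lambda>x. 2 * (real (visit_count n x k) - real (window_count n m x k)))"
  proof (rule integrable_pmf_bounded[where C="2 * real n"])
    fix x show "norm (2 * (real (visit_count n x k) - real (window_count n m x k))) \<le> 2 * real n"
      using wc[of x] visit_count_le[of n x k] by simp
  qed
  have i2: "integrable (steps p n) (\<lambda>x. real (visit_count n x k) * indicator {x. 2 * (2 * m + 1) < visit_count n x k} x)"
    by (rule integrable_pmf_bounded[where C="real n"]) (auto simp: visit_count_le indicator_def)
  have "measure_pmf.expectation (steps p n)
     (\<lambda>x. real (visit_count n x k) * indicator {x. 2 * (2 * m + 1) < visit_count n x k} x) \<le>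
     measure_pmf.expectation (steps p n) (\<lambda>x. 2 * (real (visit_count n x k) - real (window_count n m x k)))"
  proof (intro integral_mono i1 i2)
    fix x
    show "real (visit_count n x k) * indicator {x. 2 * (2 * m + 1) < visit_count n x k} x \<le>
        2 * (real (visit_count n x k) - real (window_count n m x k))"
      using wc[of x] window_count_le[of n m x k] by (auto simp: indicator_def)
  qed
  also have "\<dots> = 2 * measure_pmf.expectation (steps p n) (\<lambda>x. real (visit_count n x k) - real (window_count n m x k))"
    by (rule integral_mult_right_zero)
  also have "\<dots> \<le> 4 * return_tail m" using expectation_visits_outside_window_le[OF k, of m] by simp
  finally show ?thesis .
qed

end

definition window_mean :: "int pmf \<Rightarrow> real \<Rightarrow> nat \<Rightarrow> real" where
  "window_mean p \<gamma> m = measure_pmf.expectation (steps p (2 * m)) (\<lambda>x. real (window_count (2 * m + 1) m x m) powr \<gamma>)"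

lemma powr_window_count_bounds:
  assumes "\<gamma> \<le> 1"
  shows "0 \<le> real (window_count n m x k) powr \<gamma>" "real (window_count n m x k) powr \<gamma> \<le> real (2 * m + 1)"
proof -
  show "real (window_count n m x k) powr \<gamma> \<le> real (2 * m + 1)"
  proof (cases "window_count n m x k = 0")
    case False
    then have "real (window_count n m x k) powr \<gamma> \<le> real (window_count n m x k) powr 1"
      using assms by (intro powr_mono) auto
    also have "\<dots> \<le> real (2 * m + 1)" using window_count_le[of n m x k] by (simp del: of_nat_Suc of_nat_add)
    finally show ?thesis .
  qed simp
qed simp

lemma window_mean_bounds:
  assumes "\<gamma> \<le> 1"
  shows "0 \<le> window_mean p \<gamma> m" "window_mean p \<gamma> m \<le> real (2 * m + 1)"
proof -
  show "0 \<le> window_mean p \<gamma> m" unfolding window_mean_def by (intro integral_nonneg_AE) auto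
  show "window_mean p \<gamma> m \<le> real (2 * m + 1)" unfolding window_mean_def
    using powr_window_count_bounds[OF assms] by (intro expectation_le_const[where C="real (2 * m + 1)"]) (auto simp del: of_nat_Suc of_nat_add)
qed

text \<open>Away from the ends of the time interval the law of the window count depends neither on \<open>k\<close> nor on \<open>n\<close>.\<close>

lemma expectation_window_count:
  assumes k: "m \<le> k" "k + m < n"
  shows "measure_pmf.expectation (steps p n) (\<lambda>x. real (window_count n m x k) powr \<gamma>) = window_mean p \<gamma> m"
proof -
  define T :: "(nat \<Rightarrow> int) \<Rightarrow> nat \<Rightarrow> int" where "T x = (\<lambda>i. if i < 2 * m then x (k - m + i) else 0)" for x
  have "steps p (2 * m) = map_pmf T (steps p n)"
    unfolding T_def using k by (intro steps_reindex[symmetric]) (auto simp: inj_on_def)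
  moreover have "window_count (2 * m + 1) m (T x) m = window_count n m x k" for x
  proof -
    have posT: "position (T x) i = position x (k - m + i) - position x (k - m)" if "i \<le> 2 * m" for i
      unfolding T_def by (rule position_shift[OF that])
    have "bij_betw (\<lambda>i. k - m + i)
      {j. j < 2 * m + 1 \<and> j \<le> m + m \<and> m \<le> j + m \<and> position (T x) j = position (T x) m}
      {j. j < n \<and> j \<le> k + m \<and> k \<le> j + m \<and> position x j = position x k}"
      using k by (intro bij_betw_byWitness[of _ "\<lambda>j. j - (k - m)"]) (auto simp: posT)
    then show ?thesis unfolding window_count_def by (rule bij_betw_same_card)
  qed
  ultimately show ?thesis unfolding window_mean_def by simp
qed

text \<open>Window counts at times at least \<open>2m\<close> apart use disjoint sets of increments.\<close>

lemma expectation_window_count_mult: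
  assumes k: "m \<le> k" "k + 2 * m \<le> l" "l + m < n" and \<gamma>: "\<gamma> \<le> 1"
  shows "measure_pmf.expectation (steps p n) (\<lambda>x. real (window_count n m x k) powr \<gamma> * real (window_count n m x l) powr \<gamma>)
    = (window_mean p \<gamma> m)\<^sup>2"
proof -
  have 1: "window_count n m (resample {k - m..<k + m} x y) k = window_count n m y k" for x y
  proof -
    have "position (resample {k - m..<k + m} x y) j = position (resample {k - m..<k + m} x y) k \<longleftrightarrow> position y j = position y k"
      if "j \<le> k + m" "k \<le> j + m" for j
      using that by (intro position_eq_resample_in) auto
    then show ?thesis unfolding window_count_def by (intro arg_cong[where f=card]) auto
  qed
  have 2: "window_count n m (resample {k - m..<k + m} x y) l = window_count n m x l" for x y
  proof -
    have "position (resample {k - m..<k + m} x y) j = position (resample {k - m..<k + m} x y) l \<longleftrightarrow> position x j = position x l"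
      if "l \<le> j + m" for j
      using that k by (intro position_eq_resample_out) auto
    then show ?thesis unfolding window_count_def by (intro arg_cong[where f=card]) auto
  qed
  have "measure_pmf.expectation (steps p n) (\<lambda>x. real (window_count n m x k) powr \<gamma> * real (window_count n m x l) powr \<gamma>)
    = measure_pmf.expectation (steps p n) (\<lambda>x. real (window_count n m x k) powr \<gamma>) *
      measure_pmf.expectation (steps p n) (\<lambda>x. real (window_count n m x l) powr \<gamma>)"
    unfolding steps_def using k powr_window_count_bounds[OF \<gamma>]
    by (intro expectation_indep[where B="{k - m..<k + m}" and C="real (2 * m + 1)" and D="real (2 * m + 1)"])
       (auto simp: 1 2 simp del: of_nat_Suc of_nat_add)
  then show ?thesis using k by (simp add: expectation_window_count power2_eq_square)
qed

text \<open>Of the covariances only those of times less than \<open>2m\<close> apart survive, at most \<open>4m\<close> for each \<open>k\<close>.\<close>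

lemma expectation_window_count_square:
  fixes m n :: nat
  assumes \<gamma>: "\<gamma> \<le> 1"
  defines "W \<equiv> real (2 * m + 1)"
  shows "measure_pmf.expectation (steps p n)
    (\<lambda>x. (\<Sum>k\<in>{m..<n - m}. real (window_count n m x k) powr \<gamma> - window_mean p \<gamma> m)\<^sup>2) \<le> 4 * real m * W\<^sup>2 * real n"
proof -
  let ?E = "measure_pmf.expectation (steps p n)"
  define v where "v = window_mean p \<gamma> m"
  define Y where "Y k x = real (window_count n m x k) powr \<gamma>" for k x
  have Y: "0 \<le> Y k x" "Y k x \<le> W" for k x using powr_window_count_bounds[OF \<gamma>] by (auto simp: Y_def W_def simp del: of_nat_Suc of_nat_add)
  have v: "0 \<le> v" "v \<le> W" using window_mean_bounds[OF \<gamma>] by (auto simp: v_def W_def simp del: of_nat_Suc of_nat_add)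
  have W: "0 \<le> W" by (simp add: W_def)
  let ?G = "{m..<n - m}"
  have iY: "integrable (steps p n) (Y k)" for k
    using Y by (intro integrable_pmf_bounded[where C=W]) auto
  have iYY: "integrable (steps p n) (\<lambda>x. Y k x * Y l x)" for k l
    using Y W by (intro integrable_pmf_bounded[where C="W * W"]) (auto simp: abs_mult intro!: mult_mono)
  have bd: "\<bar>(Y k x - v) * (Y l x - v)\<bar> \<le> W\<^sup>2" for k l x
  proof -
    have "\<bar>Y k x - v\<bar> \<le> W" "\<bar>Y l x - v\<bar> \<le> W" using Y[of k x] Y[of l x] v by (auto simp: abs_if)
    then show ?thesis unfolding abs_mult power2_eq_square using W by (intro mult_mono) auto
  qed
  have cov: "?E (\<lambda>x. (Y k x - v) * (Y l x - v)) \<le> (if l < k + 2 * m \<and> k < l + 2 * m then W\<^sup>2 else 0)"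
    if kl: "k \<in> ?G" "l \<in> ?G" for k l
  proof (cases "l < k + 2 * m \<and> k < l + 2 * m")
    case True
    have "?E (\<lambda>x. (Y k x - v) * (Y l x - v)) \<le> W\<^sup>2"
    proof (rule expectation_le_const)
      show "\<bar>(Y k x - v) * (Y l x - v)\<bar> \<le> W\<^sup>2" for x by (rule bd)
      show "(Y k x - v) * (Y l x - v) \<le> W\<^sup>2" for x using bd[of k x l] by linarith
    qed
    then show ?thesis using True by simp
  next
    case False
    have YY: "?E (\<lambda>x. Y k x * Y l x) = v\<^sup>2"
    proof (cases "k + 2 * m \<le> l")
      case True
      then show ?thesis using kl expectation_window_count_mult[of m k l n \<gamma> p, OF _ _ _ \<gamma>] by (simp add: Y_def v_def)
    next
      case F: False
      with False have "l + 2 * m \<le> k" by linarith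
      then show ?thesis using kl expectation_window_count_mult[of m l k n \<gamma> p, OF _ _ _ \<gamma>] by (simp add: Y_def v_def mult.commute)
    qed
    have EY: "?E (Y j) = v" if "j \<in> ?G" for j
      using that expectation_window_count[of m j n p \<gamma>] by (simp add: Y_def[abs_def] v_def less_diff_conv)
    have "(\<lambda>x. (Y k x - v) * (Y l x - v)) = (\<lambda>x. Y k x * Y l x - v * Y l x - v * Y k x + v\<^sup>2)"
      by (simp add: fun_eq_iff algebra_simps power2_eq_square)
    then have "?E (\<lambda>x. (Y k x - v) * (Y l x - v)) = ?E (\<lambda>x. Y k x * Y l x) - v * ?E (Y l) - v * ?E (Y k) + v\<^sup>2"
      using iY iYY by simp
    also have "\<dots> = 0" using kl by (simp add: YY EY power2_eq_square)
    finally show ?thesis using False by auto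
  qed
  have "?E (\<lambda>x. (\<Sum>k\<in>?G. Y k x - v)\<^sup>2) = ?E (\<lambda>x. \<Sum>k\<in>?G. \<Sum>l\<in>?G. (Y k x - v) * (Y l x - v))"
    by (simp add: power2_eq_square sum_product)
  also have "\<dots> = (\<Sum>k\<in>?G. \<Sum>l\<in>?G. ?E (\<lambda>x. (Y k x - v) * (Y l x - v)))"
    using bd by (subst Bochner_Integration.integral_sum,
        (intro Bochner_Integration.integrable_sum integrable_pmf_bounded[where C="W\<^sup>2"]; simp),
        subst Bochner_Integration.integral_sum, intro integrable_pmf_bounded[where C="W\<^sup>2"]) auto
  also have "\<dots> \<le> (\<Sum>k\<in>?G. \<Sum>l\<in>?G. if l < k + 2 * m \<and> k < l + 2 * m then W\<^sup>2 else 0)"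
    by (intro sum_mono cov) auto
  also have "\<dots> \<le> (\<Sum>k\<in>?G. 4 * real m * W\<^sup>2)"
  proof (intro sum_mono)
    fix k
    have "card {l\<in>?G. l < k + 2 * m \<and> k < l + 2 * m} \<le> card {Suc k - 2 * m..<k + 2 * m}"
      by (intro card_mono) auto
    also have "\<dots> \<le> 4 * m" by simp
    finally have "real (card {l\<in>?G. l < k + 2 * m \<and> k < l + 2 * m}) \<le> 4 * real m" by linarith
    then have "real (card {l\<in>?G. l < k + 2 * m \<and> k < l + 2 * m}) * W\<^sup>2 \<le> 4 * real m * W\<^sup>2"
      by (intro mult_right_mono) auto
    then show "(\<Sum>l\<in>?G. if l < k + 2 * m \<and> k < l + 2 * m then W\<^sup>2 else 0) \<le> 4 * real m * W\<^sup>2"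
      by (simp add: sum.inter_filter[symmetric])
  qed
  also have "\<dots> = real (card ?G) * (4 * real m * W\<^sup>2)" by simp
  also have "\<dots> \<le> real n * (4 * real m * W\<^sup>2)" by (intro mult_right_mono) auto
  finally show ?thesis unfolding Y_def v_def by (simp add: mult_ac)
qed

context concentrated_walk begin

text \<open>The three contributions are the visits outside the windows, the fluctuation of the window counts, and the at most
\<open>2m\<close> times near the ends, where the window is cut.\<close>

lemma expectation_mean_visit_count_le:
  fixes m n :: nat
  assumes \<gamma>: "\<bar>\<gamma>\<bar> \<le> 1" and n: "1 \<le> n" and \<delta>: "0 < \<delta>"
  defines "W \<equiv> real (2 * m + 1)"
  shows "measure_pmf.expectation (steps p n)
     (\<lambda>x. \<bar>(\<Sum>k<n. real (visit_count n x k) powr \<gamma>) / real n - window_mean p \<gamma> m\<bar>) \<le>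
     2 * return_tail m + \<delta> / 2 + (2 * real m * W\<^sup>2 / \<delta> + 2 * real m * W) / real n"
proof -
  let ?E = "measure_pmf.expectation (steps p n)"
  define v where "v = window_mean p \<gamma> m"
  define Y where "Y k x = real (window_count n m x k) powr \<gamma>" for k x
  have \<gamma>1: "\<gamma> \<le> 1" using \<gamma> by simp
  have Y: "0 \<le> Y k x" "Y k x \<le> W" for k x using powr_window_count_bounds[OF \<gamma>1] by (auto simp: Y_def W_def simp del: of_nat_Suc of_nat_add)
  have v: "0 \<le> v" "v \<le> W" using window_mean_bounds[OF \<gamma>1] by (auto simp: v_def W_def simp del: of_nat_Suc of_nat_add)
  have W: "0 \<le> W" by (simp add: W_def)
  let ?G = "{m..<n - m}"
  define Z where "Z x = (\<Sum>k\<in>?G. Y k x - v)" for x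
  have wc: "window_count n m x k \<le> visit_count n x k" for x k
    unfolding window_count_def visit_count_def by (intro card_mono) auto
  have point: "\<bar>(\<Sum>k<n. real (visit_count n x k) powr \<gamma>) / real n - v\<bar> \<le>
      ((\<Sum>k<n. real (visit_count n x k) - real (window_count n m x k)) + 2 * real m * W + (\<delta> * real n + (Z x)\<^sup>2 / (\<delta> * real n)) / 2) / real n" for x
  proof -
    \<comment> \<open>The first moment of \<open>Z\<close> is controlled by the second through the inequality of the means.\<close>
    have Zb: "\<bar>Z x\<bar> \<le> (\<delta> * real n + (Z x)\<^sup>2 / (\<delta> * real n)) / 2"
    proof -
      have gt0: "0 < \<delta> * real n" using \<delta> n by simp
      have "0 \<le> (\<bar>Z x\<bar> - \<delta> * real n)\<^sup>2" by simp
      then have "2 * \<bar>Z x\<bar> * (\<delta> * real n) \<le> (\<delta> * real n)\<^sup>2 + (Z x)\<^sup>2"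
        by (simp add: power2_eq_square algebra_simps)
      then have "2 * \<bar>Z x\<bar> \<le> ((\<delta> * real n)\<^sup>2 + (Z x)\<^sup>2) / (\<delta> * real n)"
        using gt0 by (simp only: pos_le_divide_eq)
      also have "\<dots> = \<delta> * real n + (Z x)\<^sup>2 / (\<delta> * real n)"
        using gt0 by (simp add: add_divide_distrib power2_eq_square)
      finally show ?thesis by simp
    qed
    have split: "{..<n} = ?G \<union> ({..<n} - ?G)" by auto
    have "(\<Sum>k<n. real (visit_count n x k) powr \<gamma>) - real n * v = (\<Sum>k<n. real (visit_count n x k) powr \<gamma> - Y k x) + (\<Sum>k<n. Y k x - v)"
      by (simp add: sum_subtractf)
    also have "(\<Sum>k<n. Y k x - v) = Z x + (\<Sum>k\<in>{..<n} - ?G. Y k x - v)"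
      unfolding Z_def by (subst split, subst sum.union_disjoint) auto
    finally have "\<bar>(\<Sum>k<n. real (visit_count n x k) powr \<gamma>) - real n * v\<bar> \<le>
      \<bar>\<Sum>k<n. real (visit_count n x k) powr \<gamma> - Y k x\<bar> + (\<bar>Z x\<bar> + \<bar>\<Sum>k\<in>{..<n} - ?G. Y k x - v\<bar>)" by linarith
    also have "\<bar>\<Sum>k<n. real (visit_count n x k) powr \<gamma> - Y k x\<bar> \<le> (\<Sum>k<n. real (visit_count n x k) - real (window_count n m x k))"
    proof (intro order_trans[OF sum_abs] sum_mono)
      fix k assume "k \<in> {..<n}"
      then have "\<bar>real (visit_count n x k) powr \<gamma> - Y k x\<bar> \<le> \<bar>real (visit_count n x k) - real (window_count n m x k)\<bar>"
        unfolding Y_def using visit_count_ge_1[of k n x] window_count_ge_1[of k n m x] \<gamma> by (intro abs_powr_diff_le) auto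
      then show "\<bar>real (visit_count n x k) powr \<gamma> - Y k x\<bar> \<le> real (visit_count n x k) - real (window_count n m x k)"
        using wc[of x k] by simp
    qed
    also have "\<bar>\<Sum>k\<in>{..<n} - ?G. Y k x - v\<bar> \<le> (\<Sum>k\<in>{..<n} - ?G. W)"
    proof (intro order_trans[OF sum_abs] sum_mono)
      fix k show "\<bar>Y k x - v\<bar> \<le> W" using Y[of k x] v by (auto simp: abs_if)
    qed
    also have "\<dots> = real (card ({..<n} - ?G)) * W" by simp
    also have "\<dots> \<le> real (2 * m) * W"
    proof -
      have "card ({..<n} - ?G) = card {..<n} - card ?G" by (intro card_Diff_subset) auto
      then show ?thesis using W by (intro mult_right_mono) (auto simp: of_nat_le_iff simp del: of_nat_mult)
    qed
    also note Zb
    finally have main: "\<bar>(\<Sum>k<n. real (visit_count n x k) powr \<gamma>) - real n * v\<bar> \<le>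
      (\<Sum>k<n. real (visit_count n x k) - real (window_count n m x k)) + 2 * real m * W + (\<delta> * real n + (Z x)\<^sup>2 / (\<delta> * real n)) / 2"
      by simp
    have "(\<Sum>k<n. real (visit_count n x k) powr \<gamma>) / real n - v = ((\<Sum>k<n. real (visit_count n x k) powr \<gamma>) - real n * v) / real n"
      using n by (simp add: field_simps)
    then have "\<bar>(\<Sum>k<n. real (visit_count n x k) powr \<gamma>) / real n - v\<bar> = \<bar>(\<Sum>k<n. real (visit_count n x k) powr \<gamma>) - real n * v\<bar> / real n"
      by simp
    then show ?thesis using main by (simp add: divide_right_mono)
  qed
  have ic: "integrable (steps p n) (\<lambda>x. real (visit_count n x k) - real (window_count n m x k))" for k
  proof (rule integrable_pmf_bounded[where C="real n"])
    fix x show "norm (real (visit_count n x k) - real (window_count n m x k)) \<le> real n"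
      using wc[of x k] visit_count_le[of n x k] by simp
  qed
  have Zle: "\<bar>Z x\<bar> \<le> real n * W" for x
  proof -
    have "\<bar>Z x\<bar> \<le> (\<Sum>k\<in>?G. W)" unfolding Z_def
    proof (intro order_trans[OF sum_abs] sum_mono)
      fix k show "\<bar>Y k x - v\<bar> \<le> W" using Y[of k x] v by (auto simp: abs_if)
    qed
    also have "\<dots> \<le> real n * W" using W by (simp add: mult_right_mono)
    finally show ?thesis .
  qed
  have iZ: "integrable (steps p n) (\<lambda>x. (Z x)\<^sup>2)"
  proof (rule integrable_pmf_bounded[where C="(real n * W)\<^sup>2"])
    fix x show "norm ((Z x)\<^sup>2) \<le> (real n * W)\<^sup>2"
      using power_mono[OF Zle[of x], of 2] by simp
  qed
  have "?E (\<lambda>x. \<bar>(\<Sum>k<n. real (visit_count n x k) powr \<gamma>) / real n - v\<bar>) \<le>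
    ?E (\<lambda>x. ((\<Sum>k<n. real (visit_count n x k) - real (window_count n m x k)) + 2 * real m * W + (\<delta> * real n + (Z x)\<^sup>2 / (\<delta> * real n)) / 2) / real n)"
    using ic iZ integrable_visit_count_fun[of n "\<lambda>i. real i powr \<gamma>"]
    by (intro integral_mono point) (auto intro!: integrable_abs)
  also have "\<dots> = ((\<Sum>k<n. ?E (\<lambda>x. real (visit_count n x k) - real (window_count n m x k))) + 2 * real m * W +
      (\<delta> * real n + ?E (\<lambda>x. (Z x)\<^sup>2) / (\<delta> * real n)) / 2) / real n"
    using ic iZ by (simp add: Bochner_Integration.integral_sum Bochner_Integration.integrable_sum del: Bochner_Integration.integral_diff)
  also have "\<dots> \<le> ((\<Sum>k<n. 2 * return_tail m) + 2 * real m * W + (\<delta> * real n + (4 * real m * W\<^sup>2 * real n) / (\<delta> * real n)) / 2) / real n"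
  proof (intro divide_right_mono add_mono sum_mono order_refl)
    show "?E (\<lambda>x. real (visit_count n x k) - real (window_count n m x k)) \<le> 2 * return_tail m" if "k \<in> {..<n}" for k
      using that expectation_visits_outside_window_le by simp
    show "?E (\<lambda>x. (Z x)\<^sup>2) \<le> 4 * real m * W\<^sup>2 * real n"
      using expectation_window_count_square[OF \<gamma>1, where p=p and n=n and m=m] unfolding Z_def Y_def v_def W_def .
  qed (use \<delta> in auto)
  also have "\<dots> = 2 * return_tail m + \<delta> / 2 + (2 * real m * W\<^sup>2 / \<delta> + 2 * real m * W) / real n"
    using n \<delta> by (simp add: field_simps)
  finally show ?thesis unfolding v_def .
qed

lemma mean_visit_count_tendsto:
  assumes \<gamma>: "\<bar>\<gamma>\<bar> \<le> 1" and v: "window_mean p \<gamma> \<longlonglongrightarrow> v"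
  shows "(\<lambda>n. measure_pmf.expectation (steps p n) (\<lambda>x. \<bar>(\<Sum>k<n. real (visit_count n x k) powr \<gamma>) / real n - v\<bar>)) \<longlonglongrightarrow> 0"
proof (rule LIMSEQ_I)
  fix \<epsilon> :: real assume \<epsilon>: "0 < \<epsilon>"
  have "(\<lambda>m. 2 * return_tail m + \<bar>window_mean p \<gamma> m - v\<bar>) \<longlonglongrightarrow> 2 * 0 + \<bar>v - v\<bar>"
    by (intro tendsto_intros return_tail_tendsto v)
  then have "eventually (\<lambda>m. 2 * return_tail m + \<bar>window_mean p \<gamma> m - v\<bar> < \<epsilon> / 4) sequentially"
    by (rule order_tendstoD) (use \<epsilon> in auto)
  then obtain m where m: "2 * return_tail m + \<bar>window_mean p \<gamma> m - v\<bar> < \<epsilon> / 4" by (auto simp: eventually_sequentially)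
  define W where "W = real (2 * m + 1)"
  define K where "K = 2 * real m * W\<^sup>2 / \<epsilon> + 2 * real m * W"
  have "(\<lambda>n. K / real n) \<longlonglongrightarrow> 0" by (rule lim_const_over_n)
  then have "eventually (\<lambda>n. K / real n < \<epsilon> / 4) sequentially"
    by (rule order_tendstoD) (use \<epsilon> in auto)
  then obtain N where N: "\<And>n. n \<ge> N \<Longrightarrow> K / real n < \<epsilon> / 4" by (auto simp: eventually_sequentially)
  show "\<exists>N. \<forall>n\<ge>N. norm (measure_pmf.expectation (steps p n) (\<lambda>x. \<bar>(\<Sum>k<n. real (visit_count n x k) powr \<gamma>) / real n - v\<bar>) - 0) < \<epsilon>"
  proof (intro exI allI impI)
    fix n assume n: "max N 1 \<le> n"
    let ?E = "measure_pmf.expectation (steps p n)"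
    let ?V = "\<lambda>x. (\<Sum>k<n. real (visit_count n x k) powr \<gamma>) / real n"
    have iV: "integrable (steps p n) (\<lambda>x. \<bar>?V x - u\<bar>)" for u
      using integrable_visit_count_fun[of n "\<lambda>i. real i powr \<gamma>"] by (intro integrable_abs) auto
    have "?E (\<lambda>x. \<bar>?V x - v\<bar>) \<le> ?E (\<lambda>x. \<bar>?V x - window_mean p \<gamma> m\<bar> + \<bar>window_mean p \<gamma> m - v\<bar>)"
      using iV by (intro integral_mono) auto
    also have "\<dots> = ?E (\<lambda>x. \<bar>?V x - window_mean p \<gamma> m\<bar>) + \<bar>window_mean p \<gamma> m - v\<bar>"
      using iV by (subst Bochner_Integration.integral_add) auto
    also have "?E (\<lambda>x. \<bar>?V x - window_mean p \<gamma> m\<bar>) \<le> 2 * return_tail m + \<epsilon> / 2 + K / real n"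
      using expectation_mean_visit_count_le[OF \<gamma> _ \<epsilon>, of n m] n unfolding K_def W_def by simp
    finally have "?E (\<lambda>x. \<bar>?V x - v\<bar>) \<le> 2 * return_tail m + \<epsilon> / 2 + K / real n + \<bar>window_mean p \<gamma> m - v\<bar>"
      by simp
    moreover have "K / real n < \<epsilon> / 4" using N n by simp
    ultimately have "?E (\<lambda>x. \<bar>?V x - v\<bar>) < \<epsilon>" using m by linarith
    moreover have "0 \<le> ?E (\<lambda>x. \<bar>?V x - v\<bar>)" by (intro integral_nonneg_AE) auto
    ultimately show "norm (?E (\<lambda>x. \<bar>?V x - v\<bar>) - 0) < \<epsilon>" by simp
  qed
qed

end

section \<open>The characteristic function of the random walk in random scenery\<close>

definition visits :: "nat \<Rightarrow> (nat \<Rightarrow> int) \<Rightarrow> int \<Rightarrow> nat" where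
  "visits n x y = card {j. j < n \<and> position x j = y}"

lemma visit_count_eq_visits: "visit_count n x k = visits n x (position x k)"
  by (simp add: visit_count_def visits_def)

lemma visits_ge_1: "y \<in> position x ` {..<n} \<Longrightarrow> 1 \<le> visits n x y"
  using visit_count_ge_1[of _ n x] by (auto simp: visit_count_eq_visits)

text \<open>Each site \<open>y\<close> is counted once for every time at which the walk is there.\<close>

lemma sum_over_sites:
  fixes h :: "nat \<Rightarrow> real"
  shows "(\<Sum>y\<in>position x ` {..<n}. real (visits n x y) * h (visits n x y)) = (\<Sum>k<n. h (visit_count n x k))"
proof -
  have "(\<Sum>k<n. h (visit_count n x k)) = (\<Sum>y\<in>position x ` {..<n}. \<Sum>k\<in>{k\<in>{..<n}. position x k = y}. h (visit_count n x k))"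
    by (rule sum.image_gen) simp
  also have "\<dots> = (\<Sum>y\<in>position x ` {..<n}. \<Sum>k\<in>{k\<in>{..<n}. position x k = y}. h (visits n x y))"
    by (intro sum.cong) (auto simp: visit_count_eq_visits)
  also have "\<dots> = (\<Sum>y\<in>position x ` {..<n}. real (visits n x y) * h (visits n x y))"
    by (simp add: visits_def)
  finally show ?thesis ..
qed

text \<open>The characteristic function at \<open>t\<close> of the random walk in random scenery after \<open>n\<close> steps, the scenery having
characteristic function \<open>\<phi>\<close> and being averaged out.\<close>

definition rwrs_char :: "int pmf \<Rightarrow> (real \<Rightarrow> complex) \<Rightarrow> nat \<Rightarrow> real \<Rightarrow> complex" where
  "rwrs_char p \<phi> n t = measure_pmf.expectation (steps p n)
     (\<lambda>x. \<Prod>y\<in>position x ` {..<n}. \<phi> (t * real (visits n x y)))"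

lemma norm_exp_minus_diff_le:
  fixes a b :: complex
  assumes "0 \<le> Re a" "0 \<le> Re b"
  shows "cmod (exp (- a) - exp (- b)) \<le> cmod (a - b)"
proof -
  have "cmod (exp (- a) - exp (- b)) \<le> 1 * cmod (a - b)"
  proof (rule field_differentiable_bound[of "{z. 0 \<le> Re z}" _ "\<lambda>z. - exp (- z)"])
    show "convex {z. 0 \<le> Re z}" by (rule convex_halfspace_Re_ge)
    show "((\<lambda>a. exp (- a)) has_field_derivative - exp (- z)) (at z within {z. 0 \<le> Re z})" for z
      by (auto intro!: derivative_eq_intros)
  qed (use assms in auto)
  then show ?thesis by simp
qed

lemma norm_stable_char_le_1: "0 \<le> A1 \<Longrightarrow> cmod (stable_char \<beta> A1 A2 u) \<le> 1"
  by (simp add: stable_char_def)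

context concentrated_walk begin

text \<open>For fixed \<open>s\<close> and with \<open>t = s n\<^bsup>-1/\<beta>\<^esup>\<close>, replacing \<open>\<phi>\<close> by the stable characteristic function costs at
most the sum over the sites of \<open>\<bar>\<phi> - \<psi>\<bar>(t N)\<close>. As \<open>\<bar>t N\<bar>\<^sup>\<beta>\<close> is \<open>\<bar>s\<bar>\<^sup>\<beta> N\<^sup>\<beta>/n\<close>, this is small for sites with at
most \<open>L\<close> visits by the expansion of \<open>\<phi>\<close>, and for the others by uniform integrability of the counts. The product
of the stable characteristic functions is a function of the mean of \<open>N\<^bsup>\<beta>-1\<^esup>\<close> along the path, to which the
law of large numbers applies.\<close>

lemma rwrs_char_tendsto:
  assumes \<beta>: "0 < \<beta>" "\<beta> \<le> 2" and A1: "0 \<le> A1" and le1: "\<And>u. cmod (\<phi> u) \<le> 1"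
    and expansion: "\<And>e. 0 < e \<Longrightarrow> \<exists>\<delta>>0. \<forall>u. \<bar>u\<bar> \<le> \<delta> \<longrightarrow> cmod (\<phi> u - stable_char \<beta> A1 A2 u) \<le> e * \<bar>u\<bar> powr \<beta>"
    and v: "window_mean p (\<beta> - 1) \<longlonglongrightarrow> v"
  shows "(\<lambda>n. rwrs_char p \<phi> n (s * real n powr (- 1 / \<beta>))) \<longlonglongrightarrow> stable_char \<beta> (v * A1) (v * A2) s"
proof (rule LIMSEQ_I)
  fix \<epsilon> :: real assume \<epsilon>: "0 < \<epsilon>"
  let ?\<psi> = "stable_char \<beta> A1 A2"
  define z where "z = complex_of_real A1 + \<i> * complex_of_real A2 * complex_of_real (sgn s)"
  define S where "S = \<bar>s\<bar> powr \<beta>"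
  have S: "0 \<le> S" by (simp add: S_def)
  have Rez: "0 \<le> Re z" using A1 by (simp add: z_def)
  have v0: "0 \<le> v"
    using v by (rule LIMSEQ_le_const) (use \<beta> window_mean_bounds(1)[of "\<beta> - 1"] in auto)
  have \<gamma>: "\<bar>\<beta> - 1\<bar> \<le> 1" using \<beta> by auto
  define C0 where "C0 = 1 + 2 * return_tail 0"
  have C0: "1 \<le> C0" using return_tail_nonneg[of 0] by (simp add: C0_def)
  define e where "e = \<epsilon> / (4 * (S + 1) * C0)"
  have e: "0 < e" using \<epsilon> S C0 by (simp add: e_def)
  have e': "S * (e * C0) \<le> \<epsilon> / 4"
  proof -
    have "e * C0 = \<epsilon> / (4 * (S + 1))" using C0 by (simp add: e_def)
    then have "S * (e * C0) = (\<epsilon> / 4) * (S / (S + 1))" by simp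
    also have "\<dots> \<le> (\<epsilon> / 4) * 1" using \<epsilon> S by (intro mult_left_mono) auto
    finally show ?thesis by simp
  qed
  obtain \<delta> where \<delta>: "0 < \<delta>" "\<And>u. \<bar>u\<bar> \<le> \<delta> \<Longrightarrow> cmod (\<phi> u - ?\<psi> u) \<le> e * \<bar>u\<bar> powr \<beta>"
    using expansion[OF e] by blast
  \<comment> \<open>Beyond \<open>\<delta>\<close> the difference is at most \<open>2\<close>, hence at most \<open>K \<bar>u\<bar>\<^sup>\<beta>\<close>.\<close>
  define K where "K = 2 / \<delta> powr \<beta>"
  have K: "0 < K" using \<delta> by (simp add: K_def)
  have rough: "cmod (\<phi> u - ?\<psi> u) \<le> (e + K) * \<bar>u\<bar> powr \<beta>" for u
  proof (cases "\<bar>u\<bar> \<le> \<delta>")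
    case True
    have "e * \<bar>u\<bar> powr \<beta> \<le> (e + K) * \<bar>u\<bar> powr \<beta>" using K by (intro mult_right_mono) auto
    then show ?thesis using \<delta>(2)[OF True] by linarith
  next
    case False
    have "cmod (\<phi> u - ?\<psi> u) \<le> cmod (\<phi> u) + cmod (?\<psi> u)" by (rule norm_triangle_ineq4)
    also have "\<dots> \<le> 2" using le1[of u] norm_stable_char_le_1[OF A1, of \<beta> A2 u] by linarith
    also have "2 = K * \<delta> powr \<beta>" using \<delta> by (simp add: K_def)
    also have "\<dots> \<le> K * \<bar>u\<bar> powr \<beta>" using False \<delta> \<beta> K by (intro mult_left_mono powr_mono2) auto
    also have "\<dots> \<le> (e + K) * \<bar>u\<bar> powr \<beta>" using e by (intro mult_right_mono) auto
    finally show ?thesis .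
  qed
  have "(\<lambda>m. S * (K * (4 * return_tail m))) \<longlonglongrightarrow> S * (K * (4 * 0))" by (intro tendsto_intros return_tail_tendsto)
  then have "eventually (\<lambda>m. S * (K * (4 * return_tail m)) < \<epsilon> / 4) sequentially"
    by (rule order_tendstoD) (use \<epsilon> in auto)
  then obtain m where m: "S * (K * (4 * return_tail m)) < \<epsilon> / 4" by (auto simp: eventually_sequentially)
  define L where "L = 2 * (2 * m + 1)"
  let ?E = "\<lambda>n. measure_pmf.expectation (steps p n)"
  let ?V = "\<lambda>n x. (\<Sum>k<n. real (visit_count n x k) powr (\<beta> - 1)) / real n"
  have "(\<lambda>n. S * cmod z * ?E n (\<lambda>x. \<bar>?V n x - v\<bar>)) \<longlonglongrightarrow> S * cmod z * 0"
    by (intro tendsto_intros mean_visit_count_tendsto \<gamma> v)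
  then have ev1: "eventually (\<lambda>n. S * cmod z * ?E n (\<lambda>x. \<bar>?V n x - v\<bar>) < \<epsilon> / 4) sequentially"
    by (rule order_tendstoD) (use \<epsilon> in auto)
  have "((\<lambda>n. \<bar>s\<bar> * real n powr (- 1 / \<beta>) * real L) \<longlongrightarrow> \<bar>s\<bar> * 0 * real L) sequentially"
    using \<beta> by (intro tendsto_intros tendsto_neg_powr filterlim_real_sequentially) auto
  then have ev2: "eventually (\<lambda>n. \<bar>s\<bar> * real n powr (- 1 / \<beta>) * real L < \<delta>) sequentially"
    by (rule order_tendstoD) (use \<delta> in auto)
  have "eventually (\<lambda>n. cmod (rwrs_char p \<phi> n (s * real n powr (- 1 / \<beta>)) - stable_char \<beta> (v * A1) (v * A2) s) < \<epsilon>) sequentially"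
    using ev1 ev2 eventually_ge_at_top[of 1]
  proof eventually_elim
    case (elim n)
    then have n: "1 \<le> n" and n\<delta>: "\<bar>s\<bar> * real n powr (- 1 / \<beta>) * real L < \<delta>"
      and nV: "S * cmod z * ?E n (\<lambda>x. \<bar>?V n x - v\<bar>) < \<epsilon> / 4" by auto
    define t where "t = s * real n powr (- 1 / \<beta>)"
    have t\<beta>: "\<bar>t\<bar> powr \<beta> = S / real n"
    proof -
      have "(real n powr (- 1 / \<beta>)) powr \<beta> = real n powr (- 1)"
        unfolding powr_powr using \<beta> by simp
      also have "\<dots> = 1 / real n" using n by (simp add: powr_minus_divide)
      finally have "(real n powr (- 1 / \<beta>)) powr \<beta> = 1 / real n" .
      then show ?thesis
        unfolding t_def S_def abs_mult by (subst powr_mult) simp_all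
    qed
    have sgn_t: "sgn t = sgn s" using n by (simp add: t_def sgn_mult)
    define lim where "lim = stable_char \<beta> (v * A1) (v * A2) s"
    have lim: "lim = exp (- (complex_of_real (S * v) * z))"
      by (simp add: lim_def stable_char_def S_def z_def algebra_simps)
    let ?I = "\<lambda>x k. real (visit_count n x k) * indicator {x. L < visit_count n x k} x"
    define G where "G x = S / real n * (\<Sum>k<n. e * real (visit_count n x k) + K * ?I x k) + S * cmod z * \<bar>?V n x - v\<bar>" for x
    have point: "cmod ((\<Prod>y\<in>position x ` {..<n}. \<phi> (t * real (visits n x y))) - lim) \<le> G x" for x
    proof -
      let ?N = "visits n x" and ?Y = "position x ` {..<n}"
      have Npos: "0 < real (?N y)" if "y \<in> ?Y" for y using visits_ge_1[OF that] by simp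
      have "(\<Prod>y\<in>?Y. ?\<psi> (t * real (?N y))) = (\<Prod>y\<in>?Y. exp (- (complex_of_real (S / real n) * z * complex_of_real (real (?N y) powr \<beta>))))"
      proof (intro prod.cong refl)
        fix y assume "y \<in> ?Y"
        then have N: "0 < real (?N y)" by (rule Npos)
        have "\<bar>t * real (?N y)\<bar> powr \<beta> = S / real n * real (?N y) powr \<beta>"
          using N by (simp add: abs_mult powr_mult t\<beta>)
        moreover have "sgn (t * real (?N y)) = sgn s" using N by (simp add: sgn_mult sgn_t)
        ultimately show "?\<psi> (t * real (?N y)) = exp (- (complex_of_real (S / real n) * z * complex_of_real (real (?N y) powr \<beta>)))"
          unfolding stable_char_def z_def by (simp add: mult_ac)
      qed
      also have "\<dots> = exp (- (complex_of_real (S / real n) * z * complex_of_real (\<Sum>y\<in>?Y. real (?N y) powr \<beta>)))"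
        by (simp add: exp_sum[symmetric] sum_negf sum_distrib_left)
      also have "(\<Sum>y\<in>?Y. real (?N y) powr \<beta>) = (\<Sum>y\<in>?Y. real (?N y) * real (?N y) powr (\<beta> - 1))"
        using Npos by (intro sum.cong refl) (simp add: powr_mult_base)
      also have "\<dots> = (\<Sum>k<n. real (visit_count n x k) powr (\<beta> - 1))"
        by (rule sum_over_sites)
      also have "complex_of_real (S / real n) * z * complex_of_real (\<Sum>k<n. real (visit_count n x k) powr (\<beta> - 1)) =
          complex_of_real (S * ?V n x) * z" by simp
      finally have prod\<psi>: "(\<Prod>y\<in>?Y. ?\<psi> (t * real (?N y))) = exp (- (complex_of_real (S * ?V n x) * z))" .
      have V0: "0 \<le> ?V n x" by (intro divide_nonneg_nonneg sum_nonneg) auto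
      have "cmod ((\<Prod>y\<in>?Y. ?\<psi> (t * real (?N y))) - lim) \<le> cmod (complex_of_real (S * ?V n x) * z - complex_of_real (S * v) * z)"
        unfolding prod\<psi> lim
      proof (intro norm_exp_minus_diff_le)
        have Re_eq: "Re (complex_of_real r * z) = r * Re z" for r by simp
        show "0 \<le> Re (complex_of_real (S * ?V n x) * z)" "0 \<le> Re (complex_of_real (S * v) * z)"
          unfolding Re_eq by (intro mult_nonneg_nonneg S V0 v0 Rez)+
      qed
      also have "\<dots> = cmod (complex_of_real (S * (?V n x - v)) * z)"
        by (simp only: left_diff_distrib[symmetric] of_real_diff[symmetric] right_diff_distrib[symmetric])
      also have "\<dots> = S * cmod z * \<bar>?V n x - v\<bar>"
        using S by (simp only: norm_mult norm_of_real abs_mult) simp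
      finally have 1: "cmod ((\<Prod>y\<in>?Y. ?\<psi> (t * real (?N y))) - lim) \<le> S * cmod z * \<bar>?V n x - v\<bar>" .
      have "cmod ((\<Prod>y\<in>?Y. \<phi> (t * real (?N y))) - (\<Prod>y\<in>?Y. ?\<psi> (t * real (?N y))))
        \<le> (\<Sum>y\<in>?Y. cmod (\<phi> (t * real (?N y)) - ?\<psi> (t * real (?N y))))"
        by (intro norm_prod_diff le1 norm_stable_char_le_1 A1)
      also have "\<dots> \<le> (\<Sum>y\<in>?Y. real (?N y) * (S / real n * (e * real (?N y) + K * (real (?N y) * (if L < ?N y then 1 else 0)))))"
      proof (intro sum_mono)
        fix y assume "y \<in> ?Y"
        then have N: "1 \<le> real (?N y)" using visits_ge_1[of y x n] by simp
        define w where "w = (if L < ?N y then e + K else e)"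
        have w0: "0 \<le> w" using e K by (simp add: w_def)
        have "cmod (\<phi> (t * real (?N y)) - ?\<psi> (t * real (?N y))) \<le> w * \<bar>t * real (?N y)\<bar> powr \<beta>"
        proof (cases "L < ?N y")
          case True
          then show ?thesis using rough by (simp add: w_def)
        next
          case False
          then have "\<bar>t * real (?N y)\<bar> \<le> \<bar>s\<bar> * real n powr (- 1 / \<beta>) * real L"
            by (simp add: t_def abs_mult mult_left_mono)
          then show ?thesis using False n\<delta> \<delta>(2) by (simp add: w_def)
        qed
        also have "\<bar>t * real (?N y)\<bar> powr \<beta> = S / real n * real (?N y) powr \<beta>"
          using N by (simp add: abs_mult powr_mult t\<beta>)
        also have "w * (S / real n * real (?N y) powr \<beta>) \<le> w * (S / real n * (real (?N y) * real (?N y)))"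
        proof -
          have "real (?N y) powr \<beta> \<le> real (?N y) powr 2" using N \<beta> by (intro powr_mono) auto
          then show ?thesis using w0 S N by (intro mult_left_mono) (auto simp: power2_eq_square)
        qed
        also have "\<dots> = real (?N y) * (S / real n * (e * real (?N y) + K * (real (?N y) * (if L < ?N y then 1 else 0))))"
          by (simp add: w_def algebra_simps add_divide_distrib)
        finally show "cmod (\<phi> (t * real (?N y)) - ?\<psi> (t * real (?N y))) \<le> \<dots>" .
      qed
      also have "\<dots> = (\<Sum>k<n. S / real n * (e * real (visit_count n x k) + K * (real (visit_count n x k) * (if L < visit_count n x k then 1 else 0))))"
        by (rule sum_over_sites)
      also have "\<dots> = S / real n * (\<Sum>k<n. e * real (visit_count n x k) + K * ?I x k)"
        by (simp add: sum_distrib_left indicator_def of_bool_def)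
      finally have 2: "cmod ((\<Prod>y\<in>?Y. \<phi> (t * real (?N y))) - (\<Prod>y\<in>?Y. ?\<psi> (t * real (?N y))))
        \<le> S / real n * (\<Sum>k<n. e * real (visit_count n x k) + K * ?I x k)" .
      show ?thesis unfolding G_def
        using norm_triangle_ineq[of "(\<Prod>y\<in>?Y. \<phi> (t * real (?N y))) - (\<Prod>y\<in>?Y. ?\<psi> (t * real (?N y)))"
            "(\<Prod>y\<in>?Y. ?\<psi> (t * real (?N y))) - lim"] 1 2 by simp
    qed
    have i1: "integrable (steps p n) (\<lambda>x. real (visit_count n x k))" for k
      by (rule integrable_visit_count_fun)
    have i2: "integrable (steps p n) (\<lambda>x. ?I x k)" for k
      using integrable_visit_count_fun[of n "\<lambda>i. real i * (if L < i then 1 else 0)" k] by (simp add: indicator_def of_bool_def)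
    have i3: "integrable (steps p n) (\<lambda>x. \<bar>?V n x - v\<bar>)"
      using integrable_visit_count_fun[of n "\<lambda>i. real i powr (\<beta> - 1)"] by (intro integrable_abs) auto
    have iP: "integrable (steps p n) (\<lambda>x. \<Prod>y\<in>position x ` {..<n}. \<phi> (t * real (visits n x y)))"
      by (rule integrable_pmf_bounded[where C=1]) (simp add: prod_norm[symmetric] le1 prod_le_1)
    have "rwrs_char p \<phi> n t - lim = ?E n (\<lambda>x. (\<Prod>y\<in>position x ` {..<n}. \<phi> (t * real (visits n x y))) - lim)"
      unfolding rwrs_char_def using iP by simp
    also have "cmod \<dots> \<le> ?E n (\<lambda>x. cmod ((\<Prod>y\<in>position x ` {..<n}. \<phi> (t * real (visits n x y))) - lim))"
      by (rule integral_norm_bound)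
    also have "\<dots> \<le> ?E n G"
      using iP i1 i2 i3 unfolding G_def[abs_def]
      by (intro integral_mono point[unfolded G_def]) (auto intro!: integrable_norm)
    also have "?E n G = S / real n * (\<Sum>k<n. e * ?E n (\<lambda>x. real (visit_count n x k)) + K * ?E n (\<lambda>x. ?I x k)) + S * cmod z * ?E n (\<lambda>x. \<bar>?V n x - v\<bar>)"
      unfolding G_def[abs_def] using i1 i2 i3 by simp
    also have "\<dots> \<le> S / real n * (\<Sum>k<n. e * C0 + K * (4 * return_tail m)) + S * cmod z * ?E n (\<lambda>x. \<bar>?V n x - v\<bar>)"
    proof (intro add_mono mult_left_mono sum_mono order_refl)
      fix k assume "k \<in> {..<n}"
      then show "?E n (\<lambda>x. real (visit_count n x k)) \<le> C0" "?E n (\<lambda>x. ?I x k) \<le> 4 * return_tail m"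
        using expectation_visit_count_le[of k n] expectation_large_visit_count_le[of k n m] by (auto simp: C0_def L_def)
    qed (use S e K in auto)
    also have "S / real n * (\<Sum>k<n. e * C0 + K * (4 * return_tail m)) = S * (e * C0) + S * (K * (4 * return_tail m))"
      using n by (simp add: algebra_simps)
    finally have "cmod (rwrs_char p \<phi> n t - lim) < \<epsilon>" using e' m nV \<epsilon> by linarith
    then show ?case by (simp add: t_def lim_def)
  qed
  then show "\<exists>N. \<forall>n\<ge>N. norm (rwrs_char p \<phi> n (s * real n powr (- 1 / \<beta>)) - stable_char \<beta> (v * A1) (v * A2) s) < \<epsilon>"
    by (auto simp: eventually_sequentially)
qed

end

text \<open>A site visited once contributes the factor \<open>\<phi>(t)\<close>; the other factors are only known to be at most one in
modulus.\<close>

lemma norm_rwrs_char_le: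
  assumes le1: "\<And>u. cmod (\<phi> u) \<le> 1" and bd: "cmod (\<phi> t) \<le> exp (- a)" and a: "0 \<le> a"
  shows "cmod (rwrs_char p \<phi> n t) \<le> exp (- (a * (c * real n))) +
    measure_pmf.prob (steps p n) {x. real (card {k. k < n \<and> x \<in> visited_once n k}) < c * real n}"
proof -
  let ?E = "measure_pmf.expectation (steps p n)"
  let ?B = "{x. real (card {k. k < n \<and> x \<in> visited_once n k}) < c * real n}"
  have point: "cmod (\<Prod>y\<in>position x ` {..<n}. \<phi> (t * real (visits n x y))) \<le> exp (- (a * (c * real n))) + indicator ?B x" for x
  proof -
    let ?Q = "{k. k < n \<and> x \<in> visited_once n k}"
    have inj: "inj_on (position x) ?Q" by (auto simp: inj_on_def visited_once_def)
    have one: "visits n x (position x k) = 1" if "k \<in> ?Q" for k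
    proof -
      have "{j. j < n \<and> position x j = position x k} = {k}" using that by (auto simp: visited_once_def)
      then show ?thesis by (simp add: visits_def)
    qed
    have sub: "position x ` ?Q \<subseteq> position x ` {..<n}" by auto
    have "cmod (\<Prod>y\<in>position x ` {..<n}. \<phi> (t * real (visits n x y))) =
       (\<Prod>y\<in>position x ` {..<n} - position x ` ?Q. cmod (\<phi> (t * real (visits n x y)))) * (\<Prod>y\<in>position x ` ?Q. cmod (\<phi> (t * real (visits n x y))))"
      by (subst prod.subset_diff[OF sub]) (auto simp: prod_norm norm_mult)
    also have "\<dots> \<le> 1 * (\<Prod>y\<in>position x ` ?Q. cmod (\<phi> (t * real (visits n x y))))"
      by (intro mult_right_mono prod_le_1 prod_nonneg) (auto simp: le1)
    also have "\<dots> = (\<Prod>k\<in>?Q. cmod (\<phi> t))"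
      using one by (simp add: prod.reindex[OF inj])
    also have "\<dots> = cmod (\<phi> t) ^ card ?Q" by simp
    also have "\<dots> \<le> exp (- a) ^ card ?Q" by (intro power_mono bd) auto
    also have "\<dots> = exp (- (a * real (card ?Q)))" by (simp add: exp_of_nat_mult[symmetric] mult.commute)
    also have "\<dots> \<le> exp (- (a * (c * real n))) + indicator ?B x"
    proof (cases "x \<in> ?B")
      case True
      have "exp (- (a * real (card ?Q))) \<le> 1" using a by simp
      then show ?thesis using True by (simp add: add_increasing)
    next
      case False
      then have "a * (c * real n) \<le> a * real (card ?Q)" using a by (intro mult_left_mono) auto
      then show ?thesis using False by simp
    qed
    finally show ?thesis .
  qed
  have iP: "integrable (steps p n) (\<lambda>x. \<Prod>y\<in>position x ` {..<n}. \<phi> (t * real (visits n x y)))"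
    by (rule integrable_pmf_bounded[where C=1]) (simp add: prod_norm[symmetric] le1 prod_le_1)
  have iB: "integrable (steps p n) (indicator ?B :: _ \<Rightarrow> real)"
    by (rule integrable_pmf_bounded[where C=1]) (simp add: indicator_def)
  have "cmod (rwrs_char p \<phi> n t) \<le> ?E (\<lambda>x. cmod (\<Prod>y\<in>position x ` {..<n}. \<phi> (t * real (visits n x y))))"
    unfolding rwrs_char_def by (rule integral_norm_bound)
  also have "\<dots> \<le> ?E (\<lambda>x. exp (- (a * (c * real n))) + indicator ?B x)"
    using iP iB by (intro integral_mono point) (auto intro!: integrable_norm)
  also have "\<dots> = exp (- (a * (c * real n))) + measure_pmf.prob (steps p n) ?B"
    using iB by simp
  finally show ?thesis .
qed

section \<open>Passage to the law of the steps\<close>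

text \<open>Turns laws of discrete variables into elements of the type of probability mass functions.\<close>

lemma measure_pmf_of_countable_support:
  assumes "prob_space N" "sets N = UNIV" "countable C" "AE x in N. x \<in> C"
  shows "\<exists>q. measure_pmf q = N"
proof -
  interpret prob_space N by fact
  have "AE x in N. \<forall>c\<in>{c \<in> C. measure N {c} = 0}. x \<noteq> c"
  proof (subst AE_ball_countable)
    show "countable {c \<in> C. measure N {c} = 0}" using assms(3) by simp
    show "\<forall>c\<in>{c \<in> C. measure N {c} = 0}. AE x in N. x \<noteq> c"
    proof
      fix c assume "c \<in> {c \<in> C. measure N {c} = 0}"
      then have "{c} \<in> null_sets N" using assms(2) by (simp add: null_sets_def emeasure_eq_measure)
      from AE_not_in[OF this] show "AE x in N. x \<noteq> c" by simp
    qed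
  qed
  with assms(4) have "AE x in N. measure N {x} \<noteq> 0" by eventually_elim auto
  then have "measure_pmf (Abs_pmf N) = N"
    using assms by (intro Abs_pmf_inverse) auto
  then show ?thesis by blast
qed

lemma (in prob_space) ex_law_pmf:
  fixes Y :: "'a \<Rightarrow> int"
  assumes "Y \<in> measurable M (count_space UNIV)"
  shows "\<exists>p. measure_pmf p = distr M (count_space UNIV) Y"
  by (rule measure_pmf_of_countable_support[where C=UNIV]) (auto intro!: prob_space_distr assms)

text \<open>The vector takes countably many values, so its law is determined by its values on points. The map \<open>h\<close> renames indices,
for families that are indexed by integers or by disjoint sums.\<close>

lemma (in prob_space) distr_iid_vector:
  fixes Y :: "'j \<Rightarrow> 'a \<Rightarrow> int" and h :: "'i \<Rightarrow> 'j"
  assumes A: "finite A" and h: "inj_on h A" and ind: "indep_vars (\<lambda>_. count_space UNIV) Y (h ` A)"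
    and law: "\<And>i. i \<in> A \<Longrightarrow> distr M (count_space UNIV) (Y (h i)) = measure_pmf p"
  shows "(\<lambda>\<omega> i. if i \<in> A then Y (h i) \<omega> else 0) \<in> measurable M (count_space UNIV)" (is "?R \<in> _")
    and "distr M (count_space UNIV) (\<lambda>\<omega> i. if i \<in> A then Y (h i) \<omega> else 0) = measure_pmf (iid_pmf A p)"
proof -
  define C where "C = {f :: 'i \<Rightarrow> int. \<forall>i. i \<notin> A \<longrightarrow> f i = 0}"
  have cC: "countable C"
  proof -
    have "C \<subseteq> (\<lambda>g i. if i \<in> A then g i else 0) ` (PiE A (\<lambda>_. UNIV))"
    proof
      fix f assume "f \<in> C"
      then have "f = (\<lambda>i. if i \<in> A then restrict f A i else 0)" by (auto simp: C_def fun_eq_iff)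
      then show "f \<in> (\<lambda>g i. if i \<in> A then g i else 0) ` (PiE A (\<lambda>_. UNIV))" by (rule image_eqI[of _ _ "restrict f A"]) simp
    qed
    moreover have "countable (PiE A (\<lambda>_. UNIV :: int set))" using A by (intro countable_PiE) auto
    ultimately show ?thesis by (rule countable_subset[OF _ countable_image])
  qed
  have Ymeas: "Y (h i) \<in> measurable M (count_space UNIV)" if "i \<in> A" for i
    using ind that by (auto simp: indep_vars_def)
  have pre: "?R -` {x} \<inter> space M = {\<omega> \<in> space M. \<forall>i\<in>A. Y (h i) \<omega> = x i}" if "x \<in> C" for x
    using that by (auto simp: C_def fun_eq_iff)
  have pre_sets: "{\<omega> \<in> space M. \<forall>i\<in>A. Y (h i) \<omega> = x i} \<in> sets M" for x
  proof (intro sets.sets_Collect_finite_All A)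
    fix i assume "i \<in> A"
    have "{\<omega> \<in> space M. Y (h i) \<omega> = x i} = Y (h i) -` {x i} \<inter> space M" by auto
    then show "{\<omega> \<in> space M. Y (h i) \<omega> = x i} \<in> sets M" using measurable_sets[OF Ymeas[OF \<open>i \<in> A\<close>]] by simp
  qed
  have "?R \<in> measurable M (count_space C)"
    using pre pre_sets by (subst measurable_count_space_eq_countable[OF cC]) (auto simp: C_def)
  then show R: "?R \<in> measurable M (count_space UNIV)"
    by (rule measurable_compose[where g="\<lambda>x. x"]) simp
  have "\<exists>q. measure_pmf q = distr M (count_space UNIV) ?R"
  proof (rule measure_pmf_of_countable_support)
    show "countable C" by (fact cC)
    show "AE x in distr M (count_space UNIV) ?R. x \<in> C"
      using R by (subst AE_distr_iff) (auto simp: C_def)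
  qed (auto intro!: prob_space_distr R)
  then obtain q where q: "measure_pmf q = distr M (count_space UNIV) ?R" by blast
  have "q = iid_pmf A p"
  proof (rule pmf_eqI)
    fix x
    have qx: "pmf q x = prob (?R -` {x} \<inter> space M)"
      using R by (simp add: pmf.rep_eq q measure_distr)
    show "pmf q x = pmf (iid_pmf A p) x"
    proof (cases "x \<in> C")
      case False
      then have "?R -` {x} \<inter> space M = {}" by (auto simp: C_def)
      then show ?thesis using False A qx by (auto simp: pmf_Pi C_def)
    next
      case True
      have "prob {\<omega> \<in> space M. \<forall>i\<in>A. Y (h i) \<omega> = x i} = (\<Prod>i\<in>A. pmf p (x i))"
      proof (cases "A = {}")
        case True then show ?thesis by (simp add: prob_space)
      next
        case False
        define g where "g = the_inv_into A h"
        have g: "g (h i) = i" if "i \<in> A" for i using that h by (simp add: g_def the_inv_into_f_f)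
        have "{\<omega> \<in> space M. \<forall>i\<in>A. Y (h i) \<omega> = x i} = (\<Inter>j\<in>h ` A. Y j -` {x (g j)} \<inter> space M)"
          using False g by auto
        also have "prob \<dots> = (\<Prod>j\<in>h ` A. prob (Y j -` {x (g j)} \<inter> space M))"
          using ind A False by (intro indep_varsD_finite) auto
        also have "\<dots> = (\<Prod>i\<in>A. prob (Y (h i) -` {x i} \<inter> space M))"
          using g by (subst prod.reindex[OF h]) (auto intro!: prod.cong)
        also have "\<dots> = (\<Prod>i\<in>A. pmf p (x i))"
        proof (intro prod.cong refl)
          fix i assume i: "i \<in> A"
          show "prob (Y (h i) -` {x i} \<inter> space M) = pmf p (x i)"
            using Ymeas[OF i] by (simp add: pmf.rep_eq law[OF i, symmetric] measure_distr)
        qed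
        finally show ?thesis .
      qed
      then show ?thesis using True A qx pre[OF True] by (simp add: pmf_Pi C_def)
    qed
  qed
  then show "distr M (count_space UNIV) ?R = measure_pmf (iid_pmf A p)" using q by simp
qed

lemma (in prob_space) integral_iid_vector:
  fixes Y :: "'j \<Rightarrow> 'a \<Rightarrow> int" and h :: "'i \<Rightarrow> 'j" and F :: "('i \<Rightarrow> int) \<Rightarrow> 'c::{banach, second_countable_topology}"
  assumes A: "finite A" and h: "inj_on h A" and ind: "indep_vars (\<lambda>_. count_space UNIV) Y (h ` A)"
    and law: "\<And>i. i \<in> A \<Longrightarrow> distr M (count_space UNIV) (Y (h i)) = measure_pmf p"
  shows "(\<integral>\<omega>. F (\<lambda>i. if i \<in> A then Y (h i) \<omega> else 0) \<partial>M) = measure_pmf.expectation (iid_pmf A p) F"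
  by (subst distr_iid_vector(2)[OF assms, symmetric], simp, subst integral_distr[OF distr_iid_vector(1)[OF assms]]) simp_all

lemma integral_prod_iexp_iid:
  assumes A: "A \<subseteq> {..<n}"
  shows "measure_pmf.expectation (steps p n) (\<lambda>x. iexp (s * real_of_int (\<Sum>i\<in>A. x i))) =
    (measure_pmf.expectation p (\<lambda>z. iexp (s * real_of_int z))) ^ card A"
proof -
  have finA: "finite A" using A finite_subset by blast
  let ?P = "measure_pmf (steps p n)"
  have ind: "prob_space.indep_vars ?P (\<lambda>_. count_space UNIV) (\<lambda>i x. x i) A"
    using prob_space.indep_vars_subset[OF measure_pmf.prob_space_axioms indep_vars_Pi_pmf[of "{..<n}" 0 "\<lambda>_. p"] A]
    by (simp add: steps_def)
  have ind': "prob_space.indep_vars ?P (\<lambda>_. borel) (\<lambda>i x. iexp (s * real_of_int (x i))) A"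
    by (rule prob_space.indep_vars_compose2[OF measure_pmf.prob_space_axioms ind, where Y="\<lambda>i z. iexp (s * real_of_int z)"]) simp
  have "measure_pmf.expectation (steps p n) (\<lambda>x. iexp (s * real_of_int (\<Sum>i\<in>A. x i))) =
    measure_pmf.expectation (steps p n) (\<lambda>x. \<Prod>i\<in>A. iexp (s * real_of_int (x i)))"
    using finA by (simp add: exp_sum[symmetric] sum_distrib_left)
  also have "\<dots> = (\<Prod>i\<in>A. measure_pmf.expectation (steps p n) (\<lambda>x. iexp (s * real_of_int (x i))))"
    using finA ind' by (intro prob_space.indep_vars_lebesgue_integral[OF measure_pmf.prob_space_axioms])
      (auto intro!: integrable_pmf_bounded[where C=1])
  also have "\<dots> = (\<Prod>i\<in>A. measure_pmf.expectation p (\<lambda>z. iexp (s * real_of_int z)))"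
  proof (intro prod.cong refl)
    fix i assume "i \<in> A"
    then have "p = map_pmf (\<lambda>x. x i) (steps p n)"
      using A Pi_pmf_component[of "{..<n}" i 0 "\<lambda>_. p"] by (auto simp: steps_def)
    then have "measure_pmf.expectation p (\<lambda>z. iexp (s * real_of_int z)) =
      measure_pmf.expectation (map_pmf (\<lambda>x. x i) (steps p n)) (\<lambda>z. iexp (s * real_of_int z))" by simp
    then show "measure_pmf.expectation (steps p n) (\<lambda>x. iexp (s * real_of_int (x i))) =
      measure_pmf.expectation p (\<lambda>z. iexp (s * real_of_int z))" by simp
  qed
  finally show ?thesis by simp
qed

definition pmf_char :: "int pmf \<Rightarrow> real \<Rightarrow> complex" where
  "pmf_char p t = measure_pmf.expectation p (\<lambda>z. iexp (t * real_of_int z))"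

text \<open>With \<open>m\<close> increments the concentration inequality is applied with \<open>L = \<lfloor>m\<^bsup>1/\<alpha>\<^esup>\<rfloor>\<close> and \<open>\<theta> = \<delta>/L\<close>. The bound
\<open>C m\<^bsup>-1/\<alpha>\<^esup>\<close> is summable because \<open>\<alpha> < 1\<close>.\<close>

lemma concentrated_walk_of_char_bound:
  fixes \<alpha> :: real
  assumes \<alpha>: "0 < \<alpha>" "\<alpha> < 1" and c: "0 < c" and \<delta>: "0 < \<delta>"
    and bound: "\<And>t. \<bar>t\<bar> \<le> \<delta> \<Longrightarrow> cmod (pmf_char p t) \<le> exp (- c * \<bar>t\<bar> powr \<alpha>)"
  shows "\<exists>C\<ge>0. concentrated_walk p (\<lambda>l. C * real l powr (- 1 / \<alpha>))"
proof -
  define b where "b = c * \<delta> powr \<alpha>"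
  have b: "0 < b" using c \<delta> by (simp add: b_def)
  define \<Sigma> where "\<Sigma> = (\<Sum>k. exp (- b * real k powr \<alpha>))"
  have \<Sigma>: "0 \<le> \<Sigma>" unfolding \<Sigma>_def using summable_exp_minus_powr[OF b \<alpha>(1)] by (intro suminf_nonneg) auto
  have conc: "measure_pmf.prob (steps p n) {x. increment x j k = z} \<le> 4 * \<Sigma> * real (k - j) powr (- 1 / \<alpha>)"
    if jk: "j < k" "k \<le> n" for n j k z
  proof -
    define m where "m = k - j"
    have m: "1 \<le> m" using jk by (simp add: m_def)
    define q where "q = real m powr (1 / \<alpha>)"
    have q1: "1 \<le> q" unfolding q_def using m \<alpha> by (intro ge_one_powr_ge_zero) auto
    define L where "L = nat \<lfloor>q\<rfloor>"
    have L: "1 \<le> L" "real L \<le> q" "q < real L + 1" using q1 unfolding L_def by linarith+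
    have LA: "real L powr \<alpha> \<le> real m"
    proof -
      have "real L powr \<alpha> \<le> q powr \<alpha>" using L \<alpha> by (intro powr_mono2) auto
      also have "\<dots> = real m" using \<alpha> m by (simp add: q_def powr_powr)
      finally show ?thesis .
    qed
    have "measure_pmf.prob (steps p n) {x \<in> space (steps p n). real_of_int (increment x j k) = real_of_int z} \<le> 2 * \<Sigma> / real L"
      unfolding \<Sigma>_def
    proof (rule measure_pmf.prob_eq_le_of_char_bound[where \<theta>="\<delta> / real L"])
      fix l assume l: "l < L"
      have "(CLINT x|steps p n. iexp (\<delta> / real L * real l * real_of_int (increment x j k))) = pmf_char p (\<delta> / real L * real l) ^ m"
      proof -
        have "{j..<k} \<subseteq> {..<n}" using jk by auto
        from integral_prod_iexp_iid[OF this, of p "\<delta> / real L * real l"] show ?thesis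
          by (simp add: increment_def pmf_char_def m_def)
      qed
      then have "cmod (CLINT x|steps p n. iexp (\<delta> / real L * real l * real_of_int (increment x j k))) = cmod (pmf_char p (\<delta> / real L * real l)) ^ m"
        by (simp add: norm_power)
      also have "\<dots> \<le> exp (- c * \<bar>\<delta> / real L * real l\<bar> powr \<alpha>) ^ m"
      proof (intro power_mono bound)
        have "\<delta> * real l \<le> \<delta> * real L" using l \<delta> by (intro mult_left_mono) auto
        then show "\<bar>\<delta> / real L * real l\<bar> \<le> \<delta>" using L \<delta> by (simp add: abs_mult field_simps)
      qed simp
      also have "\<dots> = exp (- (real m * (c * \<bar>\<delta> / real L * real l\<bar> powr \<alpha>)))"
        by (simp add: exp_of_nat_mult[symmetric])
      also have "\<bar>\<delta> / real L * real l\<bar> powr \<alpha> = \<delta> powr \<alpha> / real L powr \<alpha> * real l powr \<alpha>"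
        using \<delta> L by (simp add: abs_mult powr_mult powr_divide)
      also have "exp (- (real m * (c * (\<delta> powr \<alpha> / real L powr \<alpha> * real l powr \<alpha>)))) \<le> exp (- b * real l powr \<alpha>)"
      proof -
        have "1 \<le> real m / real L powr \<alpha>" using LA L by simp
        then have "1 * (b * real l powr \<alpha>) \<le> real m / real L powr \<alpha> * (b * real l powr \<alpha>)"
          using b by (intro mult_right_mono) auto
        then show ?thesis by (simp add: b_def mult_ac)
      qed
      finally show "cmod (CLINT x|steps p n. iexp (\<delta> / real L * real l * real_of_int (increment x j k))) \<le> exp (- b * real l powr \<alpha>)" .
    qed (use b \<alpha> L in auto)
    also have "\<dots> \<le> 2 * \<Sigma> / (q / 2)"
    proof (rule divide_left_mono)
      have L1: "1 \<le> real L" using L(1) by simp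
      show "q / 2 \<le> real L" using L1 L(3) by linarith
      show "0 < real L * (q / 2)" using L1 q1 by (intro mult_pos_pos) linarith+
    qed (use \<Sigma> in simp)
    also have "\<dots> = 4 * \<Sigma> * real m powr (- 1 / \<alpha>)"
      by (simp add: q_def powr_minus field_simps)
    finally show ?thesis by (simp add: m_def)
  qed
  have "concentrated_walk p (\<lambda>l. 4 * \<Sigma> * real l powr (- 1 / \<alpha>))"
  proof
    show "summable (\<lambda>l. 4 * \<Sigma> * real l powr (- 1 / \<alpha>))"
      using \<alpha> by (intro summable_mult) (simp add: summable_real_powr_iff)
  qed (use conc \<Sigma> in auto)
  then show ?thesis using \<Sigma> by (intro exI[of _ "4 * \<Sigma>"]) auto
qed

section \<open>Fourier inversion\<close>

text \<open>Compared with \<open>1/(1 + s\<^sup>2)\<close>; the linear factor is there for the first moment of the stable characteristic function.\<close>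

lemma integrable_linear_exp_powr:
  fixes c \<beta> :: real
  assumes c: "0 < c" and \<beta>: "0 < \<beta>"
  shows "integrable lborel (\<lambda>s. (1 + \<bar>s\<bar>) * exp (- c * \<bar>s\<bar> powr \<beta>))"
proof -
  have "((\<lambda>s. (1 + s) * (1 + s\<^sup>2) * exp (- c * s powr \<beta>)) \<longlongrightarrow> 0) at_top"
    using assms by real_asymp
  then have "eventually (\<lambda>s. (1 + s) * (1 + s\<^sup>2) * exp (- c * s powr \<beta>) < 1) at_top"
    by (rule order_tendstoD) simp
  then obtain B where B: "\<And>s. s \<ge> B \<Longrightarrow> (1 + s) * (1 + s\<^sup>2) * exp (- c * s powr \<beta>) < 1"
    by (auto simp: eventually_at_top_linorder)
  define B' where "B' = max B 1"
  define K where "K = (1 + B') * (1 + B'\<^sup>2)"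
  have K: "1 \<le> K"
    unfolding K_def by (rule mult_ge1_I) (auto simp: B'_def)
  have bound: "(1 + \<bar>s\<bar>) * exp (- c * \<bar>s\<bar> powr \<beta>) \<le> K * inverse (1 + s\<^sup>2)" for s
  proof -
    have gt0: "0 < 1 + s\<^sup>2" by (simp add: add_pos_nonneg)
    have "(1 + \<bar>s\<bar>) * (1 + \<bar>s\<bar>\<^sup>2) * exp (- c * \<bar>s\<bar> powr \<beta>) \<le> K"
    proof (cases "B' \<le> \<bar>s\<bar>")
      case True
      then show ?thesis using B[of "\<bar>s\<bar>"] K by (simp add: B'_def)
    next
      case False
      have "(1 + \<bar>s\<bar>) * (1 + \<bar>s\<bar>\<^sup>2) * exp (- c * \<bar>s\<bar> powr \<beta>) \<le> (1 + \<bar>s\<bar>) * (1 + \<bar>s\<bar>\<^sup>2) * 1"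
        using c by (intro mult_left_mono) auto
      also have "\<dots> \<le> K * 1" unfolding K_def using False
        by (intro mult_mono add_left_mono power_mono) auto
      finally show ?thesis by simp
    qed
    then show ?thesis using gt0 by (simp add: field_simps)
  qed
  have "integrable lborel (\<lambda>s::real. inverse (1 + s\<^sup>2))"
    using integrable_inverse_1_plus_square by (simp add: set_integrable_def)
  then have "integrable lborel (\<lambda>s::real. K * inverse (1 + s\<^sup>2))" by simp
  then show ?thesis
  proof (rule Bochner_Integration.integrable_bound)
    show "AE s in lborel. norm ((1 + \<bar>s\<bar>) * exp (- c * \<bar>s\<bar> powr \<beta>)) \<le> norm (K * inverse (1 + s\<^sup>2))"
      using bound K by (intro AE_I2) (auto simp: abs_mult)
  qed simp
qed

lemma integrable_exp_powr:
  fixes c \<beta> :: real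
  assumes c: "0 < c" and \<beta>: "0 < \<beta>"
  shows "integrable lborel (\<lambda>s. exp (- c * \<bar>s\<bar> powr \<beta>))"
  by (rule Bochner_Integration.integrable_bound[OF integrable_linear_exp_powr[OF assms]])
     (auto simp: abs_mult mult_le_cancel_right1)

lemma norm_stable_char: "cmod (stable_char \<beta> A1 A2 u) = exp (- A1 * \<bar>u\<bar> powr \<beta>)"
  by (simp add: stable_char_def mult.commute)

lemma borel_measurable_stable_char [measurable]: "stable_char \<beta> A1 A2 \<in> borel_measurable borel"
  unfolding stable_char_def[abs_def] by measurable

lemma integrable_stable_char:
  assumes "0 < A1" "0 < \<beta>"
  shows "complex_integrable lborel (stable_char \<beta> A1 A2)"
  by (rule Bochner_Integration.integrable_bound[OF integrable_exp_powr[OF assms]])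
     (auto simp: norm_stable_char)

definition inverse_fourier :: "(real \<Rightarrow> complex) \<Rightarrow> real \<Rightarrow> complex" where
  "inverse_fourier \<psi> x = (CLINT s|lborel. iexp (- (s * x)) * \<psi> s) / (2 * pi)"

lemma integrable_iexp_mult:
  assumes "complex_integrable lborel \<psi>"
  shows "complex_integrable lborel (\<lambda>s. iexp (- (s * x)) * \<psi> s)"
  by (rule Bochner_Integration.integrable_bound[OF assms]) (use assms in \<open>auto simp: norm_mult\<close>)

lemma continuous_inverse_fourier:
  assumes \<psi>: "complex_integrable lborel \<psi>"
  shows "continuous_on UNIV (inverse_fourier \<psi>)"
proof (intro continuous_at_imp_continuous_on ballI)
  fix x
  have [measurable]: "\<psi> \<in> borel_measurable lborel" using \<psi> by auto
  show "isCont (inverse_fourier \<psi>) x"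
    unfolding continuous_at_sequentially o_def inverse_fourier_def
  proof safe
    fix X assume X: "X \<longlonglongrightarrow> x"
    have "(\<lambda>n. CLINT s|lborel. iexp (- (s * X n)) * \<psi> s) \<longlonglongrightarrow> (CLINT s|lborel. iexp (- (s * x)) * \<psi> s)"
    proof (rule integral_dominated_convergence[where w="\<lambda>s. cmod (\<psi> s)"])
      show "AE s in lborel. (\<lambda>n. iexp (- (s * X n)) * \<psi> s) \<longlonglongrightarrow> iexp (- (s * x)) * \<psi> s"
        using X by (intro AE_I2 tendsto_intros)
    qed (use \<psi> in \<open>auto simp: norm_mult intro!: AE_I2\<close>)
    then show "(\<lambda>n. (CLINT s|lborel. iexp (- (s * X n)) * \<psi> s) / (2 * pi)) \<longlonglongrightarrow> (CLINT s|lborel. iexp (- (s * x)) * \<psi> s) / (2 * pi)"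
      by (intro tendsto_intros) auto
  qed
qed

lemma interval_integral_iexp_mult:
  assumes "t \<noteq> 0"
  shows "(CLBINT x=ereal a..ereal b. iexp (- (t * x))) = (iexp (- (t * a)) - iexp (- (t * b))) / (\<i> * t)"
proof -
  have "(CLBINT x=ereal a..ereal b. iexp (- (t * x))) = - iexp (- (t * b)) / (\<i> * t) - (- iexp (- (t * a)) / (\<i> * t))"
  proof (rule interval_integral_FTC_finite)
    show "continuous_on {min a b..max a b} (\<lambda>x. iexp (- (t * x)))"
      by (intro continuous_intros)
    fix x
    show "((\<lambda>x. - iexp (- (t * x)) / (\<i> * t)) has_vector_derivative iexp (- (t * x))) (at x within {min a b..max a b})"
    proof -
      have "((\<lambda>z. - exp (\<i> * - (complex_of_real t * z)) / (\<i> * t)) has_field_derivative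
          exp (\<i> * - (complex_of_real t * complex_of_real x))) (at (complex_of_real x))"
        using assms by (auto intro!: derivative_eq_intros simp: field_simps)
      from has_vector_derivative_real_field[OF this] show ?thesis by simp
    qed
  qed
  then show ?thesis by (simp add: diff_divide_distrib)
qed

context real_distribution begin

text \<open>The concentration inequality with arbitrarily many characters: the sum over \<open>k\<close> converges, while \<open>L\<close> is free.\<close>

lemma measure_singleton_eq_0_of_char:
  assumes ch: "char M = stable_char \<beta> A1 A2" and "0 < A1" "0 < \<beta>"
  shows "prob {z} = 0"
proof -
  define \<Sigma> where "\<Sigma> = (\<Sum>k. exp (- A1 * real k powr \<beta>))"
  have le: "prob {z} \<le> 2 * \<Sigma> / real (Suc n)" for n
  proof -
    have "prob {x \<in> space M. x = z} \<le> 2 * \<Sigma> / real (Suc n)" unfolding \<Sigma>_def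
    proof (rule prob_eq_le_of_char_bound[where \<theta>=1])
      fix k
      have "(CLINT x|M. iexp (1 * real k * x)) = char M (real k)" by (simp add: char_def)
      then show "cmod (CLINT x|M. iexp (1 * real k * x)) \<le> exp (- A1 * real k powr \<beta>)"
        by (simp add: ch norm_stable_char)
    qed (use assms in auto)
    moreover have "{x \<in> space M. x = z} = {z}" by auto
    ultimately show ?thesis by simp
  qed
  have "(\<lambda>n. 2 * \<Sigma> / real (Suc n)) \<longlonglongrightarrow> 0"
    by (rule LIMSEQ_Suc[OF lim_const_over_n])
  then have "prob {z} \<le> 0" by (rule LIMSEQ_le_const) (use le in auto)
  then show ?thesis using measure_nonneg[of M "{z}"] by linarith
qed

text \<open>Levy's inversion formula, in which the improper integral converges absolutely and Fubini's theorem applies.\<close>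

lemma measure_Ioc_eq_inverse_fourier:
  assumes ab: "a \<le> b" and \<psi>: "complex_integrable lborel (char M)" and atoms: "prob {a} = 0" "prob {b} = 0"
  shows "complex_of_real (prob {a<..b}) = (CLBINT x:{a<..b}. inverse_fourier (char M) x)"
proof -
  let ?\<psi> = "char M"
  define I where "I t = (CLBINT x:{a<..b}. iexp (- (t * x)))" for t
  have I: "(iexp (- (t * a)) - iexp (- (t * b))) / (\<i> * t) = I t" if "t \<noteq> 0" for t
    using interval_integral_iexp_mult[OF that, of a b] ab by (simp add: I_def interval_integral_Ioc)
  have [measurable]: "?\<psi> \<in> borel_measurable lborel" using \<psi> by auto
  have set_int: "set_integrable lborel {a<..b} (\<lambda>x. iexp (- (t * x)))" for t
    unfolding set_integrable_def
    by (rule Bochner_Integration.integrable_bound[where f="indicator {a<..b} :: real \<Rightarrow> real"])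
       (use ab in \<open>auto simp: indicator_def\<close>)
  have I_le: "cmod (I t) \<le> b - a" for t
  proof -
    have "cmod (I t) \<le> (LBINT x:{a<..b}. cmod (iexp (- (t * x))))"
      unfolding I_def by (rule set_integral_norm_bound[OF set_int])
    also have "\<dots> = b - a" using ab by (simp add: set_lebesgue_integral_def)
    finally show ?thesis .
  qed
  have I_meas [measurable]: "I \<in> borel_measurable borel"
    unfolding I_def[abs_def] set_lebesgue_integral_def by measurable
  have I\<psi>: "complex_integrable lborel (\<lambda>t. I t * ?\<psi> t)"
  proof (rule Bochner_Integration.integrable_bound)
    show "integrable lborel (\<lambda>t. (b - a) * cmod (?\<psi> t))" using \<psi> by auto
    show "AE t in lborel. norm (I t * ?\<psi> t) \<le> norm ((b - a) * cmod (?\<psi> t))"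
      using I_le ab by (auto simp: norm_mult abs_mult intro!: mult_right_mono)
  qed simp
  have "(\<lambda>T. 1 / (2 * pi) * (CLBINT t:{- real T..real T}. I t * ?\<psi> t)) \<longlonglongrightarrow> 1 / (2 * pi) * (CLINT t|lborel. I t * ?\<psi> t)"
  proof (intro tendsto_intros)
    show "(\<lambda>T. CLBINT t:{- real T..real T}. I t * ?\<psi> t) \<longlonglongrightarrow> (CLINT t|lborel. I t * ?\<psi> t)"
      unfolding set_lebesgue_integral_def
    proof (rule integral_dominated_convergence[where w="\<lambda>t. cmod (I t * ?\<psi> t)"])
      show "AE t in lborel. (\<lambda>T. indicator {- real T..real T} t *\<^sub>R (I t * ?\<psi> t)) \<longlonglongrightarrow> I t * ?\<psi> t"
      proof (rule AE_I2)
        fix t :: real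
        obtain N :: nat where N: "\<bar>t\<bar> \<le> real N" using real_arch_simple by blast
        have "eventually (\<lambda>T. indicator {- real T..real T} t *\<^sub>R (I t * ?\<psi> t) = I t * ?\<psi> t) sequentially"
          using eventually_ge_at_top[of N]
        proof eventually_elim
          case (elim T)
          then have "t \<in> {- real T..real T}" using N by (auto simp: abs_le_iff)
          then show ?case by simp
        qed
        then show "(\<lambda>T. indicator {- real T..real T} t *\<^sub>R (I t * ?\<psi> t)) \<longlonglongrightarrow> I t * ?\<psi> t"
          by (rule tendsto_eventually)
      qed
    qed (use I\<psi> in \<open>auto simp: indicator_def\<close>)
  qed
  moreover have "(CLBINT t:{- real T..real T}. I t * ?\<psi> t) =
      (CLBINT t=- real T..real T. (iexp (- (t * a)) - iexp (- (t * b))) / (\<i> * t) * ?\<psi> t)" for T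
  proof -
    have "(CLBINT t=- real T..real T. (iexp (- (t * a)) - iexp (- (t * b))) / (\<i> * t) * ?\<psi> t) =
      (CLBINT t:{- real T..real T}. (iexp (- (t * a)) - iexp (- (t * b))) / (\<i> * t) * ?\<psi> t)"
      by (subst interval_integral_Icc[symmetric]) auto
    also have "\<dots> = (CLBINT t:{- real T..real T}. I t * ?\<psi> t)"
      unfolding set_lebesgue_integral_def
    proof (rule integral_cong_AE)
      have "AE t in lborel. t \<noteq> (0::real)" by (rule AE_lborel_singleton)
      then show "AE t in lborel. indicator {- real T..real T} t *\<^sub>R ((iexp (- (t * a)) - iexp (- (t * b))) / (\<i> * t) * ?\<psi> t)
        = indicator {- real T..real T} t *\<^sub>R (I t * ?\<psi> t)"
      proof eventually_elim
        case (elim t)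
        show ?case unfolding I[OF elim] ..
      qed
    qed measurable
    finally show ?thesis ..
  qed
  ultimately have "(\<lambda>T. 1 / (2 * pi) * (CLBINT t=- real T..real T. (iexp (- (t * a)) - iexp (- (t * b))) / (\<i> * t) * ?\<psi> t))
     \<longlonglongrightarrow> 1 / (2 * pi) * (CLINT t|lborel. I t * ?\<psi> t)" by simp
  with Levy_Inversion[OF ab] atoms have "complex_of_real (prob {a<..b}) = 1 / (2 * pi) * (CLINT t|lborel. I t * ?\<psi> t)"
    by (intro LIMSEQ_unique) auto
  also have "(CLINT t|lborel. I t * ?\<psi> t) = (CLINT t|lborel. CLINT x|lborel. indicator {a<..b} x *\<^sub>R (iexp (- (t * x)) * ?\<psi> t))"
  proof (intro Bochner_Integration.integral_cong refl)
    fix t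
    show "I t * ?\<psi> t = (CLINT x|lborel. indicator {a<..b} x *\<^sub>R (iexp (- (t * x)) * ?\<psi> t))"
      unfolding I_def set_lebesgue_integral_def by (subst integral_mult_left_zero[symmetric]) simp
  qed
  also have "\<dots> = (CLINT x|lborel. CLINT t|lborel. indicator {a<..b} x *\<^sub>R (iexp (- (t * x)) * ?\<psi> t))"
  proof (rule lborel_pair.Fubini_integral)
    show "integrable (lborel \<Otimes>\<^sub>M lborel) (\<lambda>(x, t). indicator {a<..b} x *\<^sub>R (iexp (- (t * x)) * ?\<psi> t))"
    proof (rule lborel_pair.Fubini_integrable)
      have "(\<lambda>x. LINT t|lborel. norm (case (x, t) of (x, t) \<Rightarrow> indicator {a<..b} x *\<^sub>R (iexp (- (t * x)) * ?\<psi> t)))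
        = (\<lambda>x. indicator {a<..b} x * (LINT t|lborel. cmod (?\<psi> t)))"
        by (auto simp: fun_eq_iff norm_mult indicator_def)
      then show "integrable lborel (\<lambda>x. LINT t|lborel. norm (case (x, t) of (x, t) \<Rightarrow> indicator {a<..b} x *\<^sub>R (iexp (- (t * x)) * ?\<psi> t)))"
        using ab by simp
      show "AE x in lborel. complex_integrable lborel (\<lambda>t. case (x, t) of (x, t) \<Rightarrow> indicator {a<..b} x *\<^sub>R (iexp (- (t * x)) * ?\<psi> t))"
        using integrable_iexp_mult[OF \<psi>] by auto
    qed measurable
  qed
  also have "1 / (2 * pi) * \<dots> = (CLBINT x:{a<..b}. inverse_fourier ?\<psi> x)"
    unfolding set_lebesgue_integral_def inverse_fourier_def
    by (subst integral_mult_right_zero[symmetric]) (simp add: field_simps)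
  finally show ?thesis .
qed

lemma density_inverse_fourier:
  assumes ch: "char M = stable_char \<beta> A1 A2" and A1: "0 < A1" and \<beta>: "0 < \<beta>"
  defines "f \<equiv> \<lambda>x. Re (inverse_fourier (char M) x)"
  shows "continuous_on UNIV f" "\<And>x. 0 \<le> f x" "M = density lborel (\<lambda>x. ennreal (f x))"
proof -
  have \<psi>: "complex_integrable lborel (char M)" unfolding ch using A1 \<beta> by (rule integrable_stable_char)
  have contI: "continuous_on UNIV (inverse_fourier (char M))" by (rule continuous_inverse_fourier[OF \<psi>])
  show cont: "continuous_on UNIV f" unfolding f_def by (intro continuous_intros contI)
  have [measurable]: "f \<in> borel_measurable borel" "inverse_fourier (char M) \<in> borel_measurable borel"
    using cont contI by (auto intro: borel_measurable_continuous_onI)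
  have atom: "prob {z} = 0" for z using ch A1 \<beta> by (rule measure_singleton_eq_0_of_char)
  have intf: "integrable lborel (\<lambda>x. indicator {a<..b} x * f x)"
    and Ioc: "prob {a<..b} = (LINT x|lborel. indicator {a<..b} x * f x)" if "a \<le> b" for a b
  proof -
    have "set_integrable lborel {a..b} (inverse_fourier (char M))"
      by (rule borel_integrable_compact[unfolded set_integrable_def[symmetric]]) (auto intro: continuous_on_subset[OF contI])
    then have i: "set_integrable lborel {a<..b} (inverse_fourier (char M))"
      by (rule set_integrable_subset) auto
    then have i': "complex_integrable lborel (\<lambda>x. indicator {a<..b} x *\<^sub>R inverse_fourier (char M) x)"
      by (simp add: set_integrable_def)
    from integrable_Re[OF i'] show "integrable lborel (\<lambda>x. indicator {a<..b} x * f x)"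
      by (simp add: f_def)
    have "prob {a<..b} = Re (CLBINT x:{a<..b}. inverse_fourier (char M) x)"
      using measure_Ioc_eq_inverse_fourier[OF that \<psi> atom atom] by (metis Re_complex_of_real)
    also have "\<dots> = (LINT x|lborel. indicator {a<..b} x * f x)"
      unfolding set_lebesgue_integral_def using integral_Re[OF i'] by (simp add: f_def)
    finally show "prob {a<..b} = (LINT x|lborel. indicator {a<..b} x * f x)" .
  qed
  show nonneg: "0 \<le> f x" for x
  proof (rule ccontr)
    assume "\<not> 0 \<le> f x"
    then have neg: "f x < 0" by simp
    have "isCont f x" using cont by (simp add: continuous_on_eq_continuous_at)
    then have "eventually (\<lambda>y. f y < f x / 2) (at x)"
      using neg unfolding isCont_def by (intro order_tendstoD) auto
    then obtain e where e: "e > 0" "\<And>y. y \<noteq> x \<Longrightarrow> dist y x < e \<Longrightarrow> f y < f x / 2"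
      unfolding eventually_at by auto
    define b where "b = x + e / 2"
    have b: "x < b" using e by (simp add: b_def)
    have "prob {x<..b} = (LINT y|lborel. indicator {x<..b} y * f y)" using b by (intro Ioc) simp
    also have "\<dots> \<le> (LINT y|lborel. indicator {x<..b} y * (f x / 2))"
    proof (intro integral_mono intf)
      show "x \<le> b" using b by simp
      show "integrable lborel (\<lambda>y. indicator {x<..b} y * (f x / 2))" using b by simp
      fix y
      show "indicator {x<..b} y * f y \<le> indicator {x<..b} y * (f x / 2)"
        using e(2)[of y] e(1) by (auto simp: indicator_def b_def dist_real_def)
    qed
    also have "\<dots> = (b - x) * (f x / 2)" using b by simp
    also have "\<dots> < 0" using b neg by (simp add: mult_pos_neg)
    finally show False using measure_nonneg[of M "{x<..b}"] by linarith
  qed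
  show "M = density lborel (\<lambda>x. ennreal (f x))"
  proof (rule measure_eqI_lessThan)
    fix x :: real
    show "emeasure M {x<..} < \<infinity>" by (simp add: less_top[symmetric] emeasure_eq_measure)
    have eq: "emeasure M {x<..x + real n} = emeasure (density lborel (\<lambda>x. ennreal (f x))) {x<..x + real n}" for n
    proof -
      have "emeasure (density lborel (\<lambda>x. ennreal (f x))) {x<..x + real n} =
        (\<integral>\<^sup>+y. ennreal (indicator {x<..x + real n} y * f y) \<partial>lborel)"
        by (subst emeasure_density) (auto intro!: nn_integral_cong simp: indicator_def)
      also have "\<dots> = ennreal (LINT y|lborel. indicator {x<..x + real n} y * f y)"
        by (intro nn_integral_eq_integral intf) (auto simp: nonneg)
      also have "\<dots> = emeasure M {x<..x + real n}"
        by (simp add: emeasure_eq_measure Ioc)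
      finally show ?thesis ..
    qed
    have un: "{x<..} = (\<Union>n. {x<..x + real n})"
    proof safe
      fix y :: real assume "x < y"
      obtain n :: nat where "y - x \<le> real n" using real_arch_simple by blast
      then show "y \<in> (\<Union>n. {x<..x + real n})" using \<open>x < y\<close> by (auto intro!: exI[of _ n])
    qed auto
    have incr: "incseq (\<lambda>n. {x<..x + real n})" by (auto simp: incseq_def)
    have "emeasure M {x<..} = (SUP n. emeasure M {x<..x + real n})"
      unfolding un using incr by (intro SUP_emeasure_incseq[symmetric]) auto
    also have "\<dots> = (SUP n. emeasure (density lborel (\<lambda>x. ennreal (f x))) {x<..x + real n})"
      by (simp add: eq)
    also have "\<dots> = emeasure (density lborel (\<lambda>x. ennreal (f x))) {x<..}"
      unfolding un using incr by (intro SUP_emeasure_incseq) auto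
    finally show "emeasure M {x<..} = emeasure (density lborel (\<lambda>x. ennreal (f x))) {x<..}" .
  qed auto
qed

text \<open>Identifies the density with the inverse Fourier transform at every point; two continuous densities that agree
almost everywhere agree everywhere.\<close>

lemma continuous_density_stable:
  assumes ch: "char M = stable_char \<beta> A1 A2" and A1: "0 < A1" and \<beta>: "0 < \<beta>"
  shows "continuous_density M x = Re (inverse_fourier (stable_char \<beta> A1 A2) x)"
proof -
  let ?f = "\<lambda>x. Re (inverse_fourier (char M) x)"
  note f = density_inverse_fourier[OF assms]
  have "continuous_density M = ?f" unfolding continuous_density_def
  proof (rule the_equality)
    show "continuous_on UNIV ?f \<and> (\<forall>x. 0 \<le> ?f x) \<and> M = density lborel (\<lambda>x. ennreal (?f x))"
      using f by auto
    fix g assume g: "continuous_on UNIV g \<and> (\<forall>x. 0 \<le> g x) \<and> M = density lborel (\<lambda>x. ennreal (g x))"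
    have [measurable]: "?f \<in> borel_measurable borel" "g \<in> borel_measurable borel"
      using f(1) g by (auto intro: borel_measurable_continuous_onI)
    have "density lborel (\<lambda>x. ennreal (g x)) = density lborel (\<lambda>x. ennreal (?f x))"
      using f(3) g by auto
    then have "AE x in lborel. ennreal (g x) = ennreal (?f x)"
      by (subst (asm) sigma_finite_measure.density_unique_iff[OF sigma_finite_lborel]) auto
    then have ae: "AE x in lborel. g x = ?f x"
      using f(2) g by (auto simp: ennreal_inj)
    define U where "U = {x. g x \<noteq> ?f x}"
    have "open U" unfolding U_def using f(1) g by (intro open_Collect_neq) auto
    moreover have "U \<in> null_sets lborel"
    proof -
      have "U \<in> sets lborel" using \<open>open U\<close> by simp
      then show ?thesis using ae by (subst (asm) AE_iff_null) (auto simp: U_def)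
    qed
    then have "negligible U" by (simp add: negligible_iff_null_sets null_sets_completionI)
    ultimately have "U = {}" using open_not_negligible by blast
    then show "g = ?f" by (auto simp: U_def fun_eq_iff)
  qed
  then show ?thesis by (simp add: ch)
qed

end

lemma integral_iexp_int:
  "(CLBINT s:{- pi..pi}. iexp (s * real_of_int k)) = (if k = 0 then complex_of_real (2 * pi) else 0)"
proof (cases "k = 0")
  case True
  then show ?thesis by (simp add: set_lebesgue_integral_def scaleR_conv_of_real)
next
  case False
  have "(CLBINT s:{- pi..pi}. iexp (s * real_of_int k)) = (CLBINT s=ereal (- pi)..ereal pi. iexp (- (real_of_int (- k) * s)))"
    by (subst interval_integral_Icc) (simp_all add: mult.commute)
  also have "\<dots> = (iexp (- (real_of_int (- k) * (- pi))) - iexp (- (real_of_int (- k) * pi))) / (\<i> * real_of_int (- k))"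
    using False by (intro interval_integral_iexp_mult) simp
  also have "iexp (- (real_of_int (- k) * (- pi))) = iexp (- (real_of_int (- k) * pi))"
  proof -
    have "iexp (real_of_int k * pi) = iexp (- (real_of_int k * pi)) * exp (2 * of_int k * pi * \<i>)"
      by (subst exp_add[symmetric], rule arg_cong[where f=exp], simp add: algebra_simps)
    also have "exp (2 * of_int k * pi * \<i>) = 1" by (rule exp_integer_2pi) simp
    finally have "iexp (- (real_of_int k * pi)) = iexp (real_of_int k * pi)" by (simp only: mult_1_right)
    then show ?thesis by (simp only: of_int_minus minus_mult_minus mult_minus_left mult_minus_right minus_minus)
  qed
  finally show ?thesis using False by simp
qed

text \<open>Orthogonality of the characters of the integers on \<open>[-\<pi>, \<pi>]\<close>.\<close>

lemma (in prob_space) prob_eq_0_fourier: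
  fixes K :: "'a \<Rightarrow> int"
  assumes K[measurable]: "K \<in> measurable M (count_space UNIV)"
  shows "complex_of_real (2 * pi * prob {x \<in> space M. K x = 0}) =
    (CLBINT s:{- pi..pi}. (CLINT x|M. iexp (s * real_of_int (K x))))"
proof -
  interpret P: pair_sigma_finite M lborel ..
  let ?I = "indicator {- pi..pi} :: real \<Rightarrow> real"
  have "complex_of_real (2 * pi * prob {x \<in> space M. K x = 0}) = (CLINT x|M. indicator {x \<in> space M. K x = 0} x *\<^sub>R complex_of_real (2 * pi))"
    by (simp add: scaleR_conv_of_real)
  also have "\<dots> = (CLINT x|M. (CLBINT s:{- pi..pi}. iexp (s * real_of_int (K x))))"
    unfolding integral_iexp_int by (intro Bochner_Integration.integral_cong) (auto simp: indicator_def)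
  also have "\<dots> = (CLINT x|M. CLINT s|lborel. ?I s *\<^sub>R iexp (s * real_of_int (K x)))"
    by (simp add: set_lebesgue_integral_def)
  also have "\<dots> = (CLINT s|lborel. CLINT x|M. ?I s *\<^sub>R iexp (s * real_of_int (K x)))"
  proof (rule P.Fubini_integral[symmetric])
    show "integrable (M \<Otimes>\<^sub>M lborel) (\<lambda>(x, s). ?I s *\<^sub>R iexp (s * real_of_int (K x)))"
    proof (rule P.Fubini_integrable)
      show "integrable M (\<lambda>x. LINT s|lborel. norm (case (x, s) of (x, s) \<Rightarrow> ?I s *\<^sub>R iexp (s * real_of_int (K x))))"
        by simp
      show "AE x in M. complex_integrable lborel (\<lambda>s. case (x, s) of (x, s) \<Rightarrow> ?I s *\<^sub>R iexp (s * real_of_int (K x)))"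
      proof (rule AE_I2)
        fix x
        show "complex_integrable lborel (\<lambda>s. case (x, s) of (x, s) \<Rightarrow> ?I s *\<^sub>R iexp (s * real_of_int (K x)))"
          by (rule Bochner_Integration.integrable_bound[where f="?I"]) auto
      qed
    qed measurable
  qed
  also have "\<dots> = (CLBINT s:{- pi..pi}. (CLINT x|M. iexp (s * real_of_int (K x))))"
    unfolding set_lebesgue_integral_def by simp
  finally show ?thesis .
qed

section \<open>From the domain of attraction to the path measure\<close>

text \<open>Strict stability of the limit law, read off from the formula.\<close>

lemma stable_char_self_similar:
  assumes \<beta>: "0 < \<beta>" and n: "1 \<le> n"
  shows "stable_char \<beta> A1 A2 (u * real n powr (- 1 / \<beta>)) ^ n = stable_char \<beta> A1 A2 u"
proof -
  have "\<bar>u * real n powr (- 1 / \<beta>)\<bar> powr \<beta> = \<bar>u\<bar> powr \<beta> * (real n powr (- 1 / \<beta>)) powr \<beta>"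
    by (simp add: abs_mult powr_mult)
  also have "(real n powr (- 1 / \<beta>)) powr \<beta> = real n powr (- 1)"
    unfolding powr_powr using \<beta> by simp
  also have "\<dots> = 1 / real n" using n by (simp add: powr_minus_divide)
  finally have "real n * \<bar>u * real n powr (- 1 / \<beta>)\<bar> powr \<beta> = \<bar>u\<bar> powr \<beta>" using n by simp
  then have c: "complex_of_nat n * complex_of_real (\<bar>u * real n powr (- 1 / \<beta>)\<bar> powr \<beta>) = complex_of_real (\<bar>u\<bar> powr \<beta>)"
    using arg_cong[of _ _ complex_of_real] by (metis of_real_mult of_real_of_nat_eq)
  have s: "sgn (u * real n powr (- 1 / \<beta>)) = sgn u" using n by (simp add: sgn_mult)
  show ?thesis unfolding stable_char_def s
    by (subst exp_of_nat_mult[symmetric]) (simp only: mult_minus_right mult.assoc[symmetric] c)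
qed

context prob_space begin

lemma iid_onD:
  assumes "iid_on I Y" "J \<subseteq> I"
  shows "indep_vars (\<lambda>_. count_space UNIV) Y J"
    and "i \<in> I \<Longrightarrow> j \<in> I \<Longrightarrow> distr M (count_space UNIV) (Y i) = distr M (count_space UNIV) (Y j)"
    and "i \<in> I \<Longrightarrow> Y i \<in> measurable M (count_space UNIV)"
proof -
  have i: "indep_vars (\<lambda>_. count_space UNIV) Y I"
    and e: "\<forall>i\<in>I. \<forall>j\<in>I. distr M (count_space UNIV) (Y i) = distr M (count_space UNIV) (Y j)"
    using assms(1) unfolding iid_on_def by (rule conjunct1, rule conjunct2)
  show "indep_vars (\<lambda>_. count_space UNIV) Y J" by (rule indep_vars_subset[OF i assms(2)])
  show "distr M (count_space UNIV) (Y i) = distr M (count_space UNIV) (Y j)" if "i \<in> I" "j \<in> I"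
    using e that by blast
  show "Y i \<in> measurable M (count_space UNIV)" if "i \<in> I"
    using i that unfolding indep_vars_def by (elim conjE bspec)
qed

lemma expectation_iexp_law:
  assumes Y: "Y \<in> measurable M (count_space UNIV)" and p: "measure_pmf p = distr M (count_space UNIV) Y"
  shows "(CLINT \<omega>|M. iexp (t * real_of_int (Y \<omega>))) = pmf_char p t"
  unfolding pmf_char_def p by (subst integral_distr[OF Y]) simp_all

lemma norm_expectation_iexp_le: "cmod (CLINT \<omega>|M. iexp (f \<omega>)) \<le> 1"
proof -
  have "cmod (CLINT \<omega>|M. iexp (f \<omega>)) \<le> (\<integral>\<omega>. cmod (iexp (f \<omega>)) \<partial>M)" by (rule integral_norm_bound)
  then show ?thesis by (simp add: prob_space)
qed

end

lemma norm_pmf_char_le_1: "cmod (pmf_char p t) \<le> 1"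
  unfolding pmf_char_def by (rule measure_pmf.norm_expectation_iexp_le)

lemma pmf_char_eq_char: "pmf_char p t = char (distr (measure_pmf p) borel real_of_int) t"
  unfolding pmf_char_def char_def by (subst integral_distr) simp_all

lemma isCont_pmf_char: "isCont (pmf_char p) t"
proof -
  interpret real_distribution "distr (measure_pmf p) borel real_of_int"
    by (rule prob_space.real_distribution_distr[OF measure_pmf.prob_space_axioms]) simp
  show ?thesis using isCont_char unfolding pmf_char_eq_char[abs_def] .
qed

context prob_space begin

text \<open>The characteristic function of the normalised sum of \<open>n\<close> terms is an \<open>n\<close>-th power by independence.\<close>

lemma normal_attraction_scaling_limit:
  assumes iid: "iid_on {1..} Y" and att: "normal_attraction M Y \<alpha> S"
    and p: "measure_pmf p = distr M (count_space UNIV) (Y 1)"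
  shows "scaling_limit \<alpha> (pmf_char p) (char S)"
  unfolding scaling_limit_def
proof (intro allI impI)
  fix e :: real assume e: "0 < e"
  note Y = iid_onD[OF iid]
  have Ym: "Y i \<in> measurable M (count_space UNIV)" if "1 \<le> i" for i
    using Y(3)[OF subset_refl, of i] that by simp
  have Yb: "(\<lambda>\<omega>. real_of_int (Y i \<omega>)) \<in> borel_measurable M" if "1 \<le> i" for i
    by (rule measurable_compose[OF Ym[OF that]]) simp
  let ?Z = "\<lambda>n \<omega>. real n powr (- 1 / \<alpha>) * (\<Sum>i = 1..int n. real_of_int (Y i \<omega>))"
  have Zm: "?Z n \<in> borel_measurable M" for n
    by (intro borel_measurable_times borel_measurable_sum Yb) auto
  have S: "real_distribution S" and conv: "weak_conv_m (\<lambda>n. distr M borel (?Z n)) S"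
    using att unfolding normal_attraction_def strictly_stable_def by auto
  obtain J where J: "\<And>n u. n \<ge> J \<Longrightarrow> \<bar>u\<bar> \<le> 1 \<Longrightarrow> cmod (char (distr M borel (?Z n)) u - char S u) < e"
    using char_weak_conv_uniform[OF _ S conv e] real_distribution_distr[OF Zm] by blast
  have ch: "char (distr M borel (?Z n)) u = pmf_char p (u * real n powr (- 1 / \<alpha>)) ^ n" for n u
  proof -
    define t where "t = u * real n powr (- 1 / \<alpha>)"
    have ind: "indep_vars (\<lambda>_. count_space UNIV) Y {1..int n}"
      by (rule Y(1)) auto
    have ind': "indep_vars (\<lambda>_. borel) (\<lambda>i \<omega>. iexp (t * real_of_int (Y i \<omega>))) {1..int n}"
      by (rule indep_vars_compose2[OF ind, where Y="\<lambda>i z. iexp (t * real_of_int z)"]) simp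
    have "char (distr M borel (?Z n)) u = (CLINT \<omega>|M. iexp (u * ?Z n \<omega>))"
      unfolding char_def by (subst integral_distr[OF Zm]) simp_all
    also have "\<dots> = (CLINT \<omega>|M. (\<Prod>i\<in>{1..int n}. iexp (t * real_of_int (Y i \<omega>))))"
      by (simp add: exp_sum[symmetric] sum_distrib_left t_def mult_ac)
    also have "\<dots> = (\<Prod>i\<in>{1..int n}. CLINT \<omega>|M. iexp (t * real_of_int (Y i \<omega>)))"
    proof (rule indep_vars_lebesgue_integral[OF _ ind'])
      fix i assume "i \<in> {1..int n}"
      then have "(\<lambda>\<omega>. iexp (t * real_of_int (Y i \<omega>))) \<in> borel_measurable M"
        by (intro measurable_compose[OF Ym]) auto
      then show "complex_integrable M (\<lambda>\<omega>. iexp (t * real_of_int (Y i \<omega>)))"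
        by (intro integrable_const_bound[where B=1]) auto
    qed simp
    also have "\<dots> = (\<Prod>i\<in>{1..int n}. pmf_char p t)"
    proof (intro prod.cong refl)
      fix i assume i: "i \<in> {1..int n}"
      then have "measure_pmf p = distr M (count_space UNIV) (Y i)" using Y(2)[OF subset_refl, of 1 i] p by simp
      then show "(CLINT \<omega>|M. iexp (t * real_of_int (Y i \<omega>))) = pmf_char p t"
        using i by (intro expectation_iexp_law Ym) auto
    qed
    also have "\<dots> = pmf_char p t ^ n" by simp
    finally show ?thesis unfolding t_def .
  qed
  show "\<exists>J. \<forall>n\<ge>J. \<forall>u. \<bar>u\<bar> \<le> 1 \<longrightarrow> cmod (pmf_char p (u * real n powr (- 1 / \<alpha>)) ^ n - char S u) < e"
    using J unfolding ch by blast
qed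

lemma normal_attraction_char_bound:
  assumes "iid_on {1..} Y" and att: "normal_attraction M Y \<alpha> S"
    and "measure_pmf p = distr M (count_space UNIV) (Y 1)"
  shows "\<exists>c>0. \<exists>\<delta>>0. \<forall>t. \<bar>t\<bar> \<le> \<delta> \<longrightarrow> cmod (pmf_char p t) \<le> exp (- c * \<bar>t\<bar> powr \<alpha>)"
proof (rule scaling_limit_bound_near_0)
  show "scaling_limit \<alpha> (pmf_char p) (char S)" by (rule normal_attraction_scaling_limit) fact+
  have st: "strictly_stable \<alpha> S" using att by (simp add: normal_attraction_def)
  then show "0 < \<alpha>" by (simp add: strictly_stable_def)
  interpret S: real_distribution S using st by (simp add: strictly_stable_def)
  show "continuous_on UNIV (char S)" by (intro continuous_at_imp_continuous_on ballI S.isCont_char)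
  show "cmod (char S u) < 1" if "u \<noteq> 0" for u using char_strictly_stable_less_1[OF st that] .
qed (rule norm_pmf_char_le_1)

lemma walk_eq_position:
  assumes "k < n"
  shows "walk X (int k) \<omega> = position (\<lambda>i. if i < n then X (1 + int i) \<omega> else 0) k"
proof -
  have "walk X (int k) \<omega> = (\<Sum>i = 1..int k. X i \<omega>)" by (simp add: walk_def)
  also have "\<dots> = (\<Sum>i<k. X (1 + int i) \<omega>)"
    by (intro sum.reindex_bij_witness[of _ "\<lambda>i. 1 + int i" "\<lambda>i. nat (i - 1)"]) auto
  also have "\<dots> = position (\<lambda>i. if i < n then X (1 + int i) \<omega> else 0) k"
    unfolding position_def using assms by (intro sum.cong) auto
  finally show ?thesis .
qed

text \<open>Along a fixed path \<open>s\<close> the scenery sum is a combination of independent variables with the visit counts as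
coefficients.\<close>

lemma expectation_iexp_scenery_along:
  fixes s :: "nat \<Rightarrow> int"
  assumes iid: "iid_on UNIV \<xi>" and p: "measure_pmf p = distr M (count_space UNIV) (\<xi> 1)"
  shows "(CLINT \<omega>|M. iexp (t * real_of_int (\<Sum>k<n. \<xi> (s k) \<omega>))) =
    (\<Prod>y\<in>s ` {..<n}. pmf_char p (t * real (card {k. k < n \<and> s k = y})))"
proof -
  note Y = iid_onD[OF iid]
  let ?N = "\<lambda>y. real (card {k. k < n \<and> s k = y})"
  have Ym: "\<xi> i \<in> measurable M (count_space UNIV)" for i using Y(3)[OF subset_refl, of i] by simp
  have ind: "indep_vars (\<lambda>_. count_space UNIV) \<xi> (s ` {..<n})" by (rule Y(1)) auto
  have ind': "indep_vars (\<lambda>_. borel) (\<lambda>y \<omega>. iexp (t * ?N y * real_of_int (\<xi> y \<omega>))) (s ` {..<n})"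
    by (rule indep_vars_compose2[OF ind, where Y="\<lambda>y z. iexp (t * ?N y * real_of_int z)"]) simp
  have sum: "real_of_int (\<Sum>k<n. \<xi> (s k) \<omega>) = (\<Sum>y\<in>s ` {..<n}. ?N y * real_of_int (\<xi> y \<omega>))" for \<omega>
  proof -
    have "(\<Sum>k<n. real_of_int (\<xi> (s k) \<omega>)) = (\<Sum>y\<in>s ` {..<n}. \<Sum>k\<in>{k\<in>{..<n}. s k = y}. real_of_int (\<xi> (s k) \<omega>))"
      by (rule sum.image_gen) simp
    also have "\<dots> = (\<Sum>y\<in>s ` {..<n}. \<Sum>k\<in>{k\<in>{..<n}. s k = y}. real_of_int (\<xi> y \<omega>))"
      by (intro sum.cong) auto
    finally show ?thesis by simp
  qed
  have "(CLINT \<omega>|M. iexp (t * real_of_int (\<Sum>k<n. \<xi> (s k) \<omega>))) =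
     (CLINT \<omega>|M. (\<Prod>y\<in>s ` {..<n}. iexp (t * ?N y * real_of_int (\<xi> y \<omega>))))"
    unfolding sum by (simp add: exp_sum[symmetric] sum_distrib_left mult.assoc)
  also have "\<dots> = (\<Prod>y\<in>s ` {..<n}. CLINT \<omega>|M. iexp (t * ?N y * real_of_int (\<xi> y \<omega>)))"
  proof (rule indep_vars_lebesgue_integral[OF _ ind'])
    fix y
    have "(\<lambda>\<omega>. iexp (t * ?N y * real_of_int (\<xi> y \<omega>))) \<in> borel_measurable M"
      by (intro measurable_compose[OF Ym]) auto
    then show "complex_integrable M (\<lambda>\<omega>. iexp (t * ?N y * real_of_int (\<xi> y \<omega>)))"
      by (intro integrable_const_bound[where B=1]) auto
  qed simp
  also have "\<dots> = (\<Prod>y\<in>s ` {..<n}. pmf_char p (t * ?N y))"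
  proof (intro prod.cong refl)
    fix y
    have "measure_pmf p = distr M (count_space UNIV) (\<xi> y)" using Y(2)[OF subset_refl, of 1 y] p by simp
    then show "(CLINT \<omega>|M. iexp (t * ?N y * real_of_int (\<xi> y \<omega>))) = pmf_char p (t * ?N y)"
      by (intro expectation_iexp_law Ym)
  qed
  finally show ?thesis .
qed

lemma measurable_count_space_fun2:
  fixes f :: "'b \<Rightarrow> 'c :: countable"
  assumes f: "f \<in> measurable N (count_space UNIV)" and g: "g \<in> measurable N (count_space UNIV)"
  shows "(\<lambda>x. h (f x) (g x)) \<in> measurable N (count_space UNIV)"
  by (rule measurable_compose_countable[OF measurable_compose[OF g] f]) simp

lemma measurable_sum_int:
  fixes f :: "int \<Rightarrow> 'b \<Rightarrow> int"
  assumes f: "\<And>i. 1 \<le> i \<Longrightarrow> f i \<in> measurable N (count_space UNIV)"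
  shows "(\<lambda>x. \<Sum>i = 1..int j. f i x) \<in> measurable N (count_space UNIV)"
proof (induction j)
  case (Suc j)
  have "{1..int (Suc j)} = insert (int (Suc j)) {1..int j}" by auto
  then have "(\<lambda>x. \<Sum>i = 1..int (Suc j). f i x) = (\<lambda>x. f (int (Suc j)) x + (\<Sum>i = 1..int j. f i x))" by simp
  then show ?case using Suc f by (simp add: measurable_count_space_fun2)
qed simp

lemma measurable_map_upt:
  fixes f :: "nat \<Rightarrow> 'b \<Rightarrow> int"
  assumes f: "\<And>k. f k \<in> measurable N (count_space UNIV)"
  shows "(\<lambda>x. map (\<lambda>k. f k x) [0..<j]) \<in> measurable N (count_space UNIV)"
proof (induction j)
  case (Suc j)
  have "(\<lambda>x. map (\<lambda>k. f k x) [0..<j] @ [f j x]) \<in> measurable N (count_space UNIV)"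
    by (rule measurable_count_space_fun2[OF Suc f])
  then show ?case by simp
qed simp

text \<open>Fubini's theorem for the independent pair of scenery and walk. The walk enters through the list of its first \<open>n\<close>
positions, which takes countably many values; this gives joint measurability of the integrand.\<close>

lemma char_scenery_sum:
  assumes iid\<xi>: "iid_on UNIV \<xi>" and iidX: "iid_on {1..} X"
    and indep: "indep_families UNIV \<xi> {1..} X"
    and p: "measure_pmf p = distr M (count_space UNIV) (X 1)"
    and q: "measure_pmf q = distr M (count_space UNIV) (\<xi> 1)"
  shows "(CLINT \<omega>|M. iexp (t * real_of_int (scenery_sum \<xi> X n \<omega>))) = rwrs_char p (pmf_char q) n t"
proof -
  note YX = iid_onD[OF iidX] and Y\<xi> = iid_onD[OF iid\<xi>]
  let ?U = "\<lambda>\<omega>. \<lambda>i\<in>UNIV. \<xi> i \<omega>" and ?V0 = "\<lambda>\<omega>. \<lambda>j\<in>{1..}. X j \<omega>"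
  let ?PU = "PiM UNIV (\<lambda>_::int. count_space (UNIV :: int set))"
  let ?PV = "PiM {1..} (\<lambda>_::int. count_space (UNIV :: int set))"
  let ?L = "count_space (UNIV :: int list set)"
  define path :: "(int \<Rightarrow> int) \<Rightarrow> int list" where "path g = map (\<lambda>k. \<Sum>i = 1..int k. g i) [0..<n]" for g
  have path_meas: "path \<in> measurable ?PV ?L"
    unfolding path_def[abs_def]
    by (intro measurable_map_upt measurable_sum_int measurable_component_singleton) auto
  have iv: "indep_var ?PU ?U ?PV ?V0" using indep by (simp add: indep_families_def)
  then have U: "?U \<in> measurable M ?PU" and V0: "?V0 \<in> measurable M ?PV"
    and joint: "distr M ?PU ?U \<Otimes>\<^sub>M distr M ?PV ?V0 = distr M (?PU \<Otimes>\<^sub>M ?PV) (\<lambda>\<omega>. (?U \<omega>, ?V0 \<omega>))"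
    unfolding indep_var_distribution_eq by auto
  define V where "V \<omega> = path (?V0 \<omega>)" for \<omega>
  have V_nth: "V \<omega> ! k = walk X (int k) \<omega>" if "k < n" for \<omega> k
    using that by (auto simp: path_def V_def walk_def intro!: sum.cong)
  interpret dU: prob_space "distr M ?PU ?U" by (rule prob_space_distr[OF U])
  interpret dV: prob_space "distr M ?PV ?V0" by (rule prob_space_distr[OF V0])
  interpret P: pair_prob_space "distr M ?PU ?U" "distr M ?PV ?V0" ..
  define f :: "(int \<Rightarrow> int) \<Rightarrow> int list \<Rightarrow> complex" where "f u s = iexp (t * real_of_int (\<Sum>k<n. u (s ! k)))" for u s
  have fu: "(\<lambda>u. f u s) \<in> borel_measurable ?PU" for s
  proof -
    have "(\<lambda>u. real_of_int (u i)) \<in> borel_measurable ?PU" for i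
      by (rule measurable_compose[OF measurable_component_singleton]) auto
    then have "(\<lambda>u. \<Sum>k<n. real_of_int (u (s ! k))) \<in> borel_measurable ?PU"
      by (intro borel_measurable_sum) auto
    then have "(\<lambda>u. iexp (t * (\<Sum>k<n. real_of_int (u (s ! k))))) \<in> borel_measurable ?PU"
      by measurable
    then show ?thesis by (simp add: f_def)
  qed
  have fL: "case_prod f \<in> borel_measurable (?PU \<Otimes>\<^sub>M ?L)"
    unfolding case_prod_unfold
    by (rule measurable_compose_countable[OF measurable_compose[OF measurable_fst fu] measurable_snd])
  have "(\<lambda>z. (fst z, path (snd z))) \<in> measurable (?PU \<Otimes>\<^sub>M ?PV) (?PU \<Otimes>\<^sub>M ?L)"
    by (intro measurable_Pair measurable_fst measurable_compose[OF measurable_snd path_meas])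
  from measurable_compose[OF this fL]
  have fm: "(\<lambda>(u, v). f u (path v)) \<in> borel_measurable (?PU \<Otimes>\<^sub>M ?PV)"
    by (simp add: case_prod_unfold)
  have sets_eq: "sets (distr M ?PU ?U \<Otimes>\<^sub>M distr M ?PV ?V0) = sets (?PU \<Otimes>\<^sub>M ?PV)"
    by (intro sets_pair_measure_cong sets_distr)
  have f_int: "integrable (distr M ?PU ?U \<Otimes>\<^sub>M distr M ?PV ?V0) (\<lambda>(u, v). f u (path v))"
  proof (rule P.integrable_const_bound[where B=1])
    show "(\<lambda>(u, v). f u (path v)) \<in> borel_measurable (distr M ?PU ?U \<Otimes>\<^sub>M distr M ?PV ?V0)"
      unfolding measurable_cong_sets[OF sets_eq refl] by (rule fm)
  qed (auto simp: f_def)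
  define G where "G s = (\<Prod>y\<in>(!) s ` {..<n}. pmf_char q (t * real (card {k. k < n \<and> s ! k = y})))" for s :: "int list"
  have inner: "(CLINT u|distr M ?PU ?U. f u s) = G s" for s
  proof -
    have "(CLINT u|distr M ?PU ?U. f u s) = (CLINT \<omega>|M. f (?U \<omega>) s)"
      using U fu by (rule integral_distr)
    also have "\<dots> = (CLINT \<omega>|M. iexp (t * real_of_int (\<Sum>k<n. \<xi> (s ! k) \<omega>)))"
      by (simp add: f_def)
    also have "\<dots> = G s" unfolding G_def by (rule expectation_iexp_scenery_along[OF iid\<xi> q])
    finally show ?thesis .
  qed
  have "(CLINT \<omega>|M. iexp (t * real_of_int (scenery_sum \<xi> X n \<omega>))) = (CLINT \<omega>|M. (\<lambda>(u, v). f u (path v)) (?U \<omega>, ?V0 \<omega>))"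
    using V_nth by (simp add: f_def V_def[symmetric] scenery_sum_def)
  also have "\<dots> = (CLINT z|distr M (?PU \<Otimes>\<^sub>M ?PV) (\<lambda>\<omega>. (?U \<omega>, ?V0 \<omega>)). (\<lambda>(u, v). f u (path v)) z)"
    using U V0 fm by (intro integral_distr[symmetric] measurable_Pair) auto
  also have "\<dots> = (CLINT v|distr M ?PV ?V0. CLINT u|distr M ?PU ?U. f u (path v))"
    unfolding joint[symmetric] using P.integral_snd[OF f_int] by simp
  also have "\<dots> = (CLINT v|distr M ?PV ?V0. G (path v))"
    unfolding inner ..
  also have "\<dots> = (CLINT \<omega>|M. G (V \<omega>))"
    unfolding V_def using V0 measurable_compose[OF path_meas, of G borel] by (rule integral_distr) simp
  also have "\<dots> = (CLINT \<omega>|M. (\<lambda>x. \<Prod>y\<in>position x ` {..<n}. pmf_char q (t * real (visits n x y)))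
      (\<lambda>i. if i \<in> {..<n} then X (1 + int i) \<omega> else 0))"
  proof (intro Bochner_Integration.integral_cong refl)
    fix \<omega>
    let ?x = "\<lambda>i. if i < n then X (1 + int i) \<omega> else 0"
    have nth: "V \<omega> ! k = position ?x k" if "k < n" for k
      using that walk_eq_position[OF that] V_nth by simp
    have "(!) (V \<omega>) ` {..<n} = position ?x ` {..<n}" using nth by auto
    moreover have "{k. k < n \<and> V \<omega> ! k = y} = {k. k < n \<and> position ?x k = y}" for y using nth by auto
    ultimately show "G (V \<omega>) = (\<lambda>x. \<Prod>y\<in>position x ` {..<n}. pmf_char q (t * real (visits n x y)))
      (\<lambda>i. if i \<in> {..<n} then X (1 + int i) \<omega> else 0)"
      by (simp add: G_def visits_def)
  qed
  also have "\<dots> = rwrs_char p (pmf_char q) n t"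
    unfolding rwrs_char_def steps_def
  proof (rule integral_iid_vector)
    show "inj_on (\<lambda>i. 1 + int i) {..<n}" by (auto simp: inj_on_def)
    show "indep_vars (\<lambda>_. count_space UNIV) X ((\<lambda>i. 1 + int i) ` {..<n})" by (rule YX(1)) auto
    show "distr M (count_space UNIV) (X (1 + int i)) = measure_pmf p" for i
      using YX(2)[OF subset_refl, of "1 + int i" 1] p by simp
  qed simp
  finally show ?thesis .
qed

end

section \<open>The total time at the origin\<close>

context prob_space begin

text \<open>A product formula over finitely many indices of both kinds splits at the independent pair of families.\<close>

lemma indep_vars_case_sum:
  assumes Y1: "indep_vars (\<lambda>_. count_space UNIV) Y1 I1" and Y2: "indep_vars (\<lambda>_. count_space UNIV) Y2 I2"
    and ind: "indep_var (PiM I1 (\<lambda>_. count_space UNIV)) (\<lambda>\<omega>. \<lambda>i\<in>I1. Y1 i \<omega>)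
                        (PiM I2 (\<lambda>_. count_space UNIV)) (\<lambda>\<omega>. \<lambda>i\<in>I2. Y2 i \<omega>)"
  shows "indep_vars (\<lambda>_. count_space UNIV) (case_sum Y1 Y2) (Inl ` I1 \<union> Inr ` I2)"
proof -
  have m1: "\<And>i. i \<in> I1 \<Longrightarrow> Y1 i \<in> measurable M (count_space UNIV)"
    using Y1 unfolding indep_vars_def2 by blast
  have m2: "\<And>i. i \<in> I2 \<Longrightarrow> Y2 i \<in> measurable M (count_space UNIV)"
    using Y2 unfolding indep_vars_def2 by blast
  show ?thesis
    unfolding indep_vars_def2
  proof (intro conjI ballI)
    fix i assume "i \<in> Inl ` I1 \<union> Inr ` I2"
    then show "case_sum Y1 Y2 i \<in> measurable M (count_space UNIV)" using m1 m2 by auto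
  next
    show "indep_sets (\<lambda>i. {case_sum Y1 Y2 i -` A \<inter> space M |A. A \<in> sets (count_space UNIV)}) (Inl ` I1 \<union> Inr ` I2)"
      unfolding indep_sets_def
    proof (intro conjI ballI allI impI)
      fix i assume "i \<in> Inl ` I1 \<union> Inr ` I2"
      then show "{case_sum Y1 Y2 i -` A \<inter> space M |A. A \<in> sets (count_space UNIV)} \<subseteq> events"
        using m1 m2 by (auto intro: measurable_sets)
    next
      fix J A assume J: "J \<subseteq> Inl ` I1 \<union> Inr ` I2" "J \<noteq> {}" "finite J"
        and A: "A \<in> (\<Pi> i\<in>J. {case_sum Y1 Y2 i -` A \<inter> space M |A. A \<in> sets (count_space UNIV)})"
      then have "\<forall>j\<in>J. \<exists>B. A j = case_sum Y1 Y2 j -` B \<inter> space M" by (auto simp: Pi_iff)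
      then obtain B where B: "\<And>j. j \<in> J \<Longrightarrow> A j = case_sum Y1 Y2 j -` B j \<inter> space M" by metis
      define J1 where "J1 = {i. Inl i \<in> J}"
      define J2 where "J2 = {i. Inr i \<in> J}"
      have J12: "J1 \<subseteq> I1" "J2 \<subseteq> I2" using J by (auto simp: J1_def J2_def)
      have "J1 = Inl -` J" "J2 = Inr -` J" by (auto simp: J1_def J2_def)
      then have fin: "finite J1" "finite J2" using J by (auto intro!: finite_vimageI)
      have Jeq: "J = Inl ` J1 \<union> Inr ` J2" using J by (auto simp: J1_def J2_def)
      define C1 where "C1 = {g \<in> space (PiM I1 (\<lambda>_. count_space UNIV)). \<forall>i\<in>J1. g i \<in> B (Inl i)}"
      define C2 where "C2 = {g \<in> space (PiM I2 (\<lambda>_. count_space UNIV)). \<forall>i\<in>J2. g i \<in> B (Inr i)}"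
      have C1: "C1 \<in> sets (PiM I1 (\<lambda>_. count_space UNIV))" unfolding C1_def
        using fin J12 by (intro sets.sets_Collect_finite_All measurable_sets_Collect[OF measurable_component_singleton]) auto
      have C2: "C2 \<in> sets (PiM I2 (\<lambda>_. count_space UNIV))" unfolding C2_def
        using fin J12 by (intro sets.sets_Collect_finite_All measurable_sets_Collect[OF measurable_component_singleton]) auto
      let ?V1 = "\<lambda>\<omega>. \<lambda>i\<in>I1. Y1 i \<omega>" and ?V2 = "\<lambda>\<omega>. \<lambda>i\<in>I2. Y2 i \<omega>"
      have p1: "prob {\<omega>\<in>space M. \<forall>i\<in>J1. Y1 i \<omega> \<in> B (Inl i)} = (\<Prod>i\<in>J1. prob (A (Inl i)))"
      proof (cases "J1 = {}")
        case False
        have "{\<omega>\<in>space M. \<forall>i\<in>J1. Y1 i \<omega> \<in> B (Inl i)} = (\<Inter>i\<in>J1. Y1 i -` B (Inl i) \<inter> space M)"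
          using False by auto
        also have "prob \<dots> = (\<Prod>i\<in>J1. prob (Y1 i -` B (Inl i) \<inter> space M))"
          by (rule indep_varsD[OF Y1 False fin(1) J12(1)]) simp
        also have "\<dots> = (\<Prod>i\<in>J1. prob (A (Inl i)))"
          by (intro prod.cong refl) (simp add: B J1_def)
        finally show ?thesis .
      qed (simp add: prob_space)
      have p2: "prob {\<omega>\<in>space M. \<forall>i\<in>J2. Y2 i \<omega> \<in> B (Inr i)} = (\<Prod>i\<in>J2. prob (A (Inr i)))"
      proof (cases "J2 = {}")
        case False
        have "{\<omega>\<in>space M. \<forall>i\<in>J2. Y2 i \<omega> \<in> B (Inr i)} = (\<Inter>i\<in>J2. Y2 i -` B (Inr i) \<inter> space M)"
          using False by auto
        also have "prob \<dots> = (\<Prod>i\<in>J2. prob (Y2 i -` B (Inr i) \<inter> space M))"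
          by (rule indep_varsD[OF Y2 False fin(2) J12(2)]) simp
        also have "\<dots> = (\<Prod>i\<in>J2. prob (A (Inr i)))"
          by (intro prod.cong refl) (simp add: B J2_def)
        finally show ?thesis .
      qed (simp add: prob_space)
      have V1: "?V1 -` C1 \<inter> space M = {\<omega>\<in>space M. \<forall>i\<in>J1. Y1 i \<omega> \<in> B (Inl i)}"
        using J12 by (auto simp: C1_def space_PiM)
      have V2: "?V2 -` C2 \<inter> space M = {\<omega>\<in>space M. \<forall>i\<in>J2. Y2 i \<omega> \<in> B (Inr i)}"
        using J12 by (auto simp: C2_def space_PiM)
      have "(\<Inter>j\<in>J. A j) = (\<Inter>j\<in>J. case_sum Y1 Y2 j -` B j \<inter> space M)" using B by simp
      also have "\<dots> = {\<omega>\<in>space M. \<forall>j\<in>J. case_sum Y1 Y2 j \<omega> \<in> B j}" using J(2) by auto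
      also have "\<dots> = (?V1 -` C1 \<inter> space M) \<inter> (?V2 -` C2 \<inter> space M)"
        unfolding V1 V2 Jeq ball_Un by auto
      also have "\<dots> = (\<lambda>\<omega>. (?V1 \<omega>, ?V2 \<omega>)) -` (C1 \<times> C2) \<inter> space M" by auto
      also have "prob \<dots> = prob (?V1 -` C1 \<inter> space M) * prob (?V2 -` C2 \<inter> space M)"
        by (rule indep_varD[OF ind C1 C2])
      also note V1
      also note V2
      also have "prob {\<omega>\<in>space M. \<forall>i\<in>J1. Y1 i \<omega> \<in> B (Inl i)} * prob {\<omega>\<in>space M. \<forall>i\<in>J2. Y2 i \<omega> \<in> B (Inr i)} = (\<Prod>j\<in>J. prob (A j))"
        unfolding p1 p2 Jeq using fin by (subst prod.union_disjoint) (auto simp: prod.reindex)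
      finally show "prob (\<Inter>j\<in>J. A j) = (\<Prod>j\<in>J. prob (A j))" .
    qed
  qed
qed

text \<open>Equality of the laws of the two sequences transfers identical marginals and the product form of the joint law.\<close>

lemma indep_copy_iid:
  assumes iid: "iid_on {1..} X" and copy: "indep_copy {1..} X' X" and i: "1 \<le> i"
  shows "X' i \<in> measurable M (count_space UNIV)"
    and "distr M (count_space UNIV) (X' i) = distr M (count_space UNIV) (X i)"
    and "indep_vars (\<lambda>_. count_space UNIV) X' {1..}"
proof -
  let ?P = "PiM {1..} (\<lambda>_::int. count_space (UNIV :: int set))"
  let ?V' = "\<lambda>\<omega>. \<lambda>i\<in>{1..}. X' i \<omega>" and ?V = "\<lambda>\<omega>. \<lambda>i\<in>{1..}. X i \<omega>"
  have iv: "indep_var ?P ?V' ?P ?V" and eq: "distr M ?P ?V' = distr M ?P ?V"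
    using copy by (auto simp: indep_copy_def indep_families_def)
  have V': "?V' \<in> measurable M ?P" and V: "?V \<in> measurable M ?P"
    using iv unfolding indep_var_distribution_eq by auto
  have comp: "(\<lambda>g. g j) \<in> measurable ?P (count_space UNIV)" if "1 \<le> j" for j
    using that by (intro measurable_component_singleton) auto
  have X': "X' j \<in> measurable M (count_space UNIV)" if "1 \<le> j" for j
    using measurable_compose[OF V' comp[OF that]] that by simp
  have law: "distr M (count_space UNIV) (X' j) = distr M (count_space UNIV) (X j)" if "1 \<le> j" for j
  proof -
    have "distr M (count_space UNIV) (X' j) = distr (distr M ?P ?V') (count_space UNIV) (\<lambda>g. g j)"
      using that by (subst distr_distr[OF comp[OF that] V']) (simp add: o_def)
    also have "\<dots> = distr M (count_space UNIV) (X j)"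
      unfolding eq using that by (subst distr_distr[OF comp[OF that] V]) (simp add: o_def)
    finally show ?thesis .
  qed
  show "X' i \<in> measurable M (count_space UNIV)" by (rule X'[OF i])
  show "distr M (count_space UNIV) (X' i) = distr M (count_space UNIV) (X i)" by (rule law[OF i])
  have "distr M ?P ?V = PiM {1..} (\<lambda>i. distr M (count_space UNIV) (X i))"
    using iid_onD(1,3)[OF iid subset_refl] by (subst indep_vars_iff_distr_eq_PiM'[symmetric]) auto
  also have "\<dots> = PiM {1..} (\<lambda>i. distr M (count_space UNIV) (X' i))"
    by (intro PiM_cong refl law[symmetric]) auto
  finally have "distr M ?P ?V' = PiM {1..} (\<lambda>i. distr M (count_space UNIV) (X' i))"
    unfolding eq .
  then show "indep_vars (\<lambda>_. count_space UNIV) X' {1..}"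
    using X' by (subst indep_vars_iff_distr_eq_PiM') auto
qed

definition window_time :: "(int \<Rightarrow> 'a \<Rightarrow> int) \<Rightarrow> nat \<Rightarrow> 'a \<Rightarrow> nat" where
  "window_time X m \<omega> = card {j. - int m \<le> j \<and> j \<le> int m \<and> walk X j \<omega> = 0}"

text \<open>The increments around a time \<open>m\<close> of a one-sided walk are, up to order, the increments on both sides of the origin
of the two-sided walk. Hence the two window counts have the same law.\<close>

lemma window_time_law:
  assumes iid: "iid_on {1..} X" and copy: "indep_copy {1..} (\<lambda>k. X (- k)) X"
    and p: "measure_pmf p = distr M (count_space UNIV) (X 1)"
  shows "window_time X m \<in> measurable M (count_space UNIV)"
    and "(\<integral>\<omega>. real (window_time X m \<omega>) powr \<gamma> \<partial>M) = window_mean p \<gamma> m"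
proof -
  note X' = indep_copy_iid[OF iid copy]
  note X = iid_onD[OF iid subset_refl]
  define Y where "Y = case_sum (\<lambda>k. X (- k)) X"
  \<comment> \<open>The increment number \<open>i < m\<close> is the step \<open>X (i - m)\<close> of the left half; the later ones are \<open>X (i - m + 1)\<close>,
    as there is no step with index \<open>0\<close>.\<close>
  define h :: "nat \<Rightarrow> int + int" where "h i = (if i < m then Inl (int m - int i) else Inr (int i - int m + 1))" for i
  have inj: "inj_on h {..<2 * m}" by (auto simp: inj_on_def h_def split: if_splits)
  have sub: "h ` {..<2 * m} \<subseteq> Inl ` {1..} \<union> Inr ` {1..}" by (auto simp: h_def)
  have "indep_vars (\<lambda>_. count_space UNIV) Y (Inl ` {1..} \<union> Inr ` {1..})"
    unfolding Y_def using X'(3)[OF order_refl] X(1) copy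
    by (intro indep_vars_case_sum) (auto simp: indep_copy_def indep_families_def)
  then have ind: "indep_vars (\<lambda>_. count_space UNIV) Y (h ` {..<2 * m})"
    by (rule indep_vars_subset) (rule sub)
  have law: "distr M (count_space UNIV) (Y (h i)) = measure_pmf p" if "i \<in> {..<2 * m}" for i
  proof (cases "i < m")
    case True
    then have "distr M (count_space UNIV) (Y (h i)) = distr M (count_space UNIV) (X (int m - int i))"
      using X'(2)[of "int m - int i"] by (simp add: Y_def h_def)
    also have "\<dots> = measure_pmf p" using True X(2)[of "int m - int i" 1] p by simp
    finally show ?thesis .
  next
    case False
    then show ?thesis using X(2)[of "int i - int m + 1" 1] p by (simp add: Y_def h_def)
  qed
  define x where "x \<omega> = (\<lambda>i. if i \<in> {..<2 * m} then Y (h i) \<omega> else 0)" for \<omega>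
  have position_right: "position (x \<omega>) (m + j) - position (x \<omega>) m = walk X (int j) \<omega>" if "j \<le> m" for j \<omega>
  proof -
    have "position (x \<omega>) (m + j) - position (x \<omega>) m = increment (x \<omega>) m (m + j)"
      using position_split[of m "m + j" "x \<omega>"] by simp
    also have "\<dots> = (\<Sum>i = 1..int j. X i \<omega>)" unfolding increment_def
      using that by (intro sum.reindex_bij_witness[of _ "\<lambda>i. nat (i + int m - 1)" "\<lambda>i. int i - int m + 1"]) (auto simp: x_def Y_def h_def)
    finally show ?thesis by (simp add: walk_def)
  qed
  have position_left: "position (x \<omega>) (m - j) - position (x \<omega>) m = walk X (- int j) \<omega>" if "j \<le> m" for j \<omega>
  proof -
    have "position (x \<omega>) m - position (x \<omega>) (m - j) = increment (x \<omega>) (m - j) m"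
      using position_split[of "m - j" m "x \<omega>"] by simp
    also have "\<dots> = (\<Sum>i = 1..int j. X (- i) \<omega>)" unfolding increment_def
      using that by (intro sum.reindex_bij_witness[of _ "\<lambda>i. nat (int m - i)" "\<lambda>i. int m - int i"]) (auto simp: x_def Y_def h_def)
    finally show ?thesis by (cases "j = 0") (auto simp: walk_def)
  qed
  have position_eq: "position (x \<omega>) i = position (x \<omega>) m \<longleftrightarrow> walk X (int i - int m) \<omega> = 0" if "i \<le> 2 * m" for i \<omega>
  proof (cases "i \<le> m")
    case True
    then have "m - (m - i) = i" "- int (m - i) = int i - int m" by auto
    then show ?thesis using position_left[of "m - i" \<omega>] by auto
  next
    case False
    then have "m + (i - m) = i" "int (i - m) = int i - int m" "i - m \<le> m" using that by auto
    then show ?thesis using position_right[of "i - m" \<omega>] by auto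
  qed
  have W: "window_time X m \<omega> = window_count (2 * m + 1) m (x \<omega>) m" for \<omega>
  proof -
    let ?W = "{j. j < 2 * m + 1 \<and> j \<le> m + m \<and> m \<le> j + m \<and> position (x \<omega>) j = position (x \<omega>) m}"
    have "{j. - int m \<le> j \<and> j \<le> int m \<and> walk X j \<omega> = 0} = (\<lambda>i. int i - int m) ` ?W"
    proof (intro subset_antisym subsetI)
      fix j assume "j \<in> {j. - int m \<le> j \<and> j \<le> int m \<and> walk X j \<omega> = 0}"
      then have j: "- int m \<le> j" "j \<le> int m" "walk X j \<omega> = 0" by auto
      define i where "i = nat (j + int m)"
      have i: "i \<le> 2 * m" "j = int i - int m" using j by (auto simp: i_def)
      then have "i \<in> ?W" using position_eq[OF i(1)] j(3) by simp
      then show "j \<in> (\<lambda>i. int i - int m) ` ?W" using i(2) by blast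
    next
      fix j assume "j \<in> (\<lambda>i. int i - int m) ` ?W"
      then obtain i where i: "i \<le> 2 * m" "position (x \<omega>) i = position (x \<omega>) m" "j = int i - int m" by auto
      then show "j \<in> {j. - int m \<le> j \<and> j \<le> int m \<and> walk X j \<omega> = 0}" using position_eq[OF i(1)] by simp
    qed
    moreover have "inj_on (\<lambda>i. int i - int m) ?W" by (auto simp: inj_on_def)
    ultimately show ?thesis unfolding window_time_def window_count_def by (simp add: card_image)
  qed
  note vec = distr_iid_vector[OF _ inj ind law]
  show "window_time X m \<in> measurable M (count_space UNIV)"
    unfolding W[abs_def] x_def[abs_def] by (rule measurable_compose[OF vec(1)]) simp_all
  have "(\<integral>\<omega>. real (window_time X m \<omega>) powr \<gamma> \<partial>M) = (\<integral>\<omega>. (\<lambda>x. real (window_count (2 * m + 1) m x m) powr \<gamma>) (x \<omega>) \<partial>M)"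
    unfolding W ..
  also have "\<dots> = window_mean p \<gamma> m" unfolding window_mean_def steps_def
    unfolding x_def by (rule integral_iid_vector[OF _ inj ind law]) auto
  finally show "(\<integral>\<omega>. real (window_time X m \<omega>) powr \<gamma> \<partial>M) = window_mean p \<gamma> m" .
qed

lemma window_time_mono: "m \<le> m' \<Longrightarrow> window_time X m \<omega> \<le> window_time X m' \<omega>"
  unfolding window_time_def
  by (intro card_mono) (auto intro: finite_subset[of _ "{- int m'..int m'}"])

lemma window_time_ge_1: "1 \<le> window_time X m \<omega>"
proof -
  have "{0} \<subseteq> {j. - int m \<le> j \<and> j \<le> int m \<and> walk X j \<omega> = 0}" by (auto simp: walk_def)
  then have "card {0::int} \<le> window_time X m \<omega>" unfolding window_time_def
    by (intro card_mono) (auto intro: finite_subset[of _ "{- int m..int m}"])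
  then show ?thesis by simp
qed

lemma window_time_le: "window_time X m \<omega> \<le> 2 * m + 1"
proof -
  have "window_time X m \<omega> \<le> card {- int m..int m}" unfolding window_time_def by (intro card_mono) auto
  then show ?thesis by simp
qed

lemma window_time_eventually_total:
  assumes "finite {k. walk X k \<omega> = 0}"
  shows "eventually (\<lambda>m. window_time X m \<omega> = total_time_at_0 X \<omega>) sequentially"
proof -
  obtain B where B: "\<And>k. walk X k \<omega> = 0 \<Longrightarrow> \<bar>k\<bar> \<le> int B"
  proof -
    define B where "B = nat (Max (insert 0 (abs ` {k. walk X k \<omega> = 0})))"
    have "\<bar>k\<bar> \<le> int B" if "walk X k \<omega> = 0" for k
    proof -
      have "\<bar>k\<bar> \<le> Max (insert 0 (abs ` {k. walk X k \<omega> = 0}))" using assms that by (intro Max_ge) auto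
      also have "\<dots> \<le> int B" by (simp add: B_def)
      finally show ?thesis .
    qed
    then show ?thesis using that by blast
  qed
  show ?thesis using eventually_ge_at_top[of B]
  proof eventually_elim
    case (elim m)
    have "{j. - int m \<le> j \<and> j \<le> int m \<and> walk X j \<omega> = 0} = {k. walk X k \<omega> = 0}"
      using B elim by (force simp: abs_le_iff)
    then show ?case by (simp add: window_time_def total_time_at_0_def)
  qed
qed

text \<open>Expresses finiteness of the set of zeros through countably many variables, for measurability of the total time.\<close>

lemma finite_zeros_iff:
  "finite {k. walk X k \<omega> = 0} \<longleftrightarrow> (\<exists>c. \<forall>m. window_time X m \<omega> \<le> c)"
proof
  assume fin: "finite {k. walk X k \<omega> = 0}"
  have "window_time X m \<omega> \<le> card {k. walk X k \<omega> = 0}" for m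
    unfolding window_time_def using fin by (intro card_mono) auto
  then show "\<exists>c. \<forall>m. window_time X m \<omega> \<le> c" by blast
next
  assume "\<exists>c. \<forall>m. window_time X m \<omega> \<le> c"
  then obtain c where c: "\<And>m. window_time X m \<omega> \<le> c" by blast
  show "finite {k. walk X k \<omega> = 0}"
  proof (rule ccontr)
    assume "infinite {k. walk X k \<omega> = 0}"
    then obtain F where F: "F \<subseteq> {k. walk X k \<omega> = 0}" "finite F" "card F = Suc c"
      using infinite_arbitrarily_large by blast
    define m where "m = nat (Max (insert 0 (abs ` F)))"
    have "F \<subseteq> {j. - int m \<le> j \<and> j \<le> int m \<and> walk X j \<omega> = 0}"
    proof
      fix k assume k: "k \<in> F"
      have "\<bar>k\<bar> \<le> Max (insert 0 (abs ` F))" using F k by (intro Max_ge) auto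
      also have "\<dots> \<le> int m" by (simp add: m_def)
      finally have "\<bar>k\<bar> \<le> int m" .
      then show "k \<in> {j. - int m \<le> j \<and> j \<le> int m \<and> walk X j \<omega> = 0}" using F(1) k by auto
    qed
    then have "card F \<le> window_time X m \<omega>" unfolding window_time_def
      by (intro card_mono) (auto intro: finite_subset[of _ "{- int m..int m}"])
    then show False using c[of m] F(3) by simp
  qed
qed

text \<open>The time spent at the origin in windows of growing radius has bounded mean, so the total time is integrable.
It dominates the powers of the window times, since these are at least \<open>1\<close> and the exponent is at most \<open>1\<close>.\<close>

lemma window_mean_tendsto_total_time:
  assumes iid: "iid_on {1..} X" and copy: "indep_copy {1..} (\<lambda>k. X (- k)) X"
    and p: "measure_pmf p = distr M (count_space UNIV) (X 1)"
    and cw: "concentrated_walk p \<rho>" and \<gamma>: "\<gamma> \<le> 1"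
  defines "v \<equiv> (\<integral>\<omega>. real (total_time_at_0 X \<omega>) powr \<gamma> \<partial>M)"
  shows "window_mean p \<gamma> \<longlonglongrightarrow> v" and "0 < v"
proof -
  interpret W: concentrated_walk p \<rho> by (fact cw)
  let ?N = "\<lambda>m \<omega>. real (window_time X m \<omega>)"
  note law = window_time_law[OF iid copy p]
  have Nm[measurable]: "?N m \<in> borel_measurable M" for m
    by (rule measurable_compose[OF law(1)]) simp
  define C where "C = 1 + 2 * W.return_tail 0"
  have EN: "(\<integral>\<omega>. ?N m \<omega> \<partial>M) \<le> C" for m
  proof -
    have "(\<integral>\<omega>. ?N m \<omega> \<partial>M) = window_mean p 1 m"
      using law(2)[of m 1] window_time_ge_1[of X m] by simp
    also have "\<dots> = measure_pmf.expectation (steps p (2 * m + 1)) (\<lambda>x. real (window_count (2 * m + 1) m x m) powr 1)"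
      by (rule expectation_window_count[symmetric]) auto
    also have "\<dots> \<le> measure_pmf.expectation (steps p (2 * m + 1)) (\<lambda>x. real (visit_count (2 * m + 1) x m))"
    proof (rule integral_mono)
      show "integrable (steps p (2 * m + 1)) (\<lambda>x. real (window_count (2 * m + 1) m x m) powr 1)"
        by (rule integrable_pmf_bounded[where C="real (2 * m + 1)"]) (use window_count_le in \<open>simp del: of_nat_Suc of_nat_add\<close>)
      show "integrable (steps p (2 * m + 1)) (\<lambda>x. real (visit_count (2 * m + 1) x m))"
        by (rule W.integrable_visit_count_fun)
      show "real (window_count (2 * m + 1) m x m) powr 1 \<le> real (visit_count (2 * m + 1) x m)" for x
        unfolding window_count_def visit_count_def by (auto intro!: card_mono)
    qed
    also have "\<dots> \<le> C" unfolding C_def by (rule W.expectation_visit_count_le) simp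
    finally show ?thesis .
  qed
  have iN: "integrable M (?N m)" for m
    using window_time_le[of X m] by (intro integrable_const_bound[where B="real (2 * m + 1)"]) (auto simp del: of_nat_Suc of_nat_add)
  have mono: "?N m \<omega> \<le> ?N m' \<omega>" if "m \<le> m'" for m m' \<omega> using window_time_mono[OF that] by simp
  have "AE \<omega> in M. (SUP m. ennreal (?N m \<omega>)) \<noteq> \<infinity>"
  proof (rule nn_integral_noteq_infinite)
    have "(\<integral>\<^sup>+\<omega>. (SUP m. ennreal (?N m \<omega>)) \<partial>M) = (SUP m. \<integral>\<^sup>+\<omega>. ennreal (?N m \<omega>) \<partial>M)"
      using mono by (intro nn_integral_monotone_convergence_SUP) (auto simp: incseq_def le_fun_def intro!: ennreal_leI)
    also have "\<dots> \<le> ennreal C"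
      using EN iN by (intro SUP_least) (auto simp: nn_integral_eq_integral intro!: ennreal_leI)
    finally show "(\<integral>\<^sup>+\<omega>. (SUP m. ennreal (?N m \<omega>)) \<partial>M) \<noteq> \<infinity>" by (auto simp: top_unique)
  qed simp
  then have fin: "AE \<omega> in M. finite {k. walk X k \<omega> = 0}"
  proof eventually_elim
    case (elim \<omega>)
    then obtain c where c: "(SUP m. ennreal (?N m \<omega>)) = ennreal c" "0 \<le> c" by (metis ennreal_cases infinity_ennreal_def)
    have "window_time X m \<omega> \<le> nat \<lceil>c\<rceil>" for m
    proof -
      have "ennreal (?N m \<omega>) \<le> ennreal c" unfolding c(1)[symmetric] by (rule SUP_upper) simp
      then have "?N m \<omega> \<le> c" using c(2) by simp
      then show ?thesis by linarith
    qed
    then show ?case unfolding finite_zeros_iff by blast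
  qed
  let ?T = "\<lambda>\<omega>. real (total_time_at_0 X \<omega>)"
  have lim: "(\<lambda>m. ?N m \<omega>) \<longlonglongrightarrow> ?T \<omega>" if "finite {k. walk X k \<omega> = 0}" for \<omega>
    using window_time_eventually_total[OF that] by (intro tendsto_eventually) (auto elim: eventually_mono)
  have Tm[measurable]: "?T \<in> borel_measurable M"
  proof -
    have "?T = (\<lambda>\<omega>. if \<exists>c::nat. \<forall>m. ?N m \<omega> \<le> real c then lim (\<lambda>m. ?N m \<omega>) else 0)"
    proof
      fix \<omega>
      show "?T \<omega> = (if \<exists>c::nat. \<forall>m. ?N m \<omega> \<le> real c then lim (\<lambda>m. ?N m \<omega>) else 0)"
      proof (cases "finite {k. walk X k \<omega> = 0}")
        case True
        then show ?thesis using finite_zeros_iff[of X \<omega>] limI[OF lim[OF True]] by simp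
      next
        case False
        then have "\<not> (\<exists>c::nat. \<forall>m. ?N m \<omega> \<le> real c)" using finite_zeros_iff[of X \<omega>] by simp
        then show ?thesis using False by (simp only: if_False) (simp add: total_time_at_0_def)
      qed
    qed
    moreover have "(\<lambda>\<omega>. if \<exists>c::nat. \<forall>m. ?N m \<omega> \<le> real c then lim (\<lambda>m. ?N m \<omega>) else 0) \<in> borel_measurable M"
      by measurable
    ultimately show ?thesis by simp
  qed
  have conv: "AE \<omega> in M. (\<lambda>m. ?N m \<omega>) \<longlonglongrightarrow> ?T \<omega>" using fin by eventually_elim (rule lim)
  have "incseq (\<lambda>m. \<integral>\<omega>. ?N m \<omega> \<partial>M)"
    unfolding incseq_def using iN mono by (auto intro!: integral_mono)
  then obtain l where l: "(\<lambda>m. \<integral>\<omega>. ?N m \<omega> \<partial>M) \<longlonglongrightarrow> l"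
    using incseq_convergent[of "\<lambda>m. \<integral>\<omega>. ?N m \<omega> \<partial>M" C] EN by blast
  have iT: "integrable M ?T"
    by (rule integrable_monotone_convergence[OF iN _ conv l]) (use mono in \<open>auto simp: incseq_def mono_def\<close>)
  have conv\<gamma>: "AE \<omega> in M. (\<lambda>m. ?N m \<omega> powr \<gamma>) \<longlonglongrightarrow> ?T \<omega> powr \<gamma>"
    using fin
  proof eventually_elim
    case (elim \<omega>)
    show ?case using window_time_eventually_total[OF elim]
      by (intro tendsto_eventually) (auto elim: eventually_mono)
  qed
  have T_ge: "AE \<omega> in M. \<forall>m. ?N m \<omega> \<le> ?T \<omega>"
    using fin
  proof eventually_elim
    case (elim \<omega>)
    then show ?case unfolding window_time_def total_time_at_0_def by (auto intro!: card_mono)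
  qed
  have bound: "AE \<omega> in M. norm (?N m \<omega> powr \<gamma>) \<le> ?T \<omega>" for m
    using T_ge
  proof eventually_elim
    case (elim \<omega>)
    have "1 \<le> ?N m \<omega>" using window_time_ge_1[of X m \<omega>] by simp
    then have "?N m \<omega> powr \<gamma> \<le> ?N m \<omega> powr 1" using \<gamma> by (intro powr_mono) auto
    then show ?case using elim \<open>1 \<le> ?N m \<omega>\<close> by (simp add: order_trans)
  qed
  have "(\<lambda>m. \<integral>\<omega>. ?N m \<omega> powr \<gamma> \<partial>M) \<longlonglongrightarrow> v" unfolding v_def
    by (rule integral_dominated_convergence[OF _ _ iT conv\<gamma> bound]) auto
  then show "window_mean p \<gamma> \<longlonglongrightarrow> v" unfolding law(2) .
  have i\<gamma>: "integrable M (\<lambda>\<omega>. ?T \<omega> powr \<gamma>)"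
    by (rule integrable_dominated_convergence[OF _ _ iT conv\<gamma> bound]) auto
  have "v \<noteq> 0"
  proof
    assume "v = 0"
    then have "AE \<omega> in M. ?T \<omega> powr \<gamma> = 0"
      unfolding v_def using i\<gamma> by (subst (asm) integral_nonneg_eq_0_iff_AE) auto
    then have "AE \<omega> in M. False" using T_ge
    proof eventually_elim
      case (elim \<omega>)
      then have "1 \<le> ?T \<omega>" using window_time_ge_1[of X 0 \<omega>] by (metis of_nat_1 of_nat_le_iff order_trans)
      then show False using elim by simp
    qed
    then show False by simp
  qed
  moreover have "0 \<le> v" unfolding v_def by (intro integral_nonneg_AE) auto
  ultimately show "0 < v" by simp
qed

end

section \<open>The local limit estimate\<close>

lemma bound_on_compact_of_bound_near_0:
  fixes \<phi> :: "real \<Rightarrow> complex"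
  assumes c: "0 < c" and \<delta>: "0 < \<delta>" and R: "0 < R" and \<beta>: "0 < \<beta>"
    and near: "\<And>t. \<bar>t\<bar> \<le> \<delta> \<Longrightarrow> cmod (\<phi> t) \<le> exp (- c * \<bar>t\<bar> powr \<beta>)"
    and cont: "\<And>t. isCont \<phi> t" and less: "\<And>t. t \<noteq> 0 \<Longrightarrow> \<bar>t\<bar> \<le> R \<Longrightarrow> cmod (\<phi> t) < 1"
  shows "\<exists>\<sigma>>0. \<forall>t. \<bar>t\<bar> \<le> R \<longrightarrow> cmod (\<phi> t) \<le> exp (- \<sigma> * \<bar>t\<bar> powr \<beta>)"
proof -
  define h where "h = min \<delta> R"
  have h: "0 < h" "h \<le> \<delta>" "h \<le> R" using \<delta> R by (auto simp: h_def)
  define K where "K = {-R..-h} \<union> {h..R}"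
  have "compact K" unfolding K_def by (intro compact_Un compact_Icc)
  moreover have "K \<noteq> {}" using h by (auto simp: K_def)
  moreover have "continuous_on K (\<lambda>u. cmod (\<phi> u))"
    by (intro continuous_intros continuous_at_imp_continuous_on ballI cont)
  ultimately obtain u0 where u0: "u0 \<in> K" "\<And>u. u \<in> K \<Longrightarrow> cmod (\<phi> u) \<le> cmod (\<phi> u0)"
    using continuous_attains_sup[of K "\<lambda>u. cmod (\<phi> u)"] by blast
  have "u0 \<noteq> 0" "\<bar>u0\<bar> \<le> R" using u0 h by (auto simp: K_def)
  then have k1: "cmod (\<phi> u0) < 1" by (rule less)
  define k where "k = max (cmod (\<phi> u0)) (1 / 2)"
  have k: "0 < k" "k < 1" "cmod (\<phi> u0) \<le> k" using k1 by (auto simp: k_def)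
  define \<sigma> where "\<sigma> = min c (- ln k / R powr \<beta>)"
  have \<sigma>: "0 < \<sigma>" using k R c by (simp add: \<sigma>_def divide_neg_pos)
  have "cmod (\<phi> t) \<le> exp (- \<sigma> * \<bar>t\<bar> powr \<beta>)" if t: "\<bar>t\<bar> \<le> R" for t
  proof (cases "\<bar>t\<bar> \<le> \<delta>")
    case True
    have "- c * \<bar>t\<bar> powr \<beta> \<le> - \<sigma> * \<bar>t\<bar> powr \<beta>" by (intro mult_right_mono) (auto simp: \<sigma>_def)
    then show ?thesis using near[OF True] by (meson exp_le_cancel_iff order_trans)
  next
    case False
    then have "t \<in> K" using t h by (auto simp: K_def)
    then have "cmod (\<phi> t) \<le> k" using u0(2) k(3) by (meson order_trans)
    also have "k = exp (ln k)" using k by simp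
    also have "\<dots> \<le> exp (- \<sigma> * \<bar>t\<bar> powr \<beta>)"
    proof -
      have "\<sigma> * \<bar>t\<bar> powr \<beta> \<le> (- ln k / R powr \<beta>) * R powr \<beta>"
        using t \<beta> \<sigma> k R by (intro mult_mono powr_mono2) (auto simp: \<sigma>_def)
      then show ?thesis using R by simp
    qed
    finally show ?thesis .
  qed
  then show ?thesis using \<sigma> by blast
qed

text \<open>If \<open>exp(2 \<pi> i Y/d)\<close> has mean of modulus one it is constant.\<close>

lemma (in prob_space) AE_dvd_of_norm_char_eq_1:
  fixes Y :: "'a \<Rightarrow> int"
  assumes Y: "Y \<in> measurable M (count_space UNIV)" and d: "1 \<le> d"
    and one: "cmod (CLINT \<omega>|M. iexp (2 * pi / real d * real_of_int (Y \<omega>))) = 1"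
  shows "\<exists>c. AE \<omega> in M. int d dvd Y \<omega> - c"
proof -
  let ?u = "2 * pi / real d"
  have Yb: "(\<lambda>\<omega>. real_of_int (Y \<omega>)) \<in> borel_measurable M" by (rule measurable_compose[OF Y]) simp
  have AE: "AE \<omega> in M. iexp (?u * real_of_int (Y \<omega>)) = (CLINT \<omega>|M. iexp (?u * real_of_int (Y \<omega>)))"
    by (rule AE_iexp_eq_of_norm_one[OF Yb one])
  then obtain \<omega>0 where \<omega>0: "iexp (?u * real_of_int (Y \<omega>0)) = (CLINT \<omega>|M. iexp (?u * real_of_int (Y \<omega>)))"
    using eventually_happens ae_filter_bot by blast
  have "AE \<omega> in M. int d dvd Y \<omega> - Y \<omega>0"
    using AE
  proof eventually_elim
    case (elim \<omega>)
    have "cis (?u * real_of_int (Y \<omega> - Y \<omega>0)) = cis (?u * real_of_int (Y \<omega>)) / cis (?u * real_of_int (Y \<omega>0))"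
      by (simp add: cis_divide right_diff_distrib diff_divide_distrib)
    also have "cis (?u * real_of_int (Y \<omega>)) = cis (?u * real_of_int (Y \<omega>0))"
      using elim \<omega>0 by (simp only: cis_conv_exp)
    also have "cis (?u * real_of_int (Y \<omega>0)) / cis (?u * real_of_int (Y \<omega>0)) = 1" by simp
    finally have "cos (?u * real_of_int (Y \<omega> - Y \<omega>0)) = 1" by (simp add: complex_eq_iff)
    then obtain k :: int where k: "?u * real_of_int (Y \<omega> - Y \<omega>0) = real_of_int k * 2 * pi"
      using cos_one_2pi_int by blast
    define D where "D = real_of_int (Y \<omega> - Y \<omega>0)"
    from k have "?u * D = real_of_int k * 2 * pi" by (simp only: D_def)
    then have "2 * pi * D = 2 * pi * (real d * real_of_int k)" using d by (simp add: field_simps)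
    then have "D = real d * real_of_int k" by simp
    then have "real_of_int (Y \<omega> - Y \<omega>0) = real d * real_of_int k" by (simp only: D_def)
    then have "Y \<omega> - Y \<omega>0 = int d * k" by (metis of_int_eq_iff of_int_mult of_int_of_nat_eq)
    then show ?case by simp
  qed
  then show ?thesis by blast
qed

text \<open>Dominated convergence for the part of the error exceeding \<open>q\<^sub>n\<close>; the remainder is at most \<open>q\<^sub>n\<close> on an interval of
length \<open>2 T\<^sub>n\<close>.\<close>

lemma L1_convergence_truncated:
  fixes \<Phi> :: "nat \<Rightarrow> real \<Rightarrow> complex" and T q :: "nat \<Rightarrow> real"
  assumes \<Phi>m[measurable]: "\<And>n. \<Phi> n \<in> borel_measurable borel"
    and w: "integrable lborel w" and \<Psi>: "complex_integrable lborel \<Psi>"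
    and bound: "\<And>n u. 1 \<le> n \<Longrightarrow> \<bar>u\<bar> \<le> T n \<Longrightarrow> cmod (\<Phi> n u) \<le> w u + q n"
    and w0: "\<And>u. 0 \<le> w u" and q0: "\<And>n. 0 \<le> q n" and T0: "\<And>n. 0 \<le> T n"
    and lim: "\<And>u. (\<lambda>n. \<Phi> n u) \<longlonglongrightarrow> \<Psi> u"
    and T: "filterlim T at_top sequentially" and Tq: "(\<lambda>n. T n * q n) \<longlonglongrightarrow> 0"
  shows "(\<lambda>n. LINT u|lborel. cmod (indicator {- T n..T n} u *\<^sub>R \<Phi> n u - \<Psi> u)) \<longlonglongrightarrow> 0"
proof (rule LIMSEQ_imp_Suc)
  have [measurable]: "\<Psi> \<in> borel_measurable borel" "w \<in> borel_measurable borel" using \<Psi> w by auto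
  define D where "D n u = cmod (indicator {- T n..T n} u *\<^sub>R \<Phi> n u - \<Psi> u)" for n u
  define h where "h n u = max 0 (D n u - indicator {- T n..T n} u * q n)" for n u
  have [measurable]: "D n \<in> borel_measurable borel" for n unfolding D_def[abs_def] by measurable
  have [measurable]: "h n \<in> borel_measurable borel" for n unfolding h_def[abs_def] by measurable
  have h_le: "h n u \<le> w u + cmod (\<Psi> u)" if n: "1 \<le> n" for n u
  proof (cases "u \<in> {- T n..T n}")
    case True
    then have "cmod (\<Phi> n u) \<le> w u + q n" using bound[OF n, of u] by auto
    then have "D n u \<le> w u + q n + cmod (\<Psi> u)" unfolding D_def using True norm_triangle_ineq4[of "\<Phi> n u" "\<Psi> u"] by simp
    then show ?thesis using True w0[of u] by (simp add: h_def)
  next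
    case False
    then show ?thesis using w0[of u] by (simp add: h_def D_def)
  qed
  have h0: "0 \<le> h n u" for n u by (simp add: h_def)
  have Dlim: "(\<lambda>n. D n u) \<longlonglongrightarrow> 0" for u
  proof -
    have "(\<lambda>n. cmod (\<Phi> n u - \<Psi> u)) \<longlonglongrightarrow> cmod (\<Psi> u - \<Psi> u)" by (intro tendsto_intros lim)
    moreover have "eventually (\<lambda>n. cmod (\<Phi> n u - \<Psi> u) = D n u) sequentially"
      using filterlim_at_top_dense[THEN iffD1, OF T, rule_format, of "\<bar>u\<bar>"]
      by eventually_elim (auto simp: D_def abs_less_iff)
    ultimately show ?thesis by (simp add: Lim_transform_eventually)
  qed
  have hlim: "(\<lambda>n. h n u) \<longlonglongrightarrow> 0" for u
  proof (rule tendsto_sandwich[OF _ _ tendsto_const Dlim[of u]])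
    show "eventually (\<lambda>n. h n u \<le> D n u) sequentially"
      using q0 by (intro always_eventually allI) (auto simp: h_def D_def indicator_def)
  qed (use h0 in auto)
  have wint: "integrable lborel (\<lambda>u. w u + cmod (\<Psi> u))" using w \<Psi> by auto
  \<comment> \<open>The bound on \<open>\<Phi> n\<close> is available for \<open>n \<ge> 1\<close>, hence the shift of the index.\<close>
  have hint: "integrable lborel (h (Suc n))" for n
    by (rule Bochner_Integration.integrable_bound[OF wint]) (use h_le[of "Suc n"] h0 w0 in \<open>auto simp: abs_of_nonneg add_nonneg_nonneg\<close>)
  have "(\<lambda>n. LINT u|lborel. h (Suc n) u) \<longlonglongrightarrow> integral\<^sup>L lborel (\<lambda>_::real. 0::real)"
  proof (rule integral_dominated_convergence[where w="\<lambda>u. w u + cmod (\<Psi> u)"])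
    show "integrable lborel (\<lambda>u. w u + cmod (\<Psi> u))" by (fact wint)
    show "AE u in lborel. (\<lambda>n. h (Suc n) u) \<longlonglongrightarrow> 0" using LIMSEQ_Suc[OF hlim] by simp
    show "AE u in lborel. norm (h (Suc n) u) \<le> w u + cmod (\<Psi> u)" for n using h_le[of "Suc n"] h0 by simp
  qed auto
  moreover have "(\<lambda>n. 2 * (T (Suc n) * q (Suc n))) \<longlonglongrightarrow> 2 * 0"
    by (intro tendsto_intros LIMSEQ_Suc[OF Tq])
  ultimately have up: "(\<lambda>n. (LINT u|lborel. h (Suc n) u) + 2 * (T (Suc n) * q (Suc n))) \<longlonglongrightarrow> 0"
    using tendsto_add by fastforce
  have D_le: "(LINT u|lborel. D (Suc n) u) \<le> (LINT u|lborel. h (Suc n) u) + 2 * (T (Suc n) * q (Suc n))" for n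
  proof -
    have iq: "integrable lborel (\<lambda>u. indicator {- T (Suc n)..T (Suc n)} u * q (Suc n))"
      by (intro integrable_mult_left integrable_real_indicator) (simp_all add: emeasure_lborel_Icc_eq)
    have "(LINT u|lborel. D (Suc n) u) \<le> (LINT u|lborel. h (Suc n) u + indicator {- T (Suc n)..T (Suc n)} u * q (Suc n))"
    proof (rule integral_mono')
      show "integrable lborel (\<lambda>u. h (Suc n) u + indicator {- T (Suc n)..T (Suc n)} u * q (Suc n))"
        using hint iq by (rule Bochner_Integration.integrable_add)
    qed (auto simp: h_def D_def q0 intro!: add_nonneg_nonneg mult_nonneg_nonneg)
    also have "\<dots> = (LINT u|lborel. h (Suc n) u) + (LINT u|lborel. indicator {- T (Suc n)..T (Suc n)} u * q (Suc n))"
      using hint iq by (rule Bochner_Integration.integral_add)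
    also have "(LINT u|lborel. indicator {- T (Suc n)..T (Suc n)} u * q (Suc n)) = 2 * (T (Suc n) * q (Suc n))"
      using T0[of "Suc n"] by simp
    finally show ?thesis .
  qed
  show "(\<lambda>n. LINT u|lborel. cmod (indicator {- T (Suc n)..T (Suc n)} u *\<^sub>R \<Phi> (Suc n) u - \<Psi> u)) \<longlonglongrightarrow> 0"
    unfolding D_def[symmetric]
    by (rule tendsto_sandwich[OF _ _ tendsto_const up]) (use D_le in \<open>auto simp: D_def\<close>)
qed

text \<open>As \<open>Z - m\<close> is almost surely a multiple of \<open>d\<close>, the integral over a period runs over \<open>\<bar>t\<bar> \<le> \<pi>/d\<close> only. The variable
is rescaled by \<open>N\<close>. The second term on the right bounds the effect of replacing \<open>m/N\<close> by \<open>x\<close> in the character.\<close>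

lemma (in prob_space) local_limit_error:
  fixes Z :: "'a \<Rightarrow> int" and d :: nat and N x :: real and m :: int
  assumes Z: "Z \<in> measurable M (count_space UNIV)" and d: "1 \<le> d" and N: "0 < N"
    and lattice: "AE \<omega> in M. int d dvd Z \<omega> - m" and m: "\<bar>real_of_int m - N * x\<bar> \<le> 1"
    and \<Psi>: "complex_integrable lborel \<Psi>" and \<Psi>1: "integrable lborel (\<lambda>u. \<bar>u\<bar> * cmod (\<Psi> u))"
  defines "\<theta> \<equiv> (\<lambda>t. (CLINT \<omega>|M. iexp (t * real_of_int (Z \<omega>))))" and "T \<equiv> pi * N / real d"
  shows "\<bar>N * prob {\<omega> \<in> space M. Z \<omega> = m} - real d * Re (inverse_fourier \<Psi> x)\<bar> \<le>
    real d / (2 * pi) * ((LINT u|lborel. cmod (indicator {- T..T} u *\<^sub>R \<theta> (u / N) - \<Psi> u)) +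
       (LINT u|lborel. \<bar>u\<bar> * cmod (\<Psi> u)) / N)"
proof -
  have Zb: "(\<lambda>\<omega>. real_of_int (Z \<omega>)) \<in> borel_measurable M" by (rule measurable_compose[OF Z]) simp
  interpret Zd: real_distribution "distr M borel (\<lambda>\<omega>. real_of_int (Z \<omega>))" by (rule real_distribution_distr[OF Zb])
  have \<theta>_char: "\<theta> = char (distr M borel (\<lambda>\<omega>. real_of_int (Z \<omega>)))"
    unfolding \<theta>_def char_def by (subst integral_distr[OF Zb]) auto
  have [measurable]: "\<theta> \<in> borel_measurable borel" unfolding \<theta>_char by simp
  have \<theta>1: "cmod (\<theta> t) \<le> 1" for t unfolding \<theta>_char by (rule Zd.cmod_char_le_1)
  have [measurable]: "\<Psi> \<in> borel_measurable borel" using \<Psi> by auto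
  define K where "K \<omega> = (Z \<omega> - m) div int d" for \<omega>
  have Km: "K \<in> measurable M (count_space UNIV)"
    unfolding K_def[abs_def] by (rule measurable_compose[OF Z]) simp
  have KZ: "AE \<omega> in M. Z \<omega> - m = int d * K \<omega>"
    using lattice by eventually_elim (simp add: K_def)
  have pK: "prob {\<omega> \<in> space M. K \<omega> = 0} = prob {\<omega> \<in> space M. Z \<omega> = m}"
  proof (rule measure_eq_AE)
    show "AE \<omega> in M. (\<omega> \<in> {\<omega> \<in> space M. K \<omega> = 0}) = (\<omega> \<in> {\<omega> \<in> space M. Z \<omega> = m})"
      using KZ by eventually_elim (use d in auto)
    show "{\<omega> \<in> space M. K \<omega> = 0} \<in> sets M" by (rule measurable_sets_Collect[OF Km]) simp
    show "{\<omega> \<in> space M. Z \<omega> = m} \<in> sets M" by (rule measurable_sets_Collect[OF Z]) simp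
  qed
  have EK: "(CLINT \<omega>|M. iexp (s * real_of_int (K \<omega>))) = iexp (- (s / real d * m)) * \<theta> (s / real d)" for s
  proof -
    have "(CLINT \<omega>|M. iexp (s * real_of_int (K \<omega>))) = (CLINT \<omega>|M. iexp (- (s / real d * m)) * iexp (s / real d * real_of_int (Z \<omega>)))"
    proof (rule integral_cong_AE)
      show "AE \<omega> in M. iexp (s * real_of_int (K \<omega>)) = iexp (- (s / real d * m)) * iexp (s / real d * real_of_int (Z \<omega>))"
        using KZ
      proof eventually_elim
        case (elim \<omega>)
        then have "real_of_int (Z \<omega>) = real_of_int m + real d * real_of_int (K \<omega>)"
          by (metis add.commute diff_eq_eq of_int_add of_int_mult of_int_of_nat_eq)
        then have "s * real_of_int (K \<omega>) = - (s / real d * m) + s / real d * real_of_int (Z \<omega>)"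
          using d by (simp add: field_simps)
        then show ?case by (simp only: of_real_add distrib_left exp_add)
      qed
      show "(\<lambda>\<omega>. iexp (s * real_of_int (K \<omega>))) \<in> borel_measurable M" by (rule measurable_compose[OF Km]) simp
      show "(\<lambda>\<omega>. iexp (- (s / real d * m)) * iexp (s / real d * real_of_int (Z \<omega>))) \<in> borel_measurable M"
        by (rule measurable_compose[OF Z]) simp
    qed
    then show ?thesis unfolding \<theta>_def by simp
  qed
  let ?I = "\<lambda>u. indicator {- T..T} u :: real"
  define A where "A = (CLINT u|lborel. ?I u *\<^sub>R (iexp (- (u * (m / N))) * \<theta> (u / N)))"
  have "complex_of_real (2 * pi * prob {\<omega> \<in> space M. Z \<omega> = m}) =
      (CLINT s|lborel. indicator {- pi..pi} s *\<^sub>R (iexp (- (s / real d * m)) * \<theta> (s / real d)))"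
    using prob_eq_0_fourier[OF Km] unfolding pK EK set_lebesgue_integral_def .
  also have "\<dots> = \<bar>real d / N\<bar> *\<^sub>R (CLINT u|lborel. indicator {- pi..pi} (0 + real d / N * u) *\<^sub>R
      (iexp (- ((0 + real d / N * u) / real d * m)) * \<theta> ((0 + real d / N * u) / real d)))"
    using d N by (intro lborel_integral_real_affine) auto
  also have "(CLINT u|lborel. indicator {- pi..pi} (0 + real d / N * u) *\<^sub>R
      (iexp (- ((0 + real d / N * u) / real d * m)) * \<theta> ((0 + real d / N * u) / real d))) = A"
    unfolding A_def
  proof (intro Bochner_Integration.integral_cong refl)
    fix u
    have "(0 + real d / N * u \<in> {- pi..pi}) = (u \<in> {- T..T})"
      using d N by (auto simp: T_def field_simps)
    then have i: "indicator {- pi..pi} (0 + real d / N * u) = ?I u" by (simp add: indicator_def)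
    have e: "(0 + real d / N * u) / real d = u / N" using d by simp
    show "indicator {- pi..pi} (0 + real d / N * u) *\<^sub>R
      (iexp (- ((0 + real d / N * u) / real d * m)) * \<theta> ((0 + real d / N * u) / real d)) = ?I u *\<^sub>R (iexp (- (u * (m / N))) * \<theta> (u / N))"
      unfolding i e by simp
  qed
  finally have "complex_of_real (2 * pi * prob {\<omega> \<in> space M. Z \<omega> = m}) = complex_of_real (real d / N) * A"
    using d N by (simp add: scaleR_conv_of_real)
  then have "complex_of_real (N / (2 * pi)) * complex_of_real (2 * pi * prob {\<omega> \<in> space M. Z \<omega> = m}) =
     complex_of_real (N / (2 * pi)) * (complex_of_real (real d / N) * A)" by simp
  then have P: "complex_of_real (N * prob {\<omega> \<in> space M. Z \<omega> = m}) = complex_of_real (real d / (2 * pi)) * A"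
    using N by (simp add: field_simps)
  define B where "B = (CLINT u|lborel. iexp (- (u * x)) * \<Psi> u)"
  have "real d * Re (inverse_fourier \<Psi> x) = Re (complex_of_real (real d / (2 * pi)) * B)"
    unfolding inverse_fourier_def B_def[symmetric] by (simp add: Re_divide_of_real)
  moreover have "N * prob {\<omega> \<in> space M. Z \<omega> = m} = Re (complex_of_real (real d / (2 * pi)) * A)"
    using P by (metis Re_complex_of_real)
  ultimately have "\<bar>N * prob {\<omega> \<in> space M. Z \<omega> = m} - real d * Re (inverse_fourier \<Psi> x)\<bar> =
      \<bar>Re (complex_of_real (real d / (2 * pi)) * (A - B))\<bar>"
    by (simp add: right_diff_distrib)
  also have "\<dots> \<le> cmod (complex_of_real (real d / (2 * pi)) * (A - B))" by (rule abs_Re_le_cmod)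
  also have "\<dots> = real d / (2 * pi) * cmod (A - B)" by (simp add: norm_mult norm_divide)
  also have "\<dots> \<le> real d / (2 * pi) * ((LINT u|lborel. cmod (?I u *\<^sub>R \<theta> (u / N) - \<Psi> u)) + (LINT u|lborel. \<bar>u\<bar> * cmod (\<Psi> u)) / N)"
  proof (rule mult_left_mono)
    have Iint: "integrable lborel ?I" by (intro integrable_real_indicator) (simp_all add: emeasure_lborel_Icc_eq)
    have iA: "complex_integrable lborel (\<lambda>u. ?I u *\<^sub>R (iexp (- (u * (m / N))) * \<theta> (u / N)))"
      by (rule Bochner_Integration.integrable_bound[OF Iint]) (use \<theta>1 in \<open>auto simp: norm_mult indicator_def\<close>)
    have iX: "complex_integrable lborel (\<lambda>u. ?I u *\<^sub>R \<theta> (u / N))"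
      by (rule Bochner_Integration.integrable_bound[OF Iint]) (use \<theta>1 in \<open>auto simp: norm_mult indicator_def\<close>)
    have iB: "complex_integrable lborel (\<lambda>u. iexp (- (u * x)) * \<Psi> u)" by (rule integrable_iexp_mult[OF \<Psi>])
    have i1: "integrable lborel (\<lambda>u. cmod (?I u *\<^sub>R \<theta> (u / N) - \<Psi> u))" using iX \<Psi> by auto
    have "cmod (A - B) = cmod (CLINT u|lborel. ?I u *\<^sub>R (iexp (- (u * (m / N))) * \<theta> (u / N)) - iexp (- (u * x)) * \<Psi> u)"
      unfolding A_def B_def using iA iB by simp
    also have "\<dots> \<le> (LINT u|lborel. cmod (?I u *\<^sub>R (iexp (- (u * (m / N))) * \<theta> (u / N)) - iexp (- (u * x)) * \<Psi> u))"
      by (rule integral_norm_bound)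
    also have "\<dots> \<le> (LINT u|lborel. cmod (?I u *\<^sub>R \<theta> (u / N) - \<Psi> u) + \<bar>u\<bar> * cmod (\<Psi> u) / N)"
    proof (rule integral_mono')
      show "integrable lborel (\<lambda>u. cmod (?I u *\<^sub>R \<theta> (u / N) - \<Psi> u) + \<bar>u\<bar> * cmod (\<Psi> u) / N)"
        using i1 \<Psi>1 by auto
      fix u
      let ?a = "iexp (- (u * (m / N)))" and ?b = "iexp (- (u * x))"
      have "?I u *\<^sub>R (?a * \<theta> (u / N)) - ?b * \<Psi> u = ?a * (?I u *\<^sub>R \<theta> (u / N) - \<Psi> u) + (?a - ?b) * \<Psi> u"
        by (simp add: algebra_simps)
      then have "cmod (?I u *\<^sub>R (?a * \<theta> (u / N)) - ?b * \<Psi> u) \<le> cmod (?I u *\<^sub>R \<theta> (u / N) - \<Psi> u) + cmod (?a - ?b) * cmod (\<Psi> u)"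
        by (metis norm_triangle_ineq norm_mult norm_exp_i_times mult_1)
      also have "cmod (?a - ?b) \<le> \<bar>- (u * (m / N)) - - (u * x)\<bar>" by (rule norm_iexp_diff_le)
      also have "\<dots> = \<bar>u\<bar> * (\<bar>real_of_int m - N * x\<bar> / N)"
      proof -
        have "- (u * (m / N)) - - (u * x) = - u * ((real_of_int m - N * x) / N)" using N by (simp add: field_simps)
        then show ?thesis using N by (simp add: abs_mult)
      qed
      also have "\<dots> \<le> \<bar>u\<bar> * (1 / N)" using m N by (intro mult_left_mono divide_right_mono) auto
      finally show "cmod (?I u *\<^sub>R (?a * \<theta> (u / N)) - ?b * \<Psi> u) \<le> cmod (?I u *\<^sub>R \<theta> (u / N) - \<Psi> u) + \<bar>u\<bar> * cmod (\<Psi> u) / N"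
        by (simp add: mult_right_mono)
    qed (use N in auto)
    also have "\<dots> = (LINT u|lborel. cmod (?I u *\<^sub>R \<theta> (u / N) - \<Psi> u)) + (LINT u|lborel. \<bar>u\<bar> * cmod (\<Psi> u)) / N"
      using i1 \<Psi>1 by simp
    finally show "cmod (A - B) \<le> \<dots>" .
  qed simp
  finally show ?thesis .
qed

text \<open>Windows of length \<open>n\<^sup>g\<close> with \<open>\<alpha> < g < 1\<close>: the lower bound on \<open>g\<close> gives the first limit, the upper bound makes
the exponent \<open>n\<^bsup>1-g\<^esup>\<close> in the second beat every power of \<open>n\<close>.\<close>

lemma ex_window_sequence:
  fixes \<alpha> \<beta> C \<eta> :: real
  assumes \<alpha>: "0 < \<alpha>" "\<alpha> < 1" and \<beta>: "0 < \<beta>" and C: "0 \<le> C" and \<eta>: "0 < \<eta>" "\<eta> < 1"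
  shows "\<exists>m :: nat \<Rightarrow> nat. (\<forall>n. 1 \<le> m n) \<and> (\<lambda>n. real n * (C * real (m n) powr (- 1 / \<alpha>))) \<longlonglongrightarrow> 0 \<and>
    (\<lambda>n. real n powr (1 / \<beta>) * (3 * (real (2 * m n + 1) * \<eta> ^ (n div (2 * m n + 1))))) \<longlonglongrightarrow> 0"
proof -
  \<comment> \<open>Any exponent strictly between \<open>\<alpha>\<close> and \<open>1\<close> would do.\<close>
  define g where "g = (1 + \<alpha>) / 2"
  have g: "\<alpha> < g" "g < 1" "0 < g" using \<alpha> by (auto simp: g_def)
  define m where "m n = nat \<lceil>real n powr g\<rceil> + 1" for n :: nat
  have m_ge: "real n powr g \<le> real (m n)" and m_le: "real (m n) \<le> real n powr g + 2" for n
    unfolding m_def using powr_ge_zero[of "real n" g] by linarith+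
  have "(\<lambda>n. real n * (C * real (m n) powr (- 1 / \<alpha>))) \<longlonglongrightarrow> 0"
  proof (rule tendsto_sandwich[OF _ _ tendsto_const])
    show "eventually (\<lambda>n. 0 \<le> real n * (C * real (m n) powr (- 1 / \<alpha>))) sequentially"
      using C by (intro always_eventually allI mult_nonneg_nonneg) auto
    show "eventually (\<lambda>n. real n * (C * real (m n) powr (- 1 / \<alpha>)) \<le> C * real n powr (1 - g / \<alpha>)) sequentially"
      using eventually_ge_at_top[of 1]
    proof eventually_elim
      case (elim n)
      have "real (m n) powr (- 1 / \<alpha>) \<le> (real n powr g) powr (- 1 / \<alpha>)"
        using m_ge[of n] elim \<alpha> by (intro powr_mono2') auto
      also have "\<dots> = real n powr (- g / \<alpha>)" by (simp add: powr_powr)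
      finally have "real n * (C * real (m n) powr (- 1 / \<alpha>)) \<le> real n * (C * real n powr (- g / \<alpha>))"
        using C by (intro mult_left_mono) auto
      also have "\<dots> = C * (real n powr 1 * real n powr (- g / \<alpha>))" using elim by simp
      also have "\<dots> = C * real n powr (1 - g / \<alpha>)" by (simp only: powr_add[symmetric]) simp
      finally show ?case .
    qed
    have "1 - g / \<alpha> < 0" using g \<alpha> by (simp add: field_simps)
    then have "(\<lambda>n. C * real n powr (1 - g / \<alpha>)) \<longlonglongrightarrow> C * 0"
      by (intro tendsto_intros tendsto_neg_powr filterlim_real_sequentially)
    then show "(\<lambda>n. C * real n powr (1 - g / \<alpha>)) \<longlonglongrightarrow> 0" by simp
  qed
  moreover have "(\<lambda>n. real n powr (1 / \<beta>) * (3 * (real (2 * m n + 1) * \<eta> ^ (n div (2 * m n + 1))))) \<longlonglongrightarrow> 0"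
  proof (rule tendsto_sandwich[OF _ _ tendsto_const])
    define l where "l = ln \<eta>"
    have l: "l < 0" using \<eta> by (simp add: l_def)
    show "eventually (\<lambda>n. 0 \<le> real n powr (1 / \<beta>) * (3 * (real (2 * m n + 1) * \<eta> ^ (n div (2 * m n + 1))))) sequentially"
      using \<eta> by (intro always_eventually allI mult_nonneg_nonneg) auto
    show "eventually (\<lambda>n. real n powr (1 / \<beta>) * (3 * (real (2 * m n + 1) * \<eta> ^ (n div (2 * m n + 1)))) \<le>
      real n powr (1 / \<beta>) * (3 * (7 * real n powr g * exp ((real n powr (1 - g) / 7 - 1) * l)))) sequentially"
      using eventually_ge_at_top[of 1]
    proof eventually_elim
      case (elim n)
      have n1: "1 \<le> real n powr g" using elim g by (intro ge_one_powr_ge_zero) auto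
      have M: "real (2 * m n + 1) \<le> 7 * real n powr g" using m_le[of n] n1 by simp
      have "real n powr (1 - g) / 7 = real n / (7 * real n powr g)" using elim by (simp add: powr_diff)
      also have "\<dots> \<le> real n / real (2 * m n + 1)" using M n1 elim by (intro divide_left_mono mult_pos_pos) auto
      also have "\<dots> \<le> real (n div (2 * m n + 1)) + 1"
      proof -
        define k where "k = 2 * m n + 1"
        have k0: "0 < k" by (simp add: k_def)
        then have "n < k * (n div k) + k" using mult_div_mod_eq[of k n] mod_less_divisor[of k n] by linarith
        then have "n \<le> (n div k + 1) * k" by (simp add: algebra_simps)
        then have "real n \<le> (real (n div k) + 1) * real k"
          by (metis of_nat_1 of_nat_add of_nat_le_iff of_nat_mult)
        then show ?thesis unfolding k_def[symmetric] using k0 by (simp add: pos_divide_le_eq)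
      qed
      finally have "real n powr (1 - g) / 7 - 1 \<le> real (n div (2 * m n + 1))" by simp
      then have "real (n div (2 * m n + 1)) * l \<le> (real n powr (1 - g) / 7 - 1) * l"
        using l by (intro mult_right_mono_neg) auto
      note exponent = this
      have "\<eta> ^ (n div (2 * m n + 1)) = exp (real (n div (2 * m n + 1)) * l)"
        using \<eta> by (simp add: l_def exp_of_nat_mult)
      also have "\<dots> \<le> exp ((real n powr (1 - g) / 7 - 1) * l)"
        using exponent by (simp only: exp_le_cancel_iff)
      finally have "real (2 * m n + 1) * \<eta> ^ (n div (2 * m n + 1)) \<le> 7 * real n powr g * exp ((real n powr (1 - g) / 7 - 1) * l)"
        using M \<eta> by (intro mult_mono) auto
      then show ?case by (intro mult_left_mono) auto
    qed
    define k where "k = 1 - g"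
    have k: "0 < k" using g by (simp add: k_def)
    show "(\<lambda>n. real n powr (1 / \<beta>) * (3 * (7 * real n powr g * exp ((real n powr (1 - g) / 7 - 1) * l)))) \<longlonglongrightarrow> 0"
      unfolding k_def[symmetric] using l k by real_asymp
  qed
  ultimately show ?thesis by (intro exI[of _ m]) (auto simp: m_def)
qed

text \<open>Together with the next lemma this turns the factor \<open>r\<close> in the limiting density into the factor \<open>v = r\<^bsup>-\<beta>\<^esup>\<close> in the
exponent.\<close>

lemma inverse_fourier_scale:
  assumes r: "0 < r"
  shows "complex_of_real r * inverse_fourier \<psi> (r * x) = inverse_fourier (\<lambda>u. \<psi> (u / r)) x"
proof -
  have "(CLINT s|lborel. iexp (- (s * (r * x))) * \<psi> s) =
    \<bar>1 / r\<bar> *\<^sub>R (CLINT u|lborel. iexp (- ((0 + 1 / r * u) * (r * x))) * \<psi> (0 + 1 / r * u))"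
    using r by (intro lborel_integral_real_affine) auto
  also have "(CLINT u|lborel. iexp (- ((0 + 1 / r * u) * (r * x))) * \<psi> (0 + 1 / r * u)) =
     (CLINT u|lborel. iexp (- (u * x)) * \<psi> (u / r))"
    using r by (intro Bochner_Integration.integral_cong refl) simp
  finally show ?thesis using r by (simp add: inverse_fourier_def scaleR_conv_of_real)
qed

lemma stable_char_scale:
  assumes v: "0 < v" and \<beta>: "0 < \<beta>"
  shows "stable_char \<beta> A1 A2 (u / v powr (- 1 / \<beta>)) = stable_char \<beta> (v * A1) (v * A2) u"
proof -
  have e: "u / v powr (- 1 / \<beta>) = u * v powr (1 / \<beta>)"
    using v by (simp add: powr_minus divide_inverse)
  have "\<bar>u * v powr (1 / \<beta>)\<bar> powr \<beta> = v * \<bar>u\<bar> powr \<beta>"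
    using v \<beta> by (simp add: abs_mult powr_mult powr_powr)
  moreover have "sgn (u * v powr (1 / \<beta>)) = sgn u" using v by (simp add: sgn_mult)
  ultimately show ?thesis unfolding e stable_char_def by (simp add: algebra_simps)
qed

context prob_space begin

lemma measurable_scenery_sum:
  assumes iid\<xi>: "iid_on UNIV \<xi>" and iidX: "iid_on {1..} X"
  shows "scenery_sum \<xi> X n \<in> measurable M (count_space UNIV)"
proof -
  have X: "X i \<in> measurable M (count_space UNIV)" if "1 \<le> i" for i
    using iid_onD(3)[OF iidX subset_refl] that by simp
  have \<xi>: "\<xi> y \<in> measurable M (count_space UNIV)" for y
    using iid_onD(3)[OF iid\<xi> subset_refl] by simp
  have w: "walk X (int k) \<in> measurable M (count_space UNIV)" for k
    using measurable_sum_int[of X M k] X by (simp add: walk_def[abs_def])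
  have t: "(\<lambda>\<omega>. \<xi> (walk X (int k) \<omega>) \<omega>) \<in> measurable M (count_space UNIV)" for k
    by (rule measurable_compose_countable[OF \<xi> w])
  show ?thesis
  proof (induction n)
    case 0
    then show ?case by (simp add: scenery_sum_def[abs_def])
  next
    case (Suc n)
    then show ?case using measurable_count_space_fun2[OF Suc t, of "(+)" n]
      by (simp add: scenery_sum_def[abs_def])
  qed
qed

text \<open>All values of the scenery lie in the coset \<open>c + d\<int>\<close>, so each of the \<open>n\<close> terms does.\<close>

lemma AE_scenery_sum_lattice:
  assumes iid\<xi>: "iid_on UNIV \<xi>" and c: "AE \<omega> in M. int d dvd \<xi> 1 \<omega> - c"
  shows "AE \<omega> in M. int d dvd scenery_sum \<xi> X n \<omega> - int n * c"
proof -
  have "AE \<omega> in M. int d dvd \<xi> y \<omega> - c" for y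
  proof -
    have m: "\<xi> z \<in> measurable M (count_space UNIV)" for z using iid_onD(3)[OF iid\<xi> subset_refl] by simp
    have "AE z in distr M (count_space UNIV) (\<xi> 1). int d dvd z - c"
      using c by (subst AE_distr_iff[OF m]) auto
    also have "distr M (count_space UNIV) (\<xi> 1) = distr M (count_space UNIV) (\<xi> y)"
      using iid_onD(2)[OF iid\<xi> subset_refl, of 1 y] by simp
    finally show ?thesis by (subst (asm) AE_distr_iff[OF m]) auto
  qed
  then have "AE \<omega> in M. \<forall>y. int d dvd \<xi> y \<omega> - c" by (subst AE_all_countable) auto
  then show ?thesis
  proof eventually_elim
    case (elim \<omega>)
    have "scenery_sum \<xi> X n \<omega> - int n * c = (\<Sum>k<n. \<xi> (walk X (int k) \<omega>) \<omega> - c)"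
      by (simp add: scenery_sum_def sum_subtractf)
    also have "int d dvd \<dots>" using elim by (intro dvd_sum) auto
    finally show ?case .
  qed
qed

end

section \<open>The local limit theorem\<close>

theorem theorem2:
  fixes M :: "'a measure"
    and \<xi> X :: "int \<Rightarrow> 'a \<Rightarrow> int"
    and \<alpha> \<beta> A1 A2 :: real
    and S\<^sub>\<alpha> S\<^sub>\<beta> :: "real measure"
    and d :: nat
  assumes "prob_space M"
    and "0 < \<alpha>" "\<alpha> < 1" "0 < \<beta>" "\<beta> \<le> 2"
    and "prob_space.iid_on M UNIV \<xi>"
    and "prob_space.iid_on M {1..} X"
    and "prob_space.indep_families M UNIV \<xi> {1..} X"
    and "prob_space.indep_copy M {1..} (\<lambda>k. X (- k)) X"
    and "normal_attraction M X \<alpha> S\<^sub>\<alpha>"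
    and "normal_attraction M \<xi> \<beta> S\<^sub>\<beta>"
    and "0 < A1" "\<beta> \<noteq> 1 \<longrightarrow> \<bar>A2 / A1\<bar> \<le> \<bar>tan (pi * \<beta> / 2)\<bar>"
    and "char S\<^sub>\<beta> = stable_char \<beta> A1 A2"
    and "1 \<le> d"
    and "{u. cmod (char (distr M borel (\<lambda>\<omega>. real_of_int (\<xi> 1 \<omega>))) u) = 1} =
         range (\<lambda>k::int. 2 * pi / real d * real_of_int k)"
  shows "let r = (\<integral>\<omega>. real (total_time_at_0 X \<omega>) powr (\<beta> - 1) \<partial>M) powr (- 1 / \<beta>);
             D = (\<lambda>x. r * continuous_density S\<^sub>\<beta> (r * x))
         in (\<forall>n\<ge>1. \<forall>x::real.
               \<P>(\<omega> in M. \<not> int d dvd int n * \<xi> 1 \<omega> - \<lfloor>real n powr (1 / \<beta>) * x\<rfloor>) = 1 \<longrightarrow>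
               \<P>(\<omega> in M. scenery_sum \<xi> X n \<omega> = \<lfloor>real n powr (1 / \<beta>) * x\<rfloor>) = 0) \<and>
            (\<exists>e :: nat \<Rightarrow> real. e \<in> o(\<lambda>n. real n powr (- 1 / \<beta>)) \<and>
              (\<forall>n\<ge>1. \<forall>x::real.
                \<P>(\<omega> in M. int d dvd int n * \<xi> 1 \<omega> - \<lfloor>real n powr (1 / \<beta>) * x\<rfloor>) = 1 \<longrightarrow>
                \<bar>\<P>(\<omega> in M. scenery_sum \<xi> X n \<omega> = \<lfloor>real n powr (1 / \<beta>) * x\<rfloor>)
                  - real d * (D x / real n powr (1 / \<beta>))\<bar> \<le> e n))"
proof -
  interpret prob_space M by fact
  note \<alpha> = \<open>0 < \<alpha>\<close> \<open>\<alpha> < 1\<close> and \<beta> = \<open>0 < \<beta>\<close> \<open>\<beta> \<le> 2\<close> and A1 = \<open>0 < A1\<close> and d = \<open>1 \<le> d\<close>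
  note iid\<xi> = \<open>iid_on UNIV \<xi>\<close> and iidX = \<open>iid_on {1..} X\<close>
  note copy = \<open>indep_copy {1..} (\<lambda>k. X (- k)) X\<close> and chS = \<open>char S\<^sub>\<beta> = stable_char \<beta> A1 A2\<close>
  have iid\<xi>1: "iid_on {1..} \<xi>"
    using iid\<xi> indep_vars_subset[of "\<lambda>_. count_space UNIV" \<xi> UNIV "{1..}"] by (auto simp: iid_on_def)
  have \<xi>1: "\<xi> 1 \<in> measurable M (count_space UNIV)" using iid_onD(3)[OF iid\<xi> subset_refl] by simp
  have X1: "X 1 \<in> measurable M (count_space UNIV)" using iid_onD(3)[OF iidX subset_refl] by simp
  obtain p where p: "measure_pmf p = distr M (count_space UNIV) (X 1)" using ex_law_pmf[OF X1] by blast
  obtain q where q: "measure_pmf q = distr M (count_space UNIV) (\<xi> 1)" using ex_law_pmf[OF \<xi>1] by blast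
  define \<phi> where "\<phi> = pmf_char q"
  have \<phi>1: "cmod (\<phi> t) \<le> 1" for t unfolding \<phi>_def by (rule norm_pmf_char_le_1)
  have \<phi>_eq: "(CLINT \<omega>|M. iexp (t * real_of_int (\<xi> 1 \<omega>))) = \<phi> t" for t
    unfolding \<phi>_def by (rule expectation_iexp_law[OF \<xi>1 q])
  have \<phi>_char: "char (distr M borel (\<lambda>\<omega>. real_of_int (\<xi> 1 \<omega>))) t = \<phi> t" for t
    unfolding char_def \<phi>_eq[symmetric] by (subst integral_distr[OF measurable_compose[OF \<xi>1]]) auto
  have period: "cmod (\<phi> t) = 1 \<longleftrightarrow> (\<exists>k::int. t = 2 * pi / real d * real_of_int k)" for t
    using assms(16) unfolding \<phi>_char by (auto simp: set_eq_iff)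

  obtain cX \<delta>X where X_bound: "0 < cX" "0 < \<delta>X" "\<And>t. \<bar>t\<bar> \<le> \<delta>X \<Longrightarrow> cmod (pmf_char p t) \<le> exp (- cX * \<bar>t\<bar> powr \<alpha>)"
    using normal_attraction_char_bound[OF iidX \<open>normal_attraction M X \<alpha> S\<^sub>\<alpha>\<close> p] by blast
  obtain C where C: "0 \<le> C" and cw: "concentrated_walk p (\<lambda>l. C * real l powr (- 1 / \<alpha>))"
    using concentrated_walk_of_char_bound[OF \<alpha> X_bound] by blast
  interpret W: concentrated_walk p "\<lambda>l. C * real l powr (- 1 / \<alpha>)" by (fact cw)

  define v where "v = (\<integral>\<omega>. real (total_time_at_0 X \<omega>) powr (\<beta> - 1) \<partial>M)"
  have v: "window_mean p (\<beta> - 1) \<longlonglongrightarrow> v" "0 < v"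
    unfolding v_def using window_mean_tendsto_total_time[OF iidX copy p cw, of "\<beta> - 1"] \<beta> by auto
  define r where "r = v powr (- 1 / \<beta>)"
  have r: "0 < r" using v by (simp add: r_def)
  define \<Psi> where "\<Psi> = stable_char \<beta> (v * A1) (v * A2)"
  have vA1: "0 < v * A1" using v A1 by simp
  have \<Psi>_int: "complex_integrable lborel \<Psi>" unfolding \<Psi>_def by (rule integrable_stable_char[OF vA1 \<beta>(1)])
  have \<Psi>_int1: "integrable lborel (\<lambda>u. \<bar>u\<bar> * cmod (\<Psi> u))"
    by (rule Bochner_Integration.integrable_bound[OF integrable_linear_exp_powr[OF vA1 \<beta>(1)]])
       (auto simp: \<Psi>_def norm_stable_char abs_mult)
  define D where "D x = r * continuous_density S\<^sub>\<beta> (r * x)" for x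
  have D: "D x = Re (inverse_fourier \<Psi> x)" for x
  proof -
    interpret S: real_distribution S\<^sub>\<beta>
      using \<open>normal_attraction M \<xi> \<beta> S\<^sub>\<beta>\<close> by (simp add: normal_attraction_def strictly_stable_def)
    have "D x = Re (complex_of_real r * inverse_fourier (stable_char \<beta> A1 A2) (r * x))"
      unfolding D_def S.continuous_density_stable[OF chS A1 \<beta>(1)] by simp
    also have "\<dots> = Re (inverse_fourier \<Psi> x)"
      unfolding inverse_fourier_scale[OF r] unfolding r_def stable_char_scale[OF v(2) \<beta>(1)] \<Psi>_def ..
    finally show ?thesis .
  qed

  have scal: "scaling_limit \<beta> \<phi> (stable_char \<beta> A1 A2)"
    unfolding \<phi>_def chS[symmetric] by (rule normal_attraction_scaling_limit[OF iid\<xi>1 \<open>normal_attraction M \<xi> \<beta> S\<^sub>\<beta>\<close> q])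
  have contS: "isCont (stable_char \<beta> A1 A2) 0"
  proof -
    interpret S: real_distribution S\<^sub>\<beta>
      using \<open>normal_attraction M \<xi> \<beta> S\<^sub>\<beta>\<close> by (simp add: normal_attraction_def strictly_stable_def)
    show ?thesis using S.isCont_char[of 0] by (simp add: chS)
  qed
  have expansion: "\<exists>\<delta>>0. \<forall>u. \<bar>u\<bar> \<le> \<delta> \<longrightarrow> cmod (\<phi> u - stable_char \<beta> A1 A2 u) \<le> e * \<bar>u\<bar> powr \<beta>" if "0 < e" for e
  proof (rule scaling_limit_expansion[OF scal \<beta>(1)])
    show "isCont \<phi> 0" unfolding \<phi>_def by (rule isCont_pmf_char)
    show "\<phi> 0 = 1" unfolding \<phi>_def pmf_char_def by simp
    show "stable_char \<beta> A1 A2 0 = 1" by (simp add: stable_char_def)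
    show "cmod (stable_char \<beta> A1 A2 u) \<le> 1" for u using A1 by (intro norm_stable_char_le_1) simp
    show "exp (- A1) \<le> cmod (stable_char \<beta> A1 A2 u)" if "\<bar>u\<bar> \<le> 1" for u
    proof -
      have "\<bar>u\<bar> powr \<beta> \<le> 1" using that \<beta> by (intro powr_le1) auto
      then show ?thesis using A1 by (simp add: norm_stable_char mult_left_le)
    qed
  qed (use that contS stable_char_self_similar[OF \<beta>(1)] in auto)
  define \<Phi> where "\<Phi> n u = rwrs_char p \<phi> n (u * real n powr (- 1 / \<beta>))" for n u
  have \<Phi>_lim: "(\<lambda>n. \<Phi> n u) \<longlonglongrightarrow> \<Psi> u" for u
    unfolding \<Phi>_def \<Psi>_def using A1 \<phi>1 by (intro W.rwrs_char_tendsto \<beta> expansion v(1)) auto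
  have Zm: "scenery_sum \<xi> X n \<in> measurable M (count_space UNIV)" for n
    by (rule measurable_scenery_sum[OF iid\<xi> iidX])
  have char_Z: "(CLINT \<omega>|M. iexp (t * real_of_int (scenery_sum \<xi> X n \<omega>))) = rwrs_char p \<phi> n t" for n t
    unfolding \<phi>_def by (rule char_scenery_sum[OF iid\<xi> iidX \<open>indep_families UNIV \<xi> {1..} X\<close> p q])
  have \<Phi>_meas: "\<Phi> n \<in> borel_measurable borel" for n
  proof -
    have Zb: "(\<lambda>\<omega>. real_of_int (scenery_sum \<xi> X n \<omega>)) \<in> borel_measurable M" by (rule measurable_compose[OF Zm]) simp
    interpret Zd: real_distribution "distr M borel (\<lambda>\<omega>. real_of_int (scenery_sum \<xi> X n \<omega>))"
      by (rule real_distribution_distr[OF Zb])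
    have "rwrs_char p \<phi> n = char (distr M borel (\<lambda>\<omega>. real_of_int (scenery_sum \<xi> X n \<omega>)))"
      unfolding char_Z[symmetric, abs_def] char_def[abs_def] by (subst integral_distr[OF Zb]) auto
    then have "rwrs_char p \<phi> n \<in> borel_measurable borel" by simp
    then show ?thesis unfolding \<Phi>_def[abs_def] by measurable
  qed

  \<comment> \<open>The bound near \<open>0\<close> extends to \<open>\<bar>t\<bar> \<le> \<pi>/d\<close>, which contains no nonzero point of the lattice \<open>(2\<pi>/d) \<int>\<close>.\<close>
  obtain c0 \<delta>0 where near: "0 < c0" "0 < \<delta>0" "\<And>t. \<bar>t\<bar> \<le> \<delta>0 \<Longrightarrow> cmod (\<phi> t) \<le> exp (- c0 * \<bar>t\<bar> powr \<beta>)"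
    using normal_attraction_char_bound[OF iid\<xi>1 \<open>normal_attraction M \<xi> \<beta> S\<^sub>\<beta>\<close> q] unfolding \<phi>_def by blast
  have "\<exists>\<sigma>>0. \<forall>t. \<bar>t\<bar> \<le> pi / real d \<longrightarrow> cmod (\<phi> t) \<le> exp (- \<sigma> * \<bar>t\<bar> powr \<beta>)"
  proof (rule bound_on_compact_of_bound_near_0[OF near(1,2) _ \<beta>(1) near(3)])
    show "0 < pi / real d" using d by simp
    show "isCont \<phi> t" for t unfolding \<phi>_def by (rule isCont_pmf_char)
    show "cmod (\<phi> t) < 1" if t: "t \<noteq> 0" "\<bar>t\<bar> \<le> pi / real d" for t
    proof -
      have "cmod (\<phi> t) \<noteq> 1"
      proof
        assume "cmod (\<phi> t) = 1"
        then obtain k :: int where k: "t = 2 * pi / real d * real_of_int k" using period by auto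
        then have "k \<noteq> 0" using t by auto
        then have "1 \<le> \<bar>real_of_int k\<bar>" by linarith
        then have "2 * pi / real d * 1 \<le> 2 * pi / real d * \<bar>real_of_int k\<bar>" by (intro mult_left_mono) auto
        also have "\<dots> = \<bar>t\<bar>" using k by (simp add: abs_mult)
        finally have "2 * pi / real d \<le> pi / real d" using t by linarith
        then show False using d by (simp add: divide_le_cancel)
      qed
      then show ?thesis using \<phi>1[of t] by linarith
    qed
  qed
  then obtain \<sigma> where \<sigma>: "0 < \<sigma>" "\<And>t. \<bar>t\<bar> \<le> pi / real d \<Longrightarrow> cmod (\<phi> t) \<le> exp (- \<sigma> * \<bar>t\<bar> powr \<beta>)" by blast

  obtain c q0 \<eta> where c: "0 < c" and q0: "0 < q0" and \<eta>: "0 < \<eta>" "\<eta> < 1"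
    and few: "\<And>n m. 1 \<le> m \<Longrightarrow> real n * (C * real m powr (- 1 / \<alpha>)) \<le> q0 \<Longrightarrow>
     measure_pmf.prob (steps p n) {x. real (card {k. k < n \<and> x \<in> visited_once n k}) < c * real n}
       \<le> 3 * (real (2 * m + 1) * \<eta> ^ (n div (2 * m + 1)))"
    using W.prob_few_visited_once by blast
  obtain m :: "nat \<Rightarrow> nat" where m: "\<And>n. 1 \<le> m n" "(\<lambda>n. real n * (C * real (m n) powr (- 1 / \<alpha>))) \<longlonglongrightarrow> 0"
    "(\<lambda>n. real n powr (1 / \<beta>) * (3 * (real (2 * m n + 1) * \<eta> ^ (n div (2 * m n + 1))))) \<longlonglongrightarrow> 0"
    using ex_window_sequence[OF \<alpha> \<beta>(1) C \<eta>] by blast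
  define Q where "Q n = measure_pmf.prob (steps p n) {x. real (card {k. k < n \<and> x \<in> visited_once n k}) < c * real n}" for n
  define T where "T n = pi * real n powr (1 / \<beta>) / real d" for n
  have TQ: "(\<lambda>n. T n * Q n) \<longlonglongrightarrow> 0"
  proof (rule tendsto_sandwich[OF _ _ tendsto_const])
    let ?b = "\<lambda>n. real n powr (1 / \<beta>) * (3 * (real (2 * m n + 1) * \<eta> ^ (n div (2 * m n + 1))))"
    show "eventually (\<lambda>n. 0 \<le> T n * Q n) sequentially"
      by (intro always_eventually allI) (simp add: T_def Q_def)
    have "eventually (\<lambda>n. real n * (C * real (m n) powr (- 1 / \<alpha>)) < q0) sequentially"
      using m(2) q0 by (rule order_tendstoD)
    then show "eventually (\<lambda>n. T n * Q n \<le> pi / real d * ?b n) sequentially"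
    proof eventually_elim
      case (elim n)
      then have "Q n \<le> 3 * (real (2 * m n + 1) * \<eta> ^ (n div (2 * m n + 1)))"
        unfolding Q_def by (intro few m(1)) simp
      then have "T n * Q n \<le> T n * (3 * (real (2 * m n + 1) * \<eta> ^ (n div (2 * m n + 1))))"
        by (intro mult_left_mono) (auto simp: T_def)
      then show ?case by (simp add: T_def)
    qed
    have "(\<lambda>n. pi / real d * ?b n) \<longlonglongrightarrow> pi / real d * 0" by (intro tendsto_intros m(3))
    then show "(\<lambda>n. pi / real d * ?b n) \<longlonglongrightarrow> 0" by simp
  qed
  have n\<beta>: "filterlim (\<lambda>n. real n powr (1 / \<beta>)) at_top sequentially"
    using \<beta> by real_asymp
  define a where "a n = (LINT u|lborel. cmod (indicator {- T n..T n} u *\<^sub>R \<Phi> n u - \<Psi> u))" for n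
  have a_lim: "a \<longlonglongrightarrow> 0"
    unfolding a_def
  proof (rule L1_convergence_truncated[where w="\<lambda>u. exp (- (\<sigma> * c) * \<bar>u\<bar> powr \<beta>)" and q=Q])
    show "integrable lborel (\<lambda>u. exp (- (\<sigma> * c) * \<bar>u\<bar> powr \<beta>))"
      using \<sigma> c by (intro integrable_exp_powr \<beta>) simp
    show "filterlim T at_top sequentially"
      unfolding T_def[abs_def] using \<beta> d by real_asymp
    show "cmod (\<Phi> n u) \<le> exp (- (\<sigma> * c) * \<bar>u\<bar> powr \<beta>) + Q n" if n: "1 \<le> n" and u: "\<bar>u\<bar> \<le> T n" for n u
    proof -
      let ?t = "u * real n powr (- 1 / \<beta>)"
      have "\<bar>?t\<bar> \<le> T n * real n powr (- 1 / \<beta>)" using u by (simp add: abs_mult mult_right_mono)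
      also have "\<dots> = pi / real d" using n by (simp add: T_def powr_minus)
      finally have t: "\<bar>?t\<bar> \<le> pi / real d" .
      have "\<bar>?t\<bar> powr \<beta> = \<bar>u\<bar> powr \<beta> * (real n powr (- 1 / \<beta>)) powr \<beta>"
        by (simp add: abs_mult powr_mult)
      also have "(real n powr (- 1 / \<beta>)) powr \<beta> = real n powr (- 1)" unfolding powr_powr using \<beta> by simp
      also have "\<dots> = 1 / real n" using n by (simp add: powr_minus_divide)
      finally have t\<beta>: "\<bar>?t\<bar> powr \<beta> = \<bar>u\<bar> powr \<beta> / real n" by simp
      have "cmod (\<Phi> n u) \<le> exp (- (\<sigma> * \<bar>?t\<bar> powr \<beta> * (c * real n))) + Q n"
        unfolding \<Phi>_def Q_def using \<sigma>(1) \<sigma>(2)[OF t] by (intro norm_rwrs_char_le \<phi>1) auto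
      also have "\<sigma> * \<bar>?t\<bar> powr \<beta> * (c * real n) = \<sigma> * c * \<bar>u\<bar> powr \<beta>"
        unfolding t\<beta> using n by simp
      finally show ?thesis by simp
    qed
  qed (use \<Phi>_meas \<Psi>_int \<Phi>_lim TQ in \<open>auto simp: Q_def T_def\<close>)
  define b where "b = (LINT u|lborel. \<bar>u\<bar> * cmod (\<Psi> u))"
  \<comment> \<open>The error bound of the local limit estimate; it does not involve \<open>x\<close>.\<close>
  define e where "e n = real n powr (- 1 / \<beta>) * (real d / (2 * pi) * (a n + b / real n powr (1 / \<beta>)))" for n
  have e_small: "e \<in> o(\<lambda>n. real n powr (- 1 / \<beta>))"
  proof (rule smalloI_tendsto)
    have "(\<lambda>n. b / real n powr (1 / \<beta>)) \<longlonglongrightarrow> 0"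
      by (rule tendsto_divide_0[OF tendsto_const filterlim_at_top_imp_at_infinity[OF n\<beta>]])
    then have "(\<lambda>n. real d / (2 * pi) * (a n + b / real n powr (1 / \<beta>))) \<longlonglongrightarrow> real d / (2 * pi) * (0 + 0)"
      by (intro tendsto_intros a_lim)
    then have "(\<lambda>n. real d / (2 * pi) * (a n + b / real n powr (1 / \<beta>))) \<longlonglongrightarrow> 0" by simp
    then show "(\<lambda>n. e n / real n powr (- 1 / \<beta>)) \<longlonglongrightarrow> 0"
    proof (rule Lim_transform_eventually)
      show "eventually (\<lambda>n. real d / (2 * pi) * (a n + b / real n powr (1 / \<beta>)) = e n / real n powr (- 1 / \<beta>)) sequentially"
        using eventually_ge_at_top[of 1] by eventually_elim (simp add: e_def)
    qed
    show "eventually (\<lambda>n. real n powr (- 1 / \<beta>) \<noteq> 0) sequentially"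
      using eventually_ge_at_top[of 1] by eventually_elim simp
  qed

  have "cmod (\<phi> (2 * pi / real d)) = 1" using period by (metis mult.right_neutral of_int_1)
  then obtain z where z: "AE \<omega> in M. int d dvd \<xi> 1 \<omega> - z"
    using AE_dvd_of_norm_char_eq_1[OF \<xi>1 d] \<phi>_eq by metis
  have Z_lattice: "AE \<omega> in M. int d dvd scenery_sum \<xi> X n \<omega> - int n * z" for n
    by (rule AE_scenery_sum_lattice[OF iid\<xi> z])
  have dvd_iff: "int d dvd int n * y - k \<longleftrightarrow> int d dvd int n * z - k" if "int d dvd y - z" for n y k
  proof -
    have "int d dvd (int n * y - k) - (int n * z - k)"
      using dvd_mult[OF that, of "int n"] by (simp add: right_diff_distrib)
    then show ?thesis using dvd_diff_commute dvd_diff_right_iff by (metis diff_add_cancel dvd_add_right_iff)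
  qed
  have n\<xi>m: "Measurable.pred M (\<lambda>\<omega>. int d dvd int n * \<xi> 1 \<omega> - k)" for n k
    unfolding pred_def by (rule measurable_sets_Collect[OF \<xi>1]) simp

  have part1: "prob {\<omega> \<in> space M. scenery_sum \<xi> X n \<omega> = k} = 0"
    if one: "prob {\<omega> \<in> space M. \<not> int d dvd int n * \<xi> 1 \<omega> - k} = 1" for n k
  proof -
    have "AE \<omega> in M. \<not> int d dvd int n * \<xi> 1 \<omega> - k"
      using one n\<xi>m by (subst (asm) prob_Collect_eq_1) auto
    with z have "AE \<omega> in M. \<not> int d dvd int n * z - k"
      by eventually_elim (use dvd_iff in blast)
    then have nd: "\<not> int d dvd int n * z - k" by simp
    have "AE \<omega> in M. scenery_sum \<xi> X n \<omega> \<noteq> k"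
      using Z_lattice[of n]
    proof eventually_elim
      case (elim \<omega>)
      then show ?case using nd by (metis dvd_diff_commute)
    qed
    then show ?thesis
      using measurable_sets_Collect[OF Zm, of "\<lambda>y. y = k" n] by (subst prob_Collect_eq_0) auto
  qed
  have part2: "\<bar>prob {\<omega> \<in> space M. scenery_sum \<xi> X n \<omega> = \<lfloor>real n powr (1 / \<beta>) * x\<rfloor>}
      - real d * (D x / real n powr (1 / \<beta>))\<bar> \<le> e n"
    if n: "1 \<le> n" and one: "prob {\<omega> \<in> space M. int d dvd int n * \<xi> 1 \<omega> - \<lfloor>real n powr (1 / \<beta>) * x\<rfloor>} = 1" for n x
  proof -
    define N where "N = real n powr (1 / \<beta>)"
    define k where "k = \<lfloor>N * x\<rfloor>"
    have N: "0 < N" using n by (simp add: N_def)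
    have inv: "real n powr (- 1 / \<beta>) = 1 / N" by (simp add: N_def powr_minus_divide)
    have "AE \<omega> in M. int d dvd int n * \<xi> 1 \<omega> - k"
      using one n\<xi>m unfolding N_def[symmetric] k_def[symmetric] by (subst (asm) prob_Collect_eq_1) auto
    with z have "AE \<omega> in M. int d dvd int n * z - k"
      by eventually_elim (use dvd_iff in blast)
    then have nd: "int d dvd int n * z - k" by simp
    have lattice: "AE \<omega> in M. int d dvd scenery_sum \<xi> X n \<omega> - k"
      using Z_lattice[of n]
    proof eventually_elim
      case (elim \<omega>)
      show ?case using dvd_add[OF elim nd] by simp
    qed
    have "\<bar>real_of_int k - N * x\<bar> \<le> 1" unfolding k_def by linarith
    from local_limit_error[OF Zm d N lattice this \<Psi>_int \<Psi>_int1]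
    have "\<bar>N * prob {\<omega> \<in> space M. scenery_sum \<xi> X n \<omega> = k} - real d * D x\<bar> \<le> real d / (2 * pi) * (a n + b / N)"
      unfolding char_Z D a_def b_def T_def N_def[symmetric] \<Phi>_def inv by simp
    then have "1 / N * \<bar>N * prob {\<omega> \<in> space M. scenery_sum \<xi> X n \<omega> = k} - real d * D x\<bar> \<le> 1 / N * (real d / (2 * pi) * (a n + b / N))"
      using N by (intro mult_left_mono) auto
    also have "\<dots> = e n" unfolding e_def inv N_def[symmetric] ..
    also have "1 / N * \<bar>N * prob {\<omega> \<in> space M. scenery_sum \<xi> X n \<omega> = k} - real d * D x\<bar> =
      \<bar>prob {\<omega> \<in> space M. scenery_sum \<xi> X n \<omega> = k} - real d * (D x / N)\<bar>"
    proof -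
      have "prob {\<omega> \<in> space M. scenery_sum \<xi> X n \<omega> = k} - real d * (D x / N) =
        1 / N * (N * prob {\<omega> \<in> space M. scenery_sum \<xi> X n \<omega> = k} - real d * D x)"
        using N by (simp add: field_simps)
      then show ?thesis using N by (simp add: abs_mult)
    qed
    finally show ?thesis by (simp only: N_def k_def)
  qed
  show ?thesis
    unfolding Let_def v_def[symmetric] r_def[symmetric] D_def[symmetric]
    using part1 part2 e_small by blast
qed

end
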